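(* Let $\rho$ be as in the context with $\psi_*=0$, let the observations $y_i=\mu_\circ+\sigma_\circ\varepsilon_i$, $i=1,\dots,n$, with `good' index sets $\zeta_n$, $|\zeta_n|=h$, $h/n\to\lambda\in(1/2,1]$, be as in the context, let $\hat\sigma$ be a scale estimator and put $\hat\varsigma=\hat\sigma/\sigma_\circ$. Suppose: (1) $\hat\sigma \overset{p}{\to} \varsigma\sigma_\circ$ for some $\varsigma>0$; (2) $h^{-1}\sum_{i\in\zeta_n}\varepsilon_i^2$ is bounded in probability; (3) $h^{-1}\sum_{i\in\zeta_n}\rho(\varepsilon_i/\alpha)\overset{p}{\to}\tilde\rho_\alpha$ uniformly over $\alpha$ in a neighbourhood of $\varsigma$, where $\tilde\rho_\alpha$ is (deterministic and) continuous in $\alpha$; (4) the `outlier' errors satisfy $1/(\min_{j\in\zeta_n^c}\varepsilon_j^2)\overset{p}{\to}0$; (5) $\rho$ is Lipschitz: there is $C>0$ such that $|\rho(x_1)-\rho(x_2)|\le C|x_1-x_2|$ for all $x_1,x_2\in\mathbb{R}$; (6) the minimizers over $\mu\in\mathbb{R}$ of $\sum_{i\in\zeta_n}\rho\{(y_i-\mu)/(\sigma_\circ\varsigma)\}$ belong to a small neighbourhood of $\mu_\circ$ with large probability, i.e. for all $\delta,\epsilon>0$ there is $n_0$ such that for $n\ge n_0$, on an event of probability greater than $1-\epsilon$, all these minimizers lie in $(\mu_\circ-\delta,\mu_\circ+\delta)$; (7) $n^{1/2}(\hat\varsigma-\varsigma)$ is bounded in probability; (8) $\rho$ has a Lipschitz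 continuous second derivative $\ddot\rho$; (9) the errors $\varepsilon_i$, $i\in\zeta_n$, are i.i.d. (with a distribution not depending on $n$), $\mathsf{E}\ddot\rho(\varepsilon_i/\varsigma)>0$, $\mathsf{E}\{\varepsilon_i\ddot\rho(\varepsilon_i/\varsigma)\}=0$ and $\mathsf{Var}\{\varepsilon_i\ddot\rho(\varepsilon_i/\varsigma)\}<\infty$; (10) $\sum_{i\in\zeta_n}\rho\{(y_i-\mu)/(\sigma_\circ\varsigma)\}$ has a measurable minimizer $\hat\mu_{\zeta_n}$ such that $h^{1/2}(\hat\mu_{\zeta_n}-\mu_\circ)\overset{d}{\to}\mathsf{N}(0,\sigma_\circ^2V_\varsigma)$ for some $V_\varsigma>0$, and any other minimizer belongs to a neighbourhood of $\hat\mu_{\zeta_n}$ that shrinks faster than $n^{-1/2}$ with large probability (i.e. for all $\epsilon,\eta>0$ and all large $n$, on an event of probability greater than $1-\epsilon$ every minimizer $m$ satisfies $|m-\hat\mu_{\zeta_n}|\le\eta n^{-1/2}$); (11) $\lambda>1/(2-\tilde\rho_\varsigma/\rho_* )$. Let $R_n(\mu)=\sum_{i=1}^n\rho\{(y_i-\mu)/\hat\sigma\}$, $\mu\in\mathbb{R}$. Then, for sufficiently large $n$, there exist high-probability sets on which all minimizers of $R_n$ lie in a neighbourhood of $\hat\mu_{\zeta_n}$ shrinking faster than $n^{-1/2}$; that is, for all $\epsilon,\eta>0$ there is $n_0$ such that for every $n\ge n_0$ there is an event $\mathcal{S}_n$ with $\mathsf{P}(\mathcal{S}_n)>1-\epsilon$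 on which every minimizer $\hat\mu$ of $R_n$ satisfies $|\hat\mu-\hat\mu_{\zeta_n}|\le\eta n^{-1/2}$. Moreover, a measurable minimizer $\hat\mu$ of $R_n$ exists such that $h^{1/2}(\hat\mu-\mu_\circ)$ is asymptotically $\mathsf{N}(0,\sigma_\circ^2V_\varsigma)$.
   Context: Asymptotic setting. Models are indexed by $n$. For each $n$ there are scalar observations $y_i=\mu_\circ+\sigma_\circ\varepsilon_i$, $i=1,\dots,n$, with fixed $\mu_\circ\in\mathbb{R}$, $\sigma_\circ>0$ and random errors $\varepsilon_i$. There are $h\le n$ `good' observations and $n-h$ `outliers', with $h\to\infty$ as $n\to\infty$ and $h/n\to\lambda$, $1/2<\lambda\le 1$. The set $\zeta_n\subset\{1,\dots,n\}$, $|\zeta_n|=h$, of indices of `good' observations is a deterministic sequence; $\zeta_n^c$ is its complement in $\{1,\dots,n\}$ (indices of `outliers'). When $\zeta_n^c$ is empty, $1/\min_{j\in\zeta_n^c}\varepsilon_j^2$ is read as $0$. Condition on $\rho$. The function $\rho:\mathbb{R}\to\mathbb{R}$ satisfies $\rho(0)=0$, $\rho(x)>0$ for $x\neq 0$, is continuous, symmetric, and non-decreasing in $x>0$, and there are $x_*,\rho_*>0$ and $\psi_*\ge 0$ such that $\rho(x)=\rho_*+\psi_*(|x|-x_* )$ for $|x|\ge x_*$. The scale estimator $\hat\sigma$ is a (measurable) function of the sample. `Bounded in probability' means tight, i.e. $O_p(1)$. *)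

theory Defs
  imports "HOL-Probability.Probability"
begin

definition rho_condition :: "(real \<Rightarrow> real) \<Rightarrow> real \<Rightarrow> real \<Rightarrow> real \<Rightarrow> bool" where
  "rho_condition \<rho> x_star rho_star psi_star \<longleftrightarrow>
     \<rho> 0 = 0 \<and> (\<forall>x. x \<noteq> 0 \<longrightarrow> \<rho> x > 0) \<and> continuous_on UNIV \<rho> \<and>
     (\<forall>x. \<rho> (- x) = \<rho> x) \<and> mono_on {0<..} \<rho> \<and>
     x_star > 0 \<and> rho_star > 0 \<and> psi_star \<ge> 0 \<and>
     (\<forall>x. \<bar>x\<bar> \<ge> x_star \<longrightarrow> \<rho> x = rho_star + psi_star * (\<bar>x\<bar> - x_star))"

definition obs :: "real \<Rightarrow> real \<Rightarrow> (nat \<Rightarrow> nat \<Rightarrow> 'a \<Rightarrow> real) \<Rightarrow> nat \<Rightarrow> 'a \<Rightarrow> nat \<Rightarrow> real" where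
  "obs \<mu>0 \<sigma>0 \<epsilon> n \<omega> i = \<mu>0 + \<sigma>0 * \<epsilon> n i \<omega>"

definition objective :: "(real \<Rightarrow> real) \<Rightarrow> nat set \<Rightarrow> (nat \<Rightarrow> real) \<Rightarrow> real \<Rightarrow> real \<Rightarrow> real" where
  "objective \<rho> I y s \<mu> = (\<Sum>i\<in>I. \<rho> ((y i - \<mu>) / s))"

abbreviation minimizer :: "(real \<Rightarrow> real) \<Rightarrow> real \<Rightarrow> bool" where
  "minimizer f m \<equiv> is_arg_min f (\<lambda>_. True) m"

text \<open>
  The models are indexed by \<open>n\<close>, each with its own probability space \<open>M n\<close>.
  The events with large probability are required to be measurable, while the property
  \<open>P n\<close> itself need not define a measurable set.
\<close>

definition with_large_prob :: "(nat \<Rightarrow> 'a measure) \<Rightarrow> (nat \<Rightarrow> 'a \<Rightarrow> bool) \<Rightarrow> bool" where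
  "with_large_prob M P \<longleftrightarrow>
     (\<forall>e>0. \<exists>n0. \<forall>n\<ge>n0. \<exists>S\<in>sets (M n). measure (M n) S > 1 - e \<and> (\<forall>\<omega>\<in>S. P n \<omega>))"

definition conv_in_prob :: "(nat \<Rightarrow> 'a measure) \<Rightarrow> (nat \<Rightarrow> 'a \<Rightarrow> real) \<Rightarrow> real \<Rightarrow> bool" where
  "conv_in_prob M X c \<longleftrightarrow>
     (\<forall>d>0. (\<lambda>n. measure (M n) {\<omega>\<in>space (M n). \<bar>X n \<omega> - c\<bar> > d}) \<longlonglongrightarrow> 0)"

definition null_in_prob :: "(nat \<Rightarrow> 'a measure) \<Rightarrow> (nat \<Rightarrow> 'a \<Rightarrow> ennreal) \<Rightarrow> bool" where
  "null_in_prob M X \<longleftrightarrow>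
     (\<forall>d::real>0. (\<lambda>n. measure (M n) {\<omega>\<in>space (M n). X n \<omega> > ennreal d}) \<longlonglongrightarrow> 0)"

text \<open>
  Uniform convergence in probability: the supremum over \<open>A\<close> of the absolute deviation is at most
  \<open>d\<close> with large probability, for every \<open>d > 0\<close>.
\<close>

definition unif_conv_in_prob ::
  "(nat \<Rightarrow> 'a measure) \<Rightarrow> real set \<Rightarrow> (nat \<Rightarrow> 'a \<Rightarrow> real \<Rightarrow> real) \<Rightarrow> (real \<Rightarrow> real) \<Rightarrow> bool" where
  "unif_conv_in_prob M A X f \<longleftrightarrow>
     (\<forall>d>0. with_large_prob M (\<lambda>n \<omega>. \<forall>\<alpha>\<in>A. \<bar>X n \<omega> \<alpha> - f \<alpha>\<bar> \<le> d))"

text \<open>Bounded in probability is the library's tightness of the sequence of laws.\<close>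

definition bounded_in_prob :: "(nat \<Rightarrow> 'a measure) \<Rightarrow> (nat \<Rightarrow> 'a \<Rightarrow> real) \<Rightarrow> bool" where
  "bounded_in_prob M X \<longleftrightarrow> tight (\<lambda>n. distr (M n) borel (X n))"

definition asymp_normal :: "(nat \<Rightarrow> 'a measure) \<Rightarrow> (nat \<Rightarrow> 'a \<Rightarrow> real) \<Rightarrow> real \<Rightarrow> real \<Rightarrow> bool" where
  "asymp_normal M X m v \<longleftrightarrow>
     weak_conv_m (\<lambda>n. distr (M n) borel (X n)) (density lborel (normal_density m (sqrt v)))"

text \<open>
  The reciprocal of the smallest squared outlier error is taken in \<^typ>\<open>ennreal\<close>, so that it is
  infinite when some outlier error vanishes, and zero when there are no outliers
  (the infimum of the empty set is infinite). Division on the reals would give \<open>1 / 0 = 0\<close>.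
\<close>

definition inv_min_sq_outlier ::
  "(nat \<Rightarrow> nat set) \<Rightarrow> (nat \<Rightarrow> nat \<Rightarrow> 'a \<Rightarrow> real) \<Rightarrow> nat \<Rightarrow> 'a \<Rightarrow> ennreal" where
  "inv_min_sq_outlier \<zeta> \<epsilon> n \<omega> = 1 / (INF j\<in>{1..n} - \<zeta> n. ennreal ((\<epsilon> n j \<omega>)\<^sup>2))"

lemma inv_min_sq_outlier_no_outliers: "{1..n} - \<zeta> n = {} \<Longrightarrow> inv_min_sq_outlier \<zeta> \<epsilon> n \<omega> = 0"
  unfolding inv_min_sq_outlier_def by (simp only: image_empty Inf_empty) simp

lemma inv_min_sq_outlier_zero_error:
  assumes "j \<in> {1..n} - \<zeta> n" "\<epsilon> n j \<omega> = 0"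
  shows "inv_min_sq_outlier \<zeta> \<epsilon> n \<omega> = \<infinity>"
proof -
  have "(INF j\<in>{1..n} - \<zeta> n. ennreal ((\<epsilon> n j \<omega>)\<^sup>2)) \<le> ennreal ((\<epsilon> n j \<omega>)\<^sup>2)"
    by (rule INF_lower) (fact assms(1))
  then have "(INF j\<in>{1..n} - \<zeta> n. ennreal ((\<epsilon> n j \<omega>)\<^sup>2)) = 0"
    using assms(2) by simp
  then show ?thesis
    unfolding inv_min_sq_outlier_def by (simp only:) (simp add: divide_ennreal_def)
qed

end

theory Submission
  imports Defs
begin

text \<open>
  With probability tending to one the breakdown condition confines the minimizers of \<open>R\<^sub>n\<close> to a bounded
  interval, where every outlier contributes exactly \<open>\<rho>\<^sub>*\<close> and so drops out. What remains is the good
  objective at the scale \<open>\<sigma>\<close>-hat, which is uniformly close to the one at scale \<open>\<varsigma> \<sigma>\<^sub>\<circ>\<close>.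

  Hypothesis (6) concerns exact minimizers only, so that near-minimizers are close to \<open>\<mu>\<^sub>\<circ>\<close> has to be derived:
  the population objective has a unique minimum at \<open>\<mu>\<^sub>\<circ>\<close>, since at a second one the central limit theorem
  would let the good objective drop below its value near \<open>\<mu>\<^sub>\<circ>\<close> with nonvanishing probability.

  Near \<open>\<mu>\<^sub>\<circ>\<close> the score has slope bounded away from zero in the location, while its slope in the scale tends to zero
  because \<open>E {\<epsilon> \<rho>''(\<epsilon> / \<varsigma>)} = 0\<close>. A scale error of order \<open>n\<^sup>-\<^sup>1\<^sup>/\<^sup>2\<close> therefore moves the
  minimizer by \<open>o(n\<^sup>-\<^sup>1\<^sup>/\<^sup>2)\<close> only, and Slutsky's lemma transfers the asymptotic normality.
\<close>

section \<open>Events of large probability\<close>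

text \<open>All estimates are made in the standardised location
  \<open>t = (\<mu> - \<mu>0) / \<sigma>0\<close> and the inverse scale
  \<open>a = \<sigma>0 / sigma_hat\<close>, with target \<open>b = 1 / varsig\<close>: the residuals
  \<open>a * (e - t)\<close> are then linear in \<open>a\<close> and in \<open>t\<close> separately,
  which suits the mean value theorem.

  The breakdown condition is a comparison of costs. At the truth the good observations cost about
  \<open>h * rho_tilde varsig\<close> and each of the \<open>n - h\<close> outliers at most
  \<open>rho_star\<close>. Far away the good observations alone cost nearly
  \<open>h * rho_star\<close>, while the outliers may cost nothing. The truth wins if
  \<open>h * rho_tilde varsig + (n - h) * rho_star < h * rho_star\<close>; dividing by
  \<open>n\<close> gives \<open>\<Lambda> * (2 - rho_tilde varsig / rho_star) > 1\<close> in the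
  limit.

  Uniqueness of the population minimum rests on a clash of orders. The good objective at \<mu>0
  exceeds its minimum by a bounded amount only, because \<open>h\<close> times the squared error of
  its minimizer is bounded in probability. The difference of two objective values with equal means
  and a nondegenerate summand, however, fluctuates by the order of the square root of
  \<open>h\<close>, in both directions.\<close>

definition likely :: "(nat \<Rightarrow> 'a measure) \<Rightarrow> real \<Rightarrow> (nat \<Rightarrow> 'a \<Rightarrow> bool) \<Rightarrow> bool" where
  "likely M e P \<longleftrightarrow>
     (\<exists>n0. \<forall>n\<ge>n0. \<exists>S\<in>sets (M n). measure (M n) S > 1 - e \<and> (\<forall>\<omega>\<in>S. P n \<omega>))"

lemma with_large_prob_iff_likely: "with_large_prob M P \<longleftrightarrow> (\<forall>e>0. likely M e P)"
  by (simp add: with_large_prob_def likely_def)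

lemma likely_mono:
  assumes "likely M e P"
    and "\<forall>\<^sub>F n in sequentially. \<forall>\<omega>\<in>space (M n). P n \<omega> \<longrightarrow> Q n \<omega>"
  shows "likely M e Q"
proof -
  obtain n0 where n0: "\<And>n. n \<ge> n0 \<Longrightarrow>
      \<exists>S\<in>sets (M n). measure (M n) S > 1 - e \<and> (\<forall>\<omega>\<in>S. P n \<omega>)"
    using assms(1) unfolding likely_def by blast
  obtain n1 where n1: "\<And>n \<omega>. n \<ge> n1 \<Longrightarrow> \<omega> \<in> space (M n) \<Longrightarrow> P n \<omega> \<Longrightarrow> Q n \<omega>"
    using assms(2) unfolding eventually_sequentially by blast
  show ?thesis
    unfolding likely_def
  proof (intro exI[of _ "max n0 n1"] allI impI)
    fix n assume n: "max n0 n1 \<le> n"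
    with n0 obtain S where S: "S \<in> sets (M n)" "measure (M n) S > 1 - e" "\<forall>\<omega>\<in>S. P n \<omega>"
      by (meson max.boundedE)
    moreover have "\<forall>\<omega>\<in>S. Q n \<omega>"
      using S(1,3) n sets.sets_into_space n1 by fastforce
    ultimately show "\<exists>S\<in>sets (M n). 1 - e < measure (M n) S \<and> (\<forall>\<omega>\<in>S. Q n \<omega>)"
      by blast
  qed
qed

lemma likely_conj:
  assumes prob: "\<And>n. prob_space (M n)" and P: "likely M e P" and Q: "likely M e' Q"
  shows "likely M (e + e') (\<lambda>n \<omega>. P n \<omega> \<and> Q n \<omega>)"
proof -
  obtain n0 where n0: "\<And>n. n \<ge> n0 \<Longrightarrow>
      \<exists>S\<in>sets (M n). measure (M n) S > 1 - e \<and> (\<forall>\<omega>\<in>S. P n \<omega>)"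
    using P unfolding likely_def by blast
  obtain n1 where n1: "\<And>n. n \<ge> n1 \<Longrightarrow>
      \<exists>S\<in>sets (M n). measure (M n) S > 1 - e' \<and> (\<forall>\<omega>\<in>S. Q n \<omega>)"
    using Q unfolding likely_def by blast
  show ?thesis
    unfolding likely_def
  proof (intro exI[of _ "max n0 n1"] allI impI)
    fix n assume n: "max n0 n1 \<le> n"
    interpret prob_space "M n" by (rule prob)
    obtain S where S: "S \<in> events" "prob S > 1 - e" "\<forall>\<omega>\<in>S. P n \<omega>"
      using n0 n by (meson max.boundedE)
    obtain S' where S': "S' \<in> events" "prob S' > 1 - e'" "\<forall>\<omega>\<in>S'. Q n \<omega>"
      using n1 n by (meson max.boundedE)
    have "prob (S \<inter> S') = prob S + prob S' - prob (S \<union> S')"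
      using finite_measure_Union'[of S S'] finite_measure_Diff'[of S' S] S(1) S'(1)
      by (simp add: Int_commute)
    then have "prob (S \<inter> S') > 1 - (e + e')"
      using S(2) S'(2) prob_le_1[of "S \<union> S'"] by linarith
    then show "\<exists>S\<in>events. 1 - (e + e') < prob S \<and> (\<forall>\<omega>\<in>S. P n \<omega> \<and> Q n \<omega>)"
      using S S' by (intro bexI[of _ "S \<inter> S'"]) auto
  qed
qed

text \<open>An event of positive probability is nonempty. This supplies a sample point at which
  several limits hold at once, so that a relation between deterministic limits follows from plain
  inequalities.\<close>

lemma likely_satisfiable:
  assumes "likely M e P" "e \<le> 1"
  shows "\<forall>\<^sub>F n in sequentially. \<exists>\<omega>\<in>space (M n). P n \<omega>"
proof -
  obtain n0 where n0: "\<And>n. n \<ge> n0 \<Longrightarrow>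
      \<exists>S\<in>sets (M n). measure (M n) S > 1 - e \<and> (\<forall>\<omega>\<in>S. P n \<omega>)"
    using assms(1) unfolding likely_def by blast
  have "\<exists>\<omega>\<in>space (M n). P n \<omega>" if n: "n \<ge> n0" for n
  proof -
    obtain S where S: "S \<in> sets (M n)" "measure (M n) S > 1 - e" "\<forall>\<omega>\<in>S. P n \<omega>"
      using n0[OF n] by blast
    then have "S \<noteq> {}" using assms(2) by fastforce
    then show ?thesis using S sets.sets_into_space by fastforce
  qed
  then show ?thesis unfolding eventually_sequentially by blast
qed

lemma with_large_prob_mono:
  assumes "with_large_prob M P"
    and "\<forall>\<^sub>F n in sequentially. \<forall>\<omega>\<in>space (M n). P n \<omega> \<longrightarrow> Q n \<omega>"
  shows "with_large_prob M Q"
  using assms likely_mono unfolding with_large_prob_iff_likely by blast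

lemma with_large_prob_conj:
  assumes "\<And>n. prob_space (M n)" "with_large_prob M P" "with_large_prob M Q"
  shows "with_large_prob M (\<lambda>n \<omega>. P n \<omega> \<and> Q n \<omega>)"
  unfolding with_large_prob_iff_likely
proof (intro allI impI)
  fix e :: real assume "e > 0"
  then have "likely M (e/2 + e/2) (\<lambda>n \<omega>. P n \<omega> \<and> Q n \<omega>)"
    using assms(2,3) unfolding with_large_prob_iff_likely
    by (intro likely_conj assms(1)) auto
  then show "likely M e (\<lambda>n \<omega>. P n \<omega> \<and> Q n \<omega>)" by simp
qed

text \<open>Serves the finite net in the uniform law of large numbers.\<close>

lemma with_large_prob_Ball_finite:
  assumes prob: "\<And>n. prob_space (M n)" and "finite F" and "\<And>x. x \<in> F \<Longrightarrow> with_large_prob M (\<lambda>n. P n x)"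
  shows "with_large_prob M (\<lambda>n \<omega>. \<forall>x\<in>F. P n x \<omega>)"
  using assms(2,3)
proof (induction F rule: finite_induct)
  case empty
  show ?case
    unfolding with_large_prob_def
    by (auto intro!: exI bexI[of _ "space (M n)" for n] simp: prob_space.prob_space[OF prob])
next
  case (insert x F)
  then have "with_large_prob M (\<lambda>n \<omega>. P n x \<omega> \<and> (\<forall>x\<in>F. P n x \<omega>))"
    by (intro with_large_prob_conj prob) auto
  then show ?case by simp
qed

lemma with_large_prob_if_tendsto_0:
  assumes prob: "\<And>n. prob_space (M n)"
    and meas: "\<And>n. {\<omega>\<in>space (M n). \<not> P n \<omega>} \<in> sets (M n)"
    and lim: "(\<lambda>n. measure (M n) {\<omega>\<in>space (M n). \<not> P n \<omega>}) \<longlonglongrightarrow> 0"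
  shows "with_large_prob M P"
  unfolding with_large_prob_def
proof (intro allI impI)
  fix e :: real assume "e > 0"
  with lim have "\<forall>\<^sub>F n in sequentially. measure (M n) {\<omega>\<in>space (M n). \<not> P n \<omega>} < e"
    by (rule order_tendstoD)
  then obtain n0 where n0: "\<And>n. n \<ge> n0 \<Longrightarrow> measure (M n) {\<omega>\<in>space (M n). \<not> P n \<omega>} < e"
    unfolding eventually_sequentially by blast
  show "\<exists>n0. \<forall>n\<ge>n0. \<exists>S\<in>sets (M n). 1 - e < measure (M n) S \<and> (\<forall>\<omega>\<in>S. P n \<omega>)"
  proof (intro exI[of _ n0] allI impI)
    fix n assume n: "n0 \<le> n"
    interpret prob_space "M n" by (rule prob)
    let ?S = "space (M n) - {\<omega>\<in>space (M n). \<not> P n \<omega>}"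
    have "prob ?S > 1 - e"
      using n0[OF n] prob_compl[OF meas] by simp
    then show "\<exists>S\<in>events. 1 - e < prob S \<and> (\<forall>\<omega>\<in>S. P n \<omega>)"
      using meas[of n] by (intro bexI[of _ ?S]) auto
  qed
qed

text \<open>The bound \<open>K\<close> depends on the level \<open>e\<close>. Arguments that use
  such bounds therefore run at one fixed level, which is why \<open>likely\<close> keeps
  \<open>e\<close> as a parameter instead of quantifying over it.\<close>

lemma bounded_in_prob_likely:
  assumes prob: "\<And>n. prob_space (M n)" and meas: "\<And>n. X n \<in> borel_measurable (M n)"
    and "bounded_in_prob M X" "e > 0"
  obtains K where "K > 0" "likely M e (\<lambda>n \<omega>. \<bar>X n \<omega>\<bar> \<le> K)"
proof -
  obtain a b where ab: "a < b" "\<And>n. measure (distr (M n) borel (X n)) {a<..b} > 1 - e"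
    using assms(3,4) unfolding bounded_in_prob_def tight_def by blast
  let ?K = "max \<bar>a\<bar> \<bar>b\<bar> + 1"
  have "likely M e (\<lambda>n \<omega>. \<bar>X n \<omega>\<bar> \<le> ?K)"
    unfolding likely_def
  proof (intro exI[of _ 0] allI impI)
    fix n
    have "measure (M n) (X n -` {a<..b} \<inter> space (M n)) > 1 - e"
      using ab(2)[of n] meas[of n] by (simp add: measure_distr)
    moreover have "X n -` {a<..b} \<inter> space (M n) \<in> sets (M n)"
      using meas[of n] by (rule measurable_sets) simp
    ultimately show "\<exists>S\<in>sets (M n). 1 - e < measure (M n) S \<and> (\<forall>\<omega>\<in>S. \<bar>X n \<omega>\<bar> \<le> ?K)"
      by (intro bexI[of _ "X n -` {a<..b} \<inter> space (M n)"]) auto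
  qed
  then show ?thesis by (intro that[of ?K]) auto
qed

section \<open>Convergence to normal laws through distribution functions\<close>

lemma measure_singleton_normal: 
  assumes "0 < s"
  shows "measure (density lborel (normal_density m s)) {x} = 0"
proof -
  have "AE y in lborel. y \<notin> {x}"
    by (intro AE_not_in) auto
  then have "emeasure (density lborel (normal_density m s)) {x} = 0"
    by (subst emeasure_density) (auto intro!: nn_integral_0_iff_AE[THEN iffD2] simp: indicator_def)
  then show ?thesis by (simp add: measure_def)
qed

lemma real_distribution_normal:
  assumes "0 < s"
  shows "real_distribution (density lborel (normal_density m s))"
  using prob_space_normal_density[OF assms] 
  by (simp add: real_distribution_def real_distribution_axioms_def)

text \<open>A normal law has no atoms, so its distribution function is continuous and the
  restriction to continuity points disappears.\<close>

lemma asymp_normal_iff_cdf: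
  assumes "v > 0"
  shows "asymp_normal M X m v \<longleftrightarrow>
    (\<forall>x. (\<lambda>n. cdf (distr (M n) borel (X n)) x) \<longlonglongrightarrow> cdf (density lborel (normal_density m (sqrt v))) x)"
proof -
  interpret real_distribution "density lborel (normal_density m (sqrt v))"
    by (rule real_distribution_normal) (use assms in simp)
  have "isCont (cdf (density lborel (normal_density m (sqrt v)))) x" for x
    using isCont_cdf measure_singleton_normal[of "sqrt v"] assms by simp
  then show ?thesis
    unfolding asymp_normal_def weak_conv_m_def weak_conv_def by simp
qed

text \<open>One half of Slutsky's sandwich; exchanging \<open>X\<close> and \<open>Y\<close> gives
  the other half.\<close>

lemma cdf_distr_le:
  assumes "prob_space M" "X \<in> borel_measurable M"  "Y \<in> borel_measurable M" "S \<in> sets M"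
    and "measure M S > 1 - e" "\<And>\<omega>. \<omega> \<in> S \<Longrightarrow> \<bar>X \<omega> - Y \<omega>\<bar> \<le> d"
  shows "cdf (distr M borel Y) x \<le> cdf (distr M borel X) (x + d) + e"
proof -
  interpret prob_space M by fact
  have [measurable]: "X \<in> borel_measurable M" "Y \<in> borel_measurable M" by fact+
  let ?A = "{\<omega>\<in>space M. X \<omega> \<le> x + d}" and ?B = "{\<omega>\<in>space M. Y \<omega> \<le> x}"
  have eq: "cdf (distr M borel Y) x = prob ?B" "cdf (distr M borel X) (x + d) = prob ?A"
    by (auto simp: cdf_def measure_distr intro!: arg_cong[where f=prob])
  have "?B \<subseteq> ?A \<union> (space M - S)"
    using assms(6) by fastforce
  then have "prob ?B \<le> prob (?A \<union> (space M - S))"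
    using assms(4) by (intro finite_measure_mono) auto
  also have "\<dots> \<le> prob ?A + prob (space M - S)"
    using assms(4) by (intro measure_Un_le) auto
  also have "prob (space M - S) \<le> e"
    using prob_compl[OF assms(4)] assms(5) by simp
  finally show ?thesis unfolding eq by simp
qed

text \<open>Slutsky's argument on distribution functions: \<open>F_X (x - d) - e \<le> F_Y x \<le> F_X (x + d) + e\<close>.\<close>

lemma asymp_normal_perturb:
  assumes prob: "\<And>n. prob_space (M n)"
    and X: "\<And>n. X n \<in> borel_measurable (M n)" and Y: "\<And>n. Y n \<in> borel_measurable (M n)"
    and v: "v > 0" and norm: "asymp_normal M X m v"
    and close: "\<And>d. d > 0 \<Longrightarrow> with_large_prob M (\<lambda>n \<omega>. \<bar>X n \<omega> - Y n \<omega>\<bar> \<le> d)"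
  shows "asymp_normal M Y m v"
  unfolding asymp_normal_iff_cdf[OF v]
proof
  fix x
  let ?N = "density lborel (normal_density m (sqrt v))"
  interpret N: real_distribution ?N
    by (rule real_distribution_normal) (use v in simp)
  have cont: "isCont (cdf ?N) x"
    using N.isCont_cdf measure_singleton_normal[of "sqrt v"] v by simp
  have lim: "(\<lambda>n. cdf (distr (M n) borel (X n)) y) \<longlonglongrightarrow> cdf ?N y" for y
    using norm unfolding asymp_normal_iff_cdf[OF v] by blast
  show "(\<lambda>n. cdf (distr (M n) borel (Y n)) x) \<longlonglongrightarrow> cdf ?N x"
  proof (rule tendstoI)
    fix e :: real assume e: "e > 0"
    then have "e/4 > 0" by simp
    from cont[unfolded continuous_at_eps_delta, rule_format, OF this]
    obtain d0 where d0: "d0 > 0" "\<And>y. \<bar>y - x\<bar> < d0 \<Longrightarrow> \<bar>cdf ?N y - cdf ?N x\<bar> < e/4"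
      by (auto simp: dist_real_def)
    \<comment> \<open>The budget is three times \<open>e/4\<close>: for the exceptional event, for
      the convergence at the shifted point and for the continuity of the limit.\<close>
    define d where "d = d0/2"
    have d: "d > 0" "\<bar>cdf ?N (x + d) - cdf ?N x\<bar> < e/4" "\<bar>cdf ?N (x - d) - cdf ?N x\<bar> < e/4"
      using d0(1) d0(2)[of "x + d"] d0(2)[of "x - d"] by (auto simp: d_def)
    have "likely M (e/4) (\<lambda>n \<omega>. \<bar>X n \<omega> - Y n \<omega>\<bar> \<le> d)"
      using close[OF d(1)] e unfolding with_large_prob_iff_likely by simp
    then have 1: "\<forall>\<^sub>F n in sequentially. \<exists>S\<in>sets (M n). measure (M n) S > 1 - e/4 \<and>
        (\<forall>\<omega>\<in>S. \<bar>X n \<omega> - Y n \<omega>\<bar> \<le> d)"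
      unfolding likely_def eventually_sequentially by blast
    have 2: "\<forall>\<^sub>F n in sequentially. dist (cdf (distr (M n) borel (X n)) (x + d)) (cdf ?N (x + d)) < e/4"
      using e by (intro tendstoD[OF lim]) simp
    have 3: "\<forall>\<^sub>F n in sequentially. dist (cdf (distr (M n) borel (X n)) (x - d)) (cdf ?N (x - d)) < e/4"
      using e by (intro tendstoD[OF lim]) simp
    from 1 2 3 show "\<forall>\<^sub>F n in sequentially. dist (cdf (distr (M n) borel (Y n)) x) (cdf ?N x) < e"
    proof eventually_elim
      case (elim n)
      then obtain S where S: "S \<in> sets (M n)" "measure (M n) S > 1 - e/4"
        "\<And>\<omega>. \<omega> \<in> S \<Longrightarrow> \<bar>X n \<omega> - Y n \<omega>\<bar> \<le> d" by blast
      have "cdf (distr (M n) borel (Y n)) x \<le> cdf (distr (M n) borel (X n)) (x + d) + e/4"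
        by (rule cdf_distr_le[OF prob X Y S])
      moreover have "cdf (distr (M n) borel (X n)) (x - d) \<le> cdf (distr (M n) borel (Y n)) ((x - d) + d) + e/4"
        using S(3) by (intro cdf_distr_le[OF prob Y X S(1,2)]) (simp add: abs_minus_commute)
      ultimately show ?case
        using elim(2,3) d(2,3) unfolding dist_real_def by (simp only: diff_add_cancel)
    qed
  qed
qed

text \<open>The limit law puts more than \<open>1 - e\<close> on some interval from
  \<open>-K\<close> to \<open>K\<close>, and the distribution functions converge at both
  endpoints.\<close>

lemma asymp_normal_likely_bounded:
  assumes prob: "\<And>n. prob_space (M n)" and X: "\<And>n. X n \<in> borel_measurable (M n)"
    and v: "v > 0" and norm: "asymp_normal M X m v" and e: "e > 0"
  obtains K where "K > 0" "likely M e (\<lambda>n \<omega>. \<bar>X n \<omega>\<bar> \<le> K)"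
proof -
  let ?N = "density lborel (normal_density m (sqrt v))"
  let ?F = "\<lambda>n. cdf (distr (M n) borel (X n))"
  interpret N: real_distribution ?N
    by (rule real_distribution_normal) (use v in simp)
  have lim: "(\<lambda>n. ?F n y) \<longlonglongrightarrow> cdf ?N y" for y
    using norm unfolding asymp_normal_iff_cdf[OF v] by blast
  have "\<forall>\<^sub>F y in at_top. cdf ?N y > 1 - e/2" "\<forall>\<^sub>F y in at_top. cdf ?N (- y) < e/2"
    using order_tendstoD(1)[OF N.cdf_lim_at_top_prob, of "1 - e/2"] e
      order_tendstoD(2)[OF N.cdf_lim_at_bot, of "e/2"]
    by (auto simp: at_bot_mirror eventually_filtermap)
  then have "\<forall>\<^sub>F y in at_top. cdf ?N y > 1 - e/2 \<and> cdf ?N (- y) < e/2 \<and> y > 0"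
    using eventually_gt_at_top[of "0::real"] by eventually_elim simp
  then obtain K where K: "cdf ?N K > 1 - e/2" "cdf ?N (- K) < e/2" "K > 0"
    by (metis (no_types, lifting) eventually_happens trivial_limit_at_top_linorder)
  have "\<forall>\<^sub>F n in sequentially. ?F n K > 1 - e/2" "\<forall>\<^sub>F n in sequentially. ?F n (- K) < e/2"
    using order_tendstoD(1)[OF lim K(1)] order_tendstoD(2)[OF lim K(2)] by auto
  then have "\<forall>\<^sub>F n in sequentially. ?F n K - ?F n (- K) > 1 - e"
    by eventually_elim argo
  moreover have "\<exists>S\<in>sets (M n). measure (M n) S > 1 - e \<and> (\<forall>\<omega>\<in>S. \<bar>X n \<omega>\<bar> \<le> K)"
    if "?F n K - ?F n (- K) > 1 - e" for n
  proof -
    interpret prob_space "M n" by (rule prob)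
    note [measurable] = X
    interpret D: real_distribution "distr (M n) borel (X n)"
      by (rule real_distribution_distr) simp
    let ?S = "X n -` {-K<..K} \<inter> space (M n)"
    have "?F n K - ?F n (- K) = prob ?S"
      using K(3) by (subst D.cdf_diff_eq) (auto simp: measure_distr)
    then show ?thesis
      using that by (intro bexI[of _ ?S]) auto
  qed
  ultimately have "likely M e (\<lambda>n \<omega>. \<bar>X n \<omega>\<bar> \<le> K)"
    unfolding likely_def eventually_sequentially by blast
  then show ?thesis using K(3) that by blast
qed

text \<open>The density vanishes nowhere, so a null half-line would have Lebesgue measure zero.
  Positivity makes the probability of a large downward fluctuation nonvanishing.\<close>

lemma cdf_std_normal_pos: "cdf std_normal_distribution x > 0"
proof -
  interpret real_distribution std_normal_distribution by (rule real_dist_normal_dist)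
  have "emeasure std_normal_distribution {..x} \<noteq> 0"
  proof
    assume "emeasure std_normal_distribution {..x} = 0"
    then have "AE y in lborel. ennreal (std_normal_density y) * indicator {..x} y = 0"
      by (subst (asm) emeasure_density) (simp_all add: nn_integral_0_iff_AE)
    then have "AE y in lborel. y \<notin> {..x}"
      by eventually_elim (auto simp: indicator_def normal_density_def split: if_splits)
    then have "emeasure lborel {..x} = 0"
      by (subst (asm) AE_iff_measurable[where N="{..x}"]) auto
    then have "emeasure lborel {x-1..x} = 0"
      using emeasure_mono[of "{x-1..x}" "{..x}" lborel] by auto
    then show False by simp
  qed
  then show ?thesis
    by (simp add: cdf_def emeasure_eq_measure zero_less_measure_iff)
qed

section \<open>Averages over rows of i.i.d. errors\<close>

text \<open>An empty or infinite index set gives 0, through division by zero. Facts about constants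
  therefore ask for \<open>card Z > 0\<close>, which also encodes finiteness.\<close>

definition avg :: "'i set \<Rightarrow> ('i \<Rightarrow> real) \<Rightarrow> real" where
  "avg Z f = (\<Sum>i\<in>Z. f i) / real (card Z)"

lemma avg_add: "avg Z (\<lambda>i. f i + g i) = avg Z f + avg Z g"
  by (simp add: avg_def sum.distrib add_divide_distrib)

lemma avg_diff: "avg Z (\<lambda>i. f i - g i) = avg Z f - avg Z g"
  by (simp add: avg_def sum_subtractf diff_divide_distrib)

lemma avg_cmult: "avg Z (\<lambda>i. c * f i) = c * avg Z f"
  by (simp add: avg_def sum_distrib_left)

lemma avg_const: "card Z > 0 \<Longrightarrow> avg Z (\<lambda>i. c) = c"
  by (simp add: avg_def)

lemma avg_mono: "(\<And>i. i \<in> Z \<Longrightarrow> f i \<le> g i) \<Longrightarrow> avg Z f \<le> avg Z g"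
  unfolding avg_def by (intro divide_right_mono sum_mono) auto

lemma abs_avg_le: "\<bar>avg Z f\<bar> \<le> avg Z (\<lambda>i. \<bar>f i\<bar>)"
  unfolding avg_def abs_divide by (auto intro!: divide_right_mono sum_abs)

lemma sum_eq_card_avg: "card Z > 0 \<Longrightarrow> (\<Sum>i\<in>Z. f i) = real (card Z) * avg Z f"
  by (simp add: avg_def)

text \<open>Lets a bound on the mean square, all that is known to be bounded in probability, control
  first absolute moments as well.\<close>

lemma avg_abs_le_square: 
  assumes "card Z > 0"
  shows "avg Z (\<lambda>i. \<bar>e i\<bar>) \<le> 1 + avg Z (\<lambda>i. (e i)\<^sup>2)"
proof -
  have "\<bar>x\<bar> \<le> 1 + x\<^sup>2" for x :: real
    using sum_squares_bound[of "\<bar>x\<bar>" 1] by simp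
  then have "avg Z (\<lambda>i. \<bar>e i\<bar>) \<le> avg Z (\<lambda>i. 1 + (e i)\<^sup>2)"
    by (intro avg_mono) simp
  then show ?thesis using assms by (simp add: avg_add avg_const)
qed

lemma minimizer_iff: "minimizer f m \<longleftrightarrow> (\<forall>u. f m \<le> f u)" for f :: "real \<Rightarrow> real"
  by (simp add: is_arg_min_linorder)

text \<open>The rows live on unrelated probability spaces; only the common law \<open>D\<close>
  connects them.\<close>

locale iid_rows =
  fixes M :: "nat \<Rightarrow> 'a measure" and \<zeta> :: "nat \<Rightarrow> 'i set"
    and \<epsilon> :: "nat \<Rightarrow> 'i \<Rightarrow> 'a \<Rightarrow> real" and D :: "real measure"
  assumes prob: "\<And>n. prob_space (M n)"
    and h_infinity: "filterlim (\<lambda>n. card (\<zeta> n)) at_top sequentially"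
    and indep: "\<And>n. prob_space.indep_vars (M n) (\<lambda>_. borel) (\<epsilon> n) (\<zeta> n)"
    and law: "\<And>n i. i \<in> \<zeta> n \<Longrightarrow> distr (M n) borel (\<epsilon> n i) = D"
begin

lemma eventually_card_pos: "\<forall>\<^sub>F n in sequentially. card (\<zeta> n) > 0"
  using h_infinity[unfolded filterlim_at_top, rule_format, of 1] by eventually_elim simp

lemma measurable_errors:
  assumes "i \<in> \<zeta> n"
  shows "\<epsilon> n i \<in> borel_measurable (M n)"
proof -
  interpret prob_space "M n" by (rule prob)
  show ?thesis using indep[of n] assms unfolding indep_vars_def2 by blast
qed

text \<open>\<open>D\<close> is an arbitrary measure a priori; it inherits its properties from an
  error in any nonempty row, and such a row exists because the row sizes tend to infinity.\<close>

lemma real_distribution_D: "real_distribution D"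
proof -
  obtain n where "card (\<zeta> n) > 0"
    using eventually_card_pos eventually_happens by fastforce
  then obtain i where i: "i \<in> \<zeta> n" by (metis card_gt_0_iff ex_in_conv)
  interpret prob_space "M n" by (rule prob)
  show ?thesis
    using real_distribution_distr[OF measurable_errors[OF i]] law[OF i] by simp
qed

lemma expectation_error:
  fixes f :: "real \<Rightarrow> real"
  assumes "i \<in> \<zeta> n" "f \<in> borel_measurable borel"
  shows "(\<integral>\<omega>. f (\<epsilon> n i \<omega>) \<partial>M n) = (\<integral>x. f x \<partial>D)"
proof -
  have "(\<integral>x. f x \<partial>distr (M n) borel (\<epsilon> n i)) = (\<integral>\<omega>. f (\<epsilon> n i \<omega>) \<partial>M n)"
    using measurable_errors[OF assms(1)] assms(2) by (intro integral_distr) auto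
  then show ?thesis by (simp add: law[OF assms(1)])
qed

text \<open>Hoeffding's inequality bounds the deviation probability by an exponential in the row
  size alone, so it does not matter that different rows share no probability space.\<close>

lemma law_of_large_numbers:
  fixes f :: "real \<Rightarrow> real"
  assumes f: "f \<in> borel_measurable borel" and bound: "\<And>x. \<bar>f x\<bar> \<le> B" and d: "d > 0"
  shows "with_large_prob M (\<lambda>n \<omega>. \<bar>avg (\<zeta> n) (\<lambda>i. f (\<epsilon> n i \<omega>)) - (\<integral>x. f x \<partial>D)\<bar> \<le> d)"
proof (rule with_large_prob_mono)
  let ?m = "\<integral>x. f x \<partial>D" and ?c = "- 2 * d\<^sup>2 / (2 * (B + 1))\<^sup>2"
  let ?bad = "\<lambda>n \<omega>. \<bar>avg (\<zeta> n) (\<lambda>i. f (\<epsilon> n i \<omega>)) - ?m\<bar> > d"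
  note [measurable] = f measurable_errors
  have [measurable]: "(\<lambda>\<omega>. avg (\<zeta> n) (\<lambda>i. f (\<epsilon> n i \<omega>))) \<in> borel_measurable (M n)" for n
    unfolding avg_def by (intro borel_measurable_divide borel_measurable_sum) auto
  have B: "B \<ge> 0" using bound[of 0] by linarith
  have bd: "measure (M n) {\<omega>\<in>space (M n). ?bad n \<omega>} \<le> 2 * exp (?c * real (card (\<zeta> n)))"
    if h: "card (\<zeta> n) > 0" for n
  proof -
    interpret prob_space "M n" by (rule prob)
    let ?h = "real (card (\<zeta> n))"
    have fin: "finite (\<zeta> n)" using h card_gt_0_iff by blast
    \<comment> \<open>The range is widened to \<open>B + 1\<close> so that its length is positive
      even when \<open>B = 0\<close>.\<close>
    interpret Hoeffding_ineq "M n" "\<zeta> n" "\<lambda>i \<omega>. f (\<epsilon> n i \<omega>)" "\<lambda>_. - (B+1)" "\<lambda>_. B + 1" "?h * ?m"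
    proof unfold_locales
      show "indep_vars (\<lambda>_. borel) (\<lambda>i \<omega>. f (\<epsilon> n i \<omega>)) (\<zeta> n)"
        by (rule indep_vars_compose2[OF indep]) (use f in auto)
      show "AE x in M n. f (\<epsilon> n i x) \<in> {- (B + 1)..B + 1}" for i
      proof (rule AE_I2)
        fix x
        show "f (\<epsilon> n i x) \<in> {- (B + 1)..B + 1}"
          using bound[of "\<epsilon> n i x"] by auto
      qed
      show "?h * ?m \<equiv> \<Sum>i\<in>\<zeta> n. expectation (\<lambda>\<omega>. f (\<epsilon> n i \<omega>))"
        by (rule eq_reflection) (simp add: expectation_error)
    qed (rule fin)
    have sq: "(\<Sum>i\<in>\<zeta> n. (B + 1 - - (B + 1))\<^sup>2) = ?h * (2 * (B + 1))\<^sup>2"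
      by (simp add: algebra_simps)
    have "{\<omega>\<in>space (M n). ?bad n \<omega>} \<subseteq> {\<omega>\<in>space (M n). \<bar>(\<Sum>i\<in>\<zeta> n. f (\<epsilon> n i \<omega>)) - ?h * ?m\<bar> \<ge> ?h * d}"
    proof safe
      fix \<omega> assume "?bad n \<omega>"
      then have "?h * d \<le> ?h * \<bar>avg (\<zeta> n) (\<lambda>i. f (\<epsilon> n i \<omega>)) - ?m\<bar>"
        by (intro mult_left_mono) auto
      also have "\<dots> = \<bar>?h * (avg (\<zeta> n) (\<lambda>i. f (\<epsilon> n i \<omega>)) - ?m)\<bar>"
        by (simp add: abs_mult)
      also have "?h * (avg (\<zeta> n) (\<lambda>i. f (\<epsilon> n i \<omega>)) - ?m) = (\<Sum>i\<in>\<zeta> n. f (\<epsilon> n i \<omega>)) - ?h * ?m"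
        using h by (simp add: avg_def field_simps)
      finally show "?h * d \<le> \<bar>(\<Sum>i\<in>\<zeta> n. f (\<epsilon> n i \<omega>)) - ?h * ?m\<bar>" .
    qed
    then have "prob {\<omega>\<in>space (M n). ?bad n \<omega>} \<le>
        prob {\<omega>\<in>space (M n). \<bar>(\<Sum>i\<in>\<zeta> n. f (\<epsilon> n i \<omega>)) - ?h * ?m\<bar> \<ge> ?h * d}"
      by (rule finite_measure_mono) measurable
    also have "\<dots> \<le> 2 * exp (- 2 * (?h * d)\<^sup>2 / (\<Sum>i\<in>\<zeta> n. (B + 1 - - (B + 1))\<^sup>2))"
      unfolding sq using h B d by (intro Hoeffding_ineq_abs_ge[unfolded sq]) auto
    also have "- 2 * (?h * d)\<^sup>2 / (\<Sum>i\<in>\<zeta> n. (B + 1 - - (B + 1))\<^sup>2) = ?c * ?h"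
      proof -
      have "- 2 * (a * d)\<^sup>2 / (a * q) = - 2 * d\<^sup>2 / q * a" if "a > 0" for a q
        using that by (cases "q = 0") (simp_all add: power2_eq_square field_simps)
      then show ?thesis unfolding sq using h by simp
    qed
    finally show ?thesis .
  qed
  have "filterlim (\<lambda>n. real (card (\<zeta> n))) at_top sequentially"
    using filterlim_compose[OF filterlim_real_sequentially h_infinity] by simp
  moreover have "?c < 0" using B d by (simp add: divide_neg_pos)
  ultimately have "filterlim (\<lambda>n. ?c * real (card (\<zeta> n))) at_bot sequentially"
    by (subst filterlim_tendsto_neg_mult_at_bot_iff[OF tendsto_const]) auto
  then have "(\<lambda>n. exp (?c * real (card (\<zeta> n)))) \<longlonglongrightarrow> 0"
    by (rule filterlim_compose[OF exp_at_bot])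
  from tendsto_mult_left[OF this, of 2]
  have lim0: "(\<lambda>n. 2 * exp (?c * real (card (\<zeta> n)))) \<longlonglongrightarrow> 0" by simp
  have "\<forall>\<^sub>F n in sequentially. measure (M n) {\<omega>\<in>space (M n). ?bad n \<omega>} \<le> 2 * exp (?c * real (card (\<zeta> n)))"
    by (rule eventually_mono[OF eventually_card_pos bd])
  then have "(\<lambda>n. measure (M n) {\<omega>\<in>space (M n). ?bad n \<omega>}) \<longlonglongrightarrow> 0"
    by (intro tendsto_sandwich[OF _ _ tendsto_const lim0]) simp_all
  then show "with_large_prob M (\<lambda>n \<omega>. \<not> ?bad n \<omega>)"
    by (intro with_large_prob_if_tendsto_0 prob) auto
qed auto

text \<open>The classical theorem is about a single infinite sequence. Each row sum has the law of a
  partial sum of one such sequence, and convergence in law depends on these laws only.\<close>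

lemma central_limit_theorem_rows:
  fixes f :: "real \<Rightarrow> real"
  assumes f[measurable]: "f \<in> borel_measurable borel" and bound: "\<And>x. \<bar>f x\<bar> \<le> B"
    and mean: "(\<integral>x. f x \<partial>D) = 0" and v: "v = (\<integral>x. (f x)\<^sup>2 \<partial>D)" "v > 0"
  shows "weak_conv_m (\<lambda>n. distr (M n) borel (\<lambda>\<omega>. (\<Sum>i\<in>\<zeta> n. f (\<epsilon> n i \<omega>)) / sqrt (real (card (\<zeta> n)) * v)))
    std_normal_distribution"
proof -
  interpret D: real_distribution D by (rule real_distribution_D)
  have [measurable_cong]: "sets D = sets borel" by simp
  \<comment> \<open>The coordinates of this infinite product form one i.i.d. sequence with law
    \<open>D\<close>, long enough to represent every row.\<close>
  define P where "P = PiM (UNIV :: nat set) (\<lambda>_. D)"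
  interpret P: product_prob_space "\<lambda>_. D" "UNIV :: nat set" ..
  interpret PP: prob_space P
    unfolding P_def by (rule prob_space_PiM) (rule D.prob_space_axioms)
  have coord: "distr P borel (\<lambda>x. x i) = D" for i
  proof -
    have "distr P borel (\<lambda>x. x i) = distr P D (\<lambda>x. x i)"
      by (rule distr_cong) auto
    then show ?thesis unfolding P_def by (simp add: P.PiM_component)
  qed
  have [measurable]: "(\<lambda>x. x i) \<in> borel_measurable P" for i :: nat
    unfolding P_def by measurable
  have indepP: "PP.indep_vars (\<lambda>_. borel) (\<lambda>i x. x i) UNIV"
  proof (subst PP.indep_vars_iff_distr_eq_PiM)
    have "distr P (PiM UNIV (\<lambda>_. borel)) (\<lambda>x. \<lambda>i\<in>UNIV. x i) = distr P P (\<lambda>x. x)"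
      unfolding P_def by (intro distr_cong sets_PiM_cong) auto
    also have "\<dots> = P" by (rule distr_id)
    also have "\<dots> = PiM UNIV (\<lambda>i. distr P borel (\<lambda>x. x i))"
      unfolding coord by (rule P_def)
    finally show "distr P (PiM UNIV (\<lambda>_. borel)) (\<lambda>x. \<lambda>i\<in>UNIV. x i) =
        PiM UNIV (\<lambda>i. distr P borel (\<lambda>x. x i))" .
  qed auto
  let ?X = "\<lambda>i x. f (x i)"
  have indepX: "PP.indep_vars (\<lambda>_. borel) ?X UNIV"
    by (rule PP.indep_vars_compose2[OF indepP]) auto
  have exp: "PP.expectation (\<lambda>x. g (x i)) = (\<integral>x. g x \<partial>D)" if "g \<in> borel_measurable borel" for i and g :: "real \<Rightarrow> real"
    using integral_distr[of "\<lambda>x. x i" P borel g] that by (simp add: coord)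
  have "weak_conv_m (\<lambda>n. distr P borel (\<lambda>x. (\<Sum>i<n. ?X i x) / sqrt (n * (sqrt v)\<^sup>2))) std_normal_distribution"
  proof (rule PP.central_limit_theorem_zero_mean[OF indepX, where \<mu> = "distr D borel f"])
    show "integrable P (\<lambda>x. (f (x i))\<^sup>2)" for i
    proof (rule PP.integrable_const_bound[where B = "B\<^sup>2"])
      show "AE x in P. norm ((f (x i))\<^sup>2) \<le> B\<^sup>2"
        using bound by (intro AE_I2) (simp add: abs_le_square_iff[symmetric] order_trans[OF bound abs_ge_self])
    qed measurable
    show m: "PP.expectation (\<lambda>x. f (x i)) = 0" for i
      by (subst exp) (auto simp: mean)
    show "PP.variance (\<lambda>x. f (x i)) = (sqrt v)\<^sup>2" for i
      using exp[of "\<lambda>y. (f y)\<^sup>2" i] v by (simp add: m)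
    show "distr P borel (\<lambda>x. f (x i)) = distr D borel f" for i
      by (subst coord[of i, symmetric], subst distr_distr) (auto simp: comp_def)
  qed (use v in auto)
  then have *: "weak_conv_m (\<lambda>n. distr P borel (\<lambda>x. (\<Sum>i<n. f (x i)) / sqrt (n * v))) std_normal_distribution"
    using v by simp
  have eq: "distr (M n) borel (\<lambda>\<omega>. (\<Sum>i\<in>\<zeta> n. f (\<epsilon> n i \<omega>)) / c) =
      distr P borel (\<lambda>x. (\<Sum>i<card (\<zeta> n). f (x i)) / c)" for n c
  proof -
    interpret prob_space "M n" by (rule prob)
    note [measurable] = measurable_errors[of _ n]
    let ?f = "\<lambda>x. f x / c"
    \<comment> \<open>Both characteristic functions are the power, with exponent the row size, of
      that of a single summand; Levy's uniqueness theorem then identifies the laws.\<close>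
    have "char (distr (M n) borel (\<lambda>\<omega>. \<Sum>i\<in>\<zeta> n. ?f (\<epsilon> n i \<omega>))) t =
       char (distr P borel (\<lambda>x. \<Sum>i<card (\<zeta> n). ?f (x i))) t" for t
    proof -
      have "char (distr (M n) borel (\<lambda>\<omega>. \<Sum>i\<in>\<zeta> n. ?f (\<epsilon> n i \<omega>))) t =
          (\<Prod>i\<in>\<zeta> n. char (distr (M n) borel (\<lambda>\<omega>. ?f (\<epsilon> n i \<omega>))) t)"
        by (intro char_distr_sum indep_vars_compose2[OF indep]) auto
      also have "\<dots> = (\<Prod>i\<in>\<zeta> n. char (distr D borel ?f) t)"
      proof (intro prod.cong refl)
        fix i assume i: "i \<in> \<zeta> n"
        have "distr D borel ?f = distr (M n) borel (\<lambda>\<omega>. ?f (\<epsilon> n i \<omega>))"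
          using i by (subst law[OF i, symmetric], subst distr_distr) (auto simp: comp_def)
        then show "char (distr (M n) borel (\<lambda>\<omega>. ?f (\<epsilon> n i \<omega>))) t = char (distr D borel ?f) t" by simp
      qed
      also have "\<dots> = (\<Prod>i<card (\<zeta> n). char (distr D borel ?f) t)" by simp
      also have "\<dots> = (\<Prod>i<card (\<zeta> n). char (distr P borel (\<lambda>x. ?f (x i))) t)"
      proof (intro prod.cong refl)
        fix i
        have "distr D borel ?f = distr P borel (\<lambda>x. ?f (x i))"
          by (subst coord[of i, symmetric], subst distr_distr) (auto simp: comp_def)
        then show "char (distr D borel ?f) t = char (distr P borel (\<lambda>x. ?f (x i))) t" by simp
      qed
      also have "\<dots> = char (distr P borel (\<lambda>x. \<Sum>i<card (\<zeta> n). ?f (x i))) t"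
        by (intro PP.char_distr_sum[symmetric] PP.indep_vars_compose2[OF PP.indep_vars_subset[OF indepP]]) auto
      finally show ?thesis .
    qed
    then have "distr (M n) borel (\<lambda>\<omega>. \<Sum>i\<in>\<zeta> n. ?f (\<epsilon> n i \<omega>)) =
        distr P borel (\<lambda>x. \<Sum>i<card (\<zeta> n). ?f (x i))"
      by (intro Levy_uniqueness real_distribution_distr PP.real_distribution_distr) auto
    then show ?thesis by (simp add: sum_divide_distrib)
  qed
  \<comment> \<open>The row sizes tend to infinity, so they may be substituted for the index of the
    convergent sequence.\<close>
  show ?thesis
    using * h_infinity unfolding weak_conv_m_def weak_conv_def eq
    by (auto intro: filterlim_compose[where g = "\<lambda>n. cdf (distr P borel (\<lambda>x. (\<Sum>i<n. f (x i)) / sqrt (real n * v))) y" for y])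
qed

text \<open>The sum has spread \<open>sqrt (h * v)\<close>, so it falls below any fixed
  \<open>- K\<close> with a probability that stays away from zero, and one \<open>p\<close> serves
  all \<open>K\<close>.\<close>

lemma centred_sum_not_bounded_below:
  fixes f :: "real \<Rightarrow> real"
  assumes f: "f \<in> borel_measurable borel" "\<And>x. \<bar>f x\<bar> \<le> B"
    and mean: "(\<integral>x. f x \<partial>D) = 0" and v: "(\<integral>x. (f x)\<^sup>2 \<partial>D) > 0"
  obtains p where "p > 0" "\<And>K. \<not> likely M p (\<lambda>n \<omega>. (\<Sum>i\<in>\<zeta> n. f (\<epsilon> n i \<omega>)) \<ge> - K)"
proof -
  define v where "v = (\<integral>x. (f x)\<^sup>2 \<partial>D)"
  have v: "v > 0" using assms(4) v_def by simp
  note [measurable] = f(1) measurable_errors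
  define S where "S = (\<lambda>n \<omega>. (\<Sum>i\<in>\<zeta> n. f (\<epsilon> n i \<omega>)))"
  have [measurable]: "S n \<in> borel_measurable (M n)" for n
    unfolding S_def by (intro borel_measurable_sum) auto
  \<comment> \<open>Half of the limiting probability of falling one standard deviation below the
    mean, so that this probability eventually exceeds \<open>p\<close> strictly.\<close>
  define p where "p = cdf std_normal_distribution (-1) / 2"
  have p: "p > 0" using cdf_std_normal_pos by (simp add: p_def)
  interpret N: real_distribution std_normal_distribution by (rule real_dist_normal_dist)
  have "isCont (cdf std_normal_distribution) (-1)"
    using N.isCont_cdf measure_singleton_normal[of 1] by simp
  then have lim: "(\<lambda>n. cdf (distr (M n) borel (\<lambda>\<omega>. S n \<omega> / sqrt (real (card (\<zeta> n)) * v))) (-1)) \<longlonglongrightarrow> 2 * p"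
    using central_limit_theorem_rows[OF f mean v_def v]
    unfolding weak_conv_m_def weak_conv_def p_def S_def by simp
  have "\<not> likely M p (\<lambda>n \<omega>. S n \<omega> \<ge> - K)" for K
  proof
    assume "likely M p (\<lambda>n \<omega>. S n \<omega> \<ge> - K)"
    then have 1: "\<forall>\<^sub>F n in sequentially. \<exists>A\<in>sets (M n). measure (M n) A > 1 - p \<and> (\<forall>\<omega>\<in>A. S n \<omega> \<ge> - K)"
      unfolding likely_def eventually_sequentially by blast
    have 2: "\<forall>\<^sub>F n in sequentially. cdf (distr (M n) borel (\<lambda>\<omega>. S n \<omega> / sqrt (real (card (\<zeta> n)) * v))) (-1) > p"
      using p by (intro order_tendstoD[OF lim]) simp
    have "filterlim (\<lambda>n. real (card (\<zeta> n))) at_top sequentially"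
      using filterlim_compose[OF filterlim_real_sequentially h_infinity] by simp
    then have 3: "\<forall>\<^sub>F n in sequentially. real (card (\<zeta> n)) > (\<bar>K\<bar>\<^sup>2 + 1) / v"
      unfolding filterlim_at_top_dense by blast
    from 1 2 3 have "\<forall>\<^sub>F n in sequentially. False"
    proof eventually_elim
      case (elim n)
      interpret prob_space "M n" by (rule prob)
      obtain A where A: "A \<in> events" "prob A > 1 - p" "\<And>\<omega>. \<omega> \<in> A \<Longrightarrow> S n \<omega> \<ge> - K"
        using elim(1) by blast
      let ?r = "sqrt (real (card (\<zeta> n)) * v)"
      have "real (card (\<zeta> n)) * v > \<bar>K\<bar>\<^sup>2"
        using elim(3) v by (simp add: field_simps)
      then have r: "?r > \<bar>K\<bar>" using real_less_rsqrt by blast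
      let ?B = "{\<omega>\<in>space (M n). S n \<omega> / ?r \<le> -1}"
      have "cdf (distr (M n) borel (\<lambda>\<omega>. S n \<omega> / ?r)) (-1) = prob ?B"
        by (auto simp: cdf_def measure_distr intro!: arg_cong[where f=prob])
      \<comment> \<open>Once the standard deviation exceeds \<bar>K\<bar>, the two events are
        disjoint, yet their probabilities exceed \<open>1 - p\<close> and \<open>p\<close>.\<close>
      moreover have "A \<inter> ?B = {}"
      proof (rule ccontr)
        assume "A \<inter> ?B \<noteq> {}"
        then obtain \<omega> where "\<omega> \<in> A" "S n \<omega> / ?r \<le> -1" by blast
        moreover have "?r > 0" using r by linarith
        ultimately have "S n \<omega> \<le> - ?r"
          using pos_divide_le_eq[of ?r "S n \<omega>" "-1"] by linarith
        then show False using A(3)[OF \<open>\<omega> \<in> A\<close>] r by linarith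
      qed
      moreover have "prob (A \<union> ?B) \<le> 1" by simp
      ultimately show False
        using elim(2) A finite_measure_Union[of A ?B] by simp
    qed
    then show False by simp
  qed
  then show ?thesis using that[OF p] unfolding S_def by blast
qed

end

section \<open>Bounded smooth loss functions\<close>

locale bounded_rho =
  fixes \<rho> \<rho>' \<rho>'' :: "real \<Rightarrow> real" and x_star rho_star C L :: real
  assumes rho_condition: "rho_condition \<rho> x_star rho_star 0"
    and deriv1: "\<And>x. (\<rho> has_real_derivative \<rho>' x) (at x)"
    and deriv2: "\<And>x. (\<rho>' has_real_derivative \<rho>'' x) (at x)"
    and rho_lipschitz: "C-lipschitz_on UNIV \<rho>"
    and rho''_lipschitz: "L-lipschitz_on UNIV \<rho>''"
begin

text \<open>A bound for \<open>\<rho>''\<close>, and hence a Lipschitz constant of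
  \<open>\<rho>'\<close>: from any point within \<open>x_star\<close> of 0 the distance to
  \<open>x_star + 1\<close>, where \<open>\<rho>''\<close> vanishes, is less than
  \<open>2 * x_star + 2\<close>.\<close>

definition Q :: real where "Q = L * (2 * x_star + 2)"

lemma x_star_pos: "x_star > 0" and rho_star_pos: "rho_star > 0"
  and rho_0: "\<rho> 0 = 0" and rho_sym: "\<rho> (- x) = \<rho> x"
  and rho_eq_star: "\<bar>x\<bar> \<ge> x_star \<Longrightarrow> \<rho> x = rho_star"
  using rho_condition unfolding rho_condition_def by auto

lemma rho_nonneg: "\<rho> x \<ge> 0"
  using rho_condition unfolding rho_condition_def by (cases "x = 0") (auto intro: less_imp_le)

lemma rho_abs: "\<rho> \<bar>x\<bar> = \<rho> x"
  by (simp add: abs_if rho_sym)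

lemma rho_mono: 
  assumes "0 \<le> x" "x \<le> y" shows "\<rho> x \<le> \<rho> y"
proof (cases "x = 0")
  case False
  then show ?thesis
    using rho_condition assms mono_onD[of "{0<..}" \<rho> x y] unfolding rho_condition_def by auto
qed (simp add: rho_0 rho_nonneg)

lemma rho_le_star: "\<rho> x \<le> rho_star"
proof -
  have "\<rho> \<bar>x\<bar> \<le> \<rho> (max \<bar>x\<bar> x_star)"
    by (intro rho_mono) auto
  also have "\<dots> = rho_star" by (intro rho_eq_star) auto
  finally show ?thesis by (simp add: rho_abs)
qed

lemma C_nonneg: "C \<ge> 0" and L_nonneg: "L \<ge> 0"
  using rho_lipschitz rho''_lipschitz lipschitz_on_nonneg by blast+

lemma rho_diff_le: "\<bar>\<rho> x - \<rho> y\<bar> \<le> C * \<bar>x - y\<bar>"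
  using lipschitz_onD[OF rho_lipschitz] by (simp add: dist_real_def)

lemma rho''_diff_le: "\<bar>\<rho>'' x - \<rho>'' y\<bar> \<le> L * \<bar>x - y\<bar>"
  using lipschitz_onD[OF rho''_lipschitz] by (simp add: dist_real_def)

lemma rho'_outer:
  assumes "\<bar>x\<bar> > x_star" shows "\<rho>' x = 0"
proof -
  have "((\<lambda>_. rho_star) has_real_derivative \<rho>' x) (at x)"
  proof (rule has_field_derivative_transform_within_open[OF deriv1])
    show "open {x. \<bar>x\<bar> > x_star}"
      by (intro open_Collect_less continuous_intros)
  qed (use assms rho_eq_star in auto)
  then show ?thesis using DERIV_const DERIV_unique by blast
qed

lemma rho''_outer:
  assumes "\<bar>x\<bar> > x_star" shows "\<rho>'' x = 0"
proof -
  have "((\<lambda>_. 0) has_real_derivative \<rho>'' x) (at x)"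
  proof (rule has_field_derivative_transform_within_open[OF deriv2])
    show "open {x. \<bar>x\<bar> > x_star}"
      by (intro open_Collect_less continuous_intros)
  qed (use assms rho'_outer in auto)
  then show ?thesis using DERIV_const DERIV_unique by blast
qed

lemma Q_nonneg: "Q \<ge> 0"
  using L_nonneg x_star_pos by (simp add: Q_def)

lemma rho''_bound: "\<bar>\<rho>'' x\<bar> \<le> Q"
proof (cases "\<bar>x\<bar> > x_star")
  case False
  have "\<bar>\<rho>'' x - \<rho>'' (x_star + 1)\<bar> \<le> L * \<bar>x - (x_star + 1)\<bar>" by (rule rho''_diff_le)
  also have "\<dots> \<le> L * (2 * x_star + 2)"
    using False L_nonneg by (intro mult_left_mono) auto
  finally show ?thesis using rho''_outer[of "x_star + 1"] x_star_pos by (simp add: Q_def)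
qed (simp add: rho''_outer Q_nonneg)

lemma rho'_diff_le: "\<bar>\<rho>' x - \<rho>' y\<bar> \<le> Q * \<bar>x - y\<bar>"
  using field_differentiable_bound[of UNIV \<rho>' \<rho>'' Q x y] rho''_bound deriv2
  by (auto intro: has_field_derivative_at_within)

lemma rho'_bound: "\<bar>\<rho>' x\<bar> \<le> Q * (2 * x_star + 2)"
proof (cases "\<bar>x\<bar> > x_star")
  case False
  have "\<bar>\<rho>' x - \<rho>' (x_star + 1)\<bar> \<le> Q * \<bar>x - (x_star + 1)\<bar>" by (rule rho'_diff_le)
  also have "\<dots> \<le> Q * (2 * x_star + 2)"
    using False Q_nonneg by (intro mult_left_mono) auto
  finally show ?thesis using rho'_outer[of "x_star + 1"] x_star_pos by simp
qed (use x_star_pos in \<open>simp add: rho'_outer Q_nonneg\<close>)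

lemma measurable_rho [measurable]: "\<rho> \<in> borel_measurable borel" "\<rho>' \<in> borel_measurable borel"
  "\<rho>'' \<in> borel_measurable borel"
  using deriv1 deriv2 lipschitz_on_continuous_on[OF rho''_lipschitz]
  by (auto intro!: borel_measurable_continuous_onI continuous_at_imp_continuous_on intro: DERIV_isCont)

text \<open>On the ball of radius \<bar>u\<bar> around \<open>x\<close> the function
  \<open>\<rho> y - y * \<rho>' x\<close> has slope at most \<open>Q * \<bar>u\<bar>\<close>. Hence
  the constant \<open>Q\<close>, where Taylor's formula would give half of it.\<close>

lemma rho_second_order: "\<bar>\<rho> (x - u) - \<rho> x + u * \<rho>' x\<bar> \<le> Q * u\<^sup>2"
proof -
  define f where "f = (\<lambda>y. \<rho> y - y * \<rho>' x)"
  have "\<bar>f (x - u) - f x\<bar> \<le> (Q * \<bar>u\<bar>) * \<bar>(x - u) - x\<bar>"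
  proof -
    have "norm (f (x - u) - f x) \<le> (Q * \<bar>u\<bar>) * norm ((x - u) - x)"
    proof (rule field_differentiable_bound[where S="cball x \<bar>u\<bar>" and f' = "\<lambda>y. \<rho>' y - \<rho>' x"])
      show "norm (\<rho>' y - \<rho>' x) \<le> Q * \<bar>u\<bar>" if "y \<in> cball x \<bar>u\<bar>" for y
      proof -
        have "\<bar>\<rho>' y - \<rho>' x\<bar> \<le> Q * \<bar>y - x\<bar>" by (rule rho'_diff_le)
        also have "\<dots> \<le> Q * \<bar>u\<bar>"
          using that Q_nonneg by (intro mult_left_mono) (auto simp: dist_real_def)
        finally show ?thesis by simp
      qed
    next
      fix y
      show "(f has_real_derivative \<rho>' y - \<rho>' x) (at y within cball x \<bar>u\<bar>)"
        unfolding f_def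
        by (auto intro!: derivative_eq_intros has_field_derivative_at_within[OF deriv1])
    qed (auto simp: dist_real_def)
    then show ?thesis by simp
  qed
  then show ?thesis by (simp add: f_def algebra_simps power2_eq_square abs_mult_self_eq)
qed

section \<open>Symmetry and flat pieces of the loss\<close>

lemma rho'_odd: "\<rho>' (- x) = - \<rho>' x"
proof -
  have "((\<lambda>x. \<rho> (- x)) has_real_derivative \<rho>' (- x) * (-1)) (at x)"
    by (rule DERIV_chain2[OF deriv1]) (auto intro!: derivative_eq_intros)
  then have "(\<rho> has_real_derivative - \<rho>' (- x)) (at x)" by (simp add: rho_sym)
  then show ?thesis using DERIV_unique[OF deriv1] by force
qed

lemma rho''_even: "\<rho>'' (- x) = \<rho>'' x"
proof -
  have "((\<lambda>x. \<rho>' (- x)) has_real_derivative \<rho>'' (- x) * (-1)) (at x)"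
    by (rule DERIV_chain2[OF deriv2]) (auto intro!: derivative_eq_intros)
  moreover have "((\<lambda>x. \<rho>' (- x)) has_real_derivative - \<rho>'' x) (at x)"
    unfolding rho'_odd using deriv2 by (rule DERIV_minus)
  ultimately show ?thesis using DERIV_unique by force
qed

lemma rho'_nonneg:
  assumes "x > 0" shows "\<rho>' x \<ge> 0"
proof (rule ccontr)
  assume "\<not> \<rho>' x \<ge> 0"
  then obtain d where d: "d > 0" "\<And>h. h > 0 \<Longrightarrow> h < d \<Longrightarrow> \<rho> (x + h) < \<rho> x"
    using DERIV_neg_dec_right[OF deriv1, of x] by force
  have "\<rho> (x + d/2) < \<rho> x" using d by (intro d(2)) auto
  moreover have "\<rho> x \<le> \<rho> (x + d/2)" using d(1) assms by (intro rho_mono) auto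
  ultimately show False by simp
qed

text \<open>Monotonicity squeezes \<rho> to a constant between \<open>u\<close> and
  \<open>w\<close>. The derivatives vanish in the open interval, and by continuity at its
  endpoints.\<close>

lemma rho_flat:
  assumes "0 \<le> u" "u < w" "\<rho> u = \<rho> w" "x \<in> {u..w}"
  shows "\<rho>' x = 0 \<and> \<rho>'' x = 0"
proof -
  define c where "c = \<rho> u"
  have const: "\<rho> y = c" if "y \<in> {u..w}" for y
    using rho_mono[of u y] rho_mono[of y w] assms(1,3) that unfolding c_def by simp
  have d1: "\<rho>' y = 0" if "y \<in> {u<..<w}" for y
  proof -
    have "((\<lambda>_. c) has_real_derivative \<rho>' y) (at y)"
      by (rule has_field_derivative_transform_within_open[OF deriv1, of "{u<..<w}"])
        (use that const in auto)
    then show ?thesis using DERIV_const DERIV_unique by blast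
  qed
  have d2: "\<rho>'' y = 0" if "y \<in> {u<..<w}" for y
  proof -
    have "((\<lambda>_. 0) has_real_derivative \<rho>'' y) (at y)"
      by (rule has_field_derivative_transform_within_open[OF deriv2, of "{u<..<w}"])
        (use that d1 in auto)
    then show ?thesis using DERIV_const DERIV_unique by blast
  qed
  have "continuous_on UNIV \<rho>'"
    using deriv2 by (intro continuous_at_imp_continuous_on) (auto intro: DERIV_isCont)
  moreover have "continuous_on UNIV \<rho>''"
    using rho''_lipschitz by (rule lipschitz_on_continuous_on)
  ultimately have "closed {y. \<rho>' y = 0 \<and> \<rho>'' y = 0}"
    by (intro closed_Collect_conj closed_Collect_eq continuous_on_const)
  then have "closure {u<..<w} \<subseteq> {y. \<rho>' y = 0 \<and> \<rho>'' y = 0}"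
    using d1 d2 by (intro closure_minimal) auto
  then show ?thesis using assms by auto
qed

text \<open>Apart from the midpoint, \<open>x\<close> and \<open>x - b\<close> have different
  absolute values, so equal losses mean a flat piece reaching \<bar>x\<bar>; symmetry carries this
  back to \<open>x\<close>.\<close>

lemma rho_coincidence:
  assumes "\<rho> (x - b) = \<rho> x" "b \<noteq> 0" "x \<noteq> b / 2"
  shows "\<rho>' x = 0 \<and> \<rho>'' x = 0"
proof -
  have "\<bar>x\<bar> \<noteq> \<bar>x - b\<bar>" using assms(2,3) by (auto simp: abs_if field_simps)
  then have "\<rho>' \<bar>x\<bar> = 0 \<and> \<rho>'' \<bar>x\<bar> = 0"
    using assms(1) by (intro rho_flat[of "min \<bar>x\<bar> \<bar>x - b\<bar>" "max \<bar>x\<bar> \<bar>x - b\<bar>"])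
      (auto simp: min_def max_def rho_abs)
  then show ?thesis by (auto simp: abs_if rho'_odd rho''_even split: if_splits)
qed

text \<open>To the right of 0 the derivative is nonnegative, so each of its zeros there is a local
  minimum of \<open>\<rho>'\<close>.\<close>

lemma rho''_0_if_rho'_0:
  assumes "x \<noteq> 0" "\<rho>' x = 0"
  shows "\<rho>'' x = 0"
proof -
  have pos: "\<rho>'' y = 0" if "y > 0" "\<rho>' y = 0" for y
  proof (rule DERIV_local_min[OF deriv2 that(1)])
    show "\<forall>z. \<bar>y - z\<bar> < y \<longrightarrow> \<rho>' y \<le> \<rho>' z"
      using that rho'_nonneg by auto
  qed
  show ?thesis
    using pos[of x] pos[of "- x"] assms by (cases "x > 0") (auto simp: rho'_odd rho''_even)
qed

text \<open>\<open>\<rho>''\<close> vanishes beyond \<open>x_star\<close>, which tames the unbounded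
  factor \<open>x\<close>; the law of large numbers for bounded functions thus covers the slope of
  the score in the scale.\<close>

lemma times_rho''_bound:
  assumes "a > 0" shows "\<bar>x * \<rho>'' (a * x)\<bar> \<le> x_star / a * Q"
proof (cases "\<bar>a * x\<bar> > x_star")
  case False
  then have "\<bar>x\<bar> \<le> x_star / a" using assms by (simp add: abs_mult field_simps)
  then show ?thesis unfolding abs_mult using rho''_bound Q_nonneg by (intro mult_mono) auto
next
  case True
  then show ?thesis using assms x_star_pos Q_nonneg by (simp add: rho''_outer)
qed

section \<open>Perturbation of averages in scale and location\<close>

lemma rho_scale_perturb:
  assumes "card Z > 0"
  shows "\<bar>avg Z (\<lambda>i. \<rho> (a * (e i - t))) - avg Z (\<lambda>i. \<rho> (b * (e i - t)))\<bar>
    \<le> C * \<bar>a - b\<bar> * (1 + avg Z (\<lambda>i. (e i)\<^sup>2) + \<bar>t\<bar>)"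
proof -
  have "\<bar>avg Z (\<lambda>i. \<rho> (a * (e i - t))) - avg Z (\<lambda>i. \<rho> (b * (e i - t)))\<bar>
      \<le> avg Z (\<lambda>i. \<bar>\<rho> (a * (e i - t)) - \<rho> (b * (e i - t))\<bar>)"
    unfolding avg_diff[symmetric] by (rule abs_avg_le)
  also have "\<dots> \<le> avg Z (\<lambda>i. C * \<bar>a - b\<bar> * (\<bar>e i\<bar> + \<bar>t\<bar>))"
  proof (rule avg_mono)
    fix i
    have "\<bar>\<rho> (a * (e i - t)) - \<rho> (b * (e i - t))\<bar> \<le> C * \<bar>a * (e i - t) - b * (e i - t)\<bar>"
      by (rule rho_diff_le)
    also have "\<bar>a * (e i - t) - b * (e i - t)\<bar> = \<bar>a - b\<bar> * \<bar>e i - t\<bar>"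
      by (simp add: abs_mult[symmetric] algebra_simps)
    also have "C * (\<bar>a - b\<bar> * \<bar>e i - t\<bar>) \<le> C * (\<bar>a - b\<bar> * (\<bar>e i\<bar> + \<bar>t\<bar>))"
      using C_nonneg by (intro mult_left_mono) auto
    finally show "\<bar>\<rho> (a * (e i - t)) - \<rho> (b * (e i - t))\<bar> \<le> C * \<bar>a - b\<bar> * (\<bar>e i\<bar> + \<bar>t\<bar>)"
      by (simp add: mult.assoc)
  qed
  also have "\<dots> = C * \<bar>a - b\<bar> * (avg Z (\<lambda>i. \<bar>e i\<bar>) + \<bar>t\<bar>)"
    using assms by (simp add: avg_cmult avg_add avg_const)
  also have "\<dots> \<le> C * \<bar>a - b\<bar> * (1 + avg Z (\<lambda>i. (e i)\<^sup>2) + \<bar>t\<bar>)"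
    using C_nonneg avg_abs_le_square[OF assms, of e] by (intro mult_left_mono) auto
  finally show ?thesis .
qed

lemma rho_shift_perturb:
  assumes "card Z > 0" "a > 0"
  shows "\<bar>avg Z (\<lambda>i. \<rho> (a * (e i - t))) - avg Z (\<lambda>i. \<rho> (a * (e i - u)))\<bar> \<le> C * a * \<bar>t - u\<bar>"
proof -
  have "\<bar>avg Z (\<lambda>i. \<rho> (a * (e i - t))) - avg Z (\<lambda>i. \<rho> (a * (e i - u)))\<bar>
      \<le> avg Z (\<lambda>i. \<bar>\<rho> (a * (e i - t)) - \<rho> (a * (e i - u))\<bar>)"
    unfolding avg_diff[symmetric] by (rule abs_avg_le)
  also have "\<dots> \<le> avg Z (\<lambda>i. C * a * \<bar>t - u\<bar>)"
  proof (rule avg_mono)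
    fix i
    have "\<bar>a * (e i - t) - a * (e i - u)\<bar> = a * \<bar>t - u\<bar>"
      using assms(2) by (simp add: right_diff_distrib[symmetric] abs_mult abs_minus_commute)
    then show "\<bar>\<rho> (a * (e i - t)) - \<rho> (a * (e i - u))\<bar> \<le> C * a * \<bar>t - u\<bar>"
      using rho_diff_le[of "a * (e i - t)" "a * (e i - u)"] by (simp add: mult.assoc)
  qed
  finally show ?thesis using assms by (simp add: avg_const)
qed

text \<open>A Chebyshev argument: errors up to \<open>A\<close> have residuals on the constant part
  of \<rho>, and the fraction of larger ones is at most the mean square divided by
  \<open>A\<^sup>2\<close>.\<close>

lemma avg_rho_far:
  assumes "card Z > 0" "a > 0" "A > 0" "\<bar>t\<bar> \<ge> A + x_star / a"
  shows "avg Z (\<lambda>i. \<rho> (a * (e i - t))) \<ge> (1 - avg Z (\<lambda>i. (e i)\<^sup>2) / A\<^sup>2) * rho_star"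
proof -
  have "avg Z (\<lambda>i. rho_star - rho_star / A\<^sup>2 * (e i)\<^sup>2) \<le> avg Z (\<lambda>i. \<rho> (a * (e i - t)))"
  proof (rule avg_mono)
    fix i
    show "rho_star - rho_star / A\<^sup>2 * (e i)\<^sup>2 \<le> \<rho> (a * (e i - t))"
    proof (cases "\<bar>e i\<bar> \<le> A")
      case True
      then have "\<bar>e i - t\<bar> \<ge> x_star / a" using assms(4) by linarith
      then have "\<bar>a * (e i - t)\<bar> \<ge> x_star"
        using assms(2) by (simp add: abs_mult pos_divide_le_eq mult.commute)
      then show ?thesis using rho_eq_star rho_star_pos by simp
    next
      case False
      then have "A\<^sup>2 \<le> (e i)\<^sup>2" using assms(3) by (simp add: abs_le_square_iff[symmetric])
      then have "rho_star / A\<^sup>2 * (e i)\<^sup>2 \<ge> rho_star / A\<^sup>2 * A\<^sup>2"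
        using rho_star_pos by (intro mult_left_mono) auto
      then show ?thesis using rho_nonneg[of "a * (e i - t)"] assms(3) by simp
    qed
  qed
  then have "rho_star - rho_star / A\<^sup>2 * avg Z (\<lambda>i. (e i)\<^sup>2) \<le> avg Z (\<lambda>i. \<rho> (a * (e i - t)))"
    unfolding avg_diff avg_cmult avg_const[OF assms(1)] .
  then show ?thesis by (simp add: left_diff_distrib right_diff_distrib mult.commute)
qed

section \<open>Slopes of the score and stationarity of minimizers\<close>

lemma DERIV_avg_shift:
  "((\<lambda>t. avg Z (\<lambda>i. \<rho>' (a * (e i - t)))) has_real_derivative - a * avg Z (\<lambda>i. \<rho>'' (a * (e i - t)))) (at t)"
proof -
  have "((\<lambda>t. \<Sum>i\<in>Z. \<rho>' (a * (e i - t))) has_real_derivative (\<Sum>i\<in>Z. - a * \<rho>'' (a * (e i - t)))) (at t)"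
    by (auto intro!: derivative_eq_intros DERIV_chain2[OF deriv2] simp: mult.commute)
  from DERIV_cdivide[OF this, of "real (card Z)"] show ?thesis
    by (simp add: avg_def sum_distrib_left sum_negf)
qed

lemma DERIV_avg_scale:
  "((\<lambda>a. avg Z (\<lambda>i. \<rho>' (a * (e i - t)))) has_real_derivative avg Z (\<lambda>i. (e i - t) * \<rho>'' (a * (e i - t)))) (at a)"
proof -
  have "((\<lambda>a. \<Sum>i\<in>Z. \<rho>' (a * (e i - t))) has_real_derivative (\<Sum>i\<in>Z. (e i - t) * \<rho>'' (a * (e i - t)))) (at a)"
    by (auto intro!: derivative_eq_intros DERIV_chain2[OF deriv2] simp: mult.commute)
  from DERIV_cdivide[OF this, of "real (card Z)"] show ?thesis
    by (simp add: avg_def)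
qed

lemma DERIV_sum_rho:
  "((\<lambda>t. \<Sum>i\<in>Z. \<rho> (a * (e i - t))) has_real_derivative - a * (\<Sum>i\<in>Z. \<rho>' (a * (e i - t)))) (at t)"
  unfolding sum_distrib_left
  by (auto intro!: derivative_eq_intros DERIV_chain2[OF deriv1] simp: mult.commute)

lemma sum_rho'_eq_0_if_minimizer:
  assumes "\<And>u. (\<Sum>i\<in>Z. \<rho> (a * (e i - t))) \<le> (\<Sum>i\<in>Z. \<rho> (a * (e i - u)))" "a > 0"
  shows "(\<Sum>i\<in>Z. \<rho>' (a * (e i - t))) = 0"
proof -
  have "- a * (\<Sum>i\<in>Z. \<rho>' (a * (e i - t))) = 0"
    by (rule DERIV_local_min[OF DERIV_sum_rho zero_less_one]) (use assms in auto)
  then show ?thesis using assms(2) by simp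
qed

text \<open>Expanding around the minimizer, where the first-order term vanishes, leaves only \<open>n t\<^sup>2\<close>.\<close>

lemma sum_rho_origin_le:
  assumes min: "\<And>u. (\<Sum>i\<in>Z. \<rho> (a * (e i - t))) \<le> (\<Sum>i\<in>Z. \<rho> (a * (e i - u)))" and a: "a > 0"
  shows "(\<Sum>i\<in>Z. \<rho> (a * e i)) - (\<Sum>i\<in>Z. \<rho> (a * (e i - t))) \<le> Q * a\<^sup>2 * (real (card Z) * t\<^sup>2)"
proof -
  have "(\<Sum>i\<in>Z. \<rho> (a * e i)) - (\<Sum>i\<in>Z. \<rho> (a * (e i - t)))
      = (\<Sum>i\<in>Z. \<rho> (a * (e i - t) - (- a * t)) - \<rho> (a * (e i - t)) + (- a * t) * \<rho>' (a * (e i - t)))"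
    using sum_rho'_eq_0_if_minimizer[OF assms]
    by (simp add: sum.distrib sum_subtractf sum_distrib_left[symmetric] sum_negf algebra_simps)
  also have "\<dots> \<le> (\<Sum>i\<in>Z. Q * (- a * t)\<^sup>2)"
    using rho_second_order by (intro sum_mono) (rule order_trans[OF abs_ge_self])
  finally show ?thesis by (simp add: power_mult_distrib algebra_simps)
qed

lemma avg_rho''_perturb:
  assumes Z: "card Z > 0" and "a \<ge> 0" "avg Z (\<lambda>i. (e i)\<^sup>2) \<le> K"
  shows "\<bar>avg Z (\<lambda>i. \<rho>'' (a * (e i - t))) - avg Z (\<lambda>i. \<rho>'' (b * e i))\<bar> \<le> L * (a * \<bar>t\<bar> + \<bar>a - b\<bar> * (1 + K))"
proof -
  have "\<bar>avg Z (\<lambda>i. \<rho>'' (a * (e i - t))) - avg Z (\<lambda>i. \<rho>'' (b * e i))\<bar>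
      \<le> avg Z (\<lambda>i. \<bar>\<rho>'' (a * (e i - t)) - \<rho>'' (b * e i)\<bar>)"
    unfolding avg_diff[symmetric] by (rule abs_avg_le)
  also have "\<dots> \<le> avg Z (\<lambda>i. L * (a * \<bar>t\<bar> + \<bar>a - b\<bar> * \<bar>e i\<bar>))"
  proof (rule avg_mono)
    fix i
    have "\<bar>a * (e i - t) - b * e i\<bar> = \<bar>(a - b) * e i - a * t\<bar>" by (simp add: algebra_simps)
    also have "\<dots> \<le> a * \<bar>t\<bar> + \<bar>a - b\<bar> * \<bar>e i\<bar>"
      using abs_triangle_ineq4[of "(a - b) * e i" "a * t"] assms(2) by (simp add: abs_mult)
    finally show "\<bar>\<rho>'' (a * (e i - t)) - \<rho>'' (b * e i)\<bar> \<le> L * (a * \<bar>t\<bar> + \<bar>a - b\<bar> * \<bar>e i\<bar>)"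
      using rho''_diff_le[of "a * (e i - t)" "b * e i"] L_nonneg
      by (meson mult_left_mono order_trans)
  qed
  also have "\<dots> = L * (a * \<bar>t\<bar> + \<bar>a - b\<bar> * avg Z (\<lambda>i. \<bar>e i\<bar>))"
    using Z by (simp add: avg_cmult avg_add avg_const)
  also have "\<dots> \<le> L * (a * \<bar>t\<bar> + \<bar>a - b\<bar> * (1 + K))"
    using avg_abs_le_square[OF Z, of e] assms(3) L_nonneg
    by (intro mult_left_mono add_left_mono) auto
  finally show ?thesis .
qed

text \<open>The weight \<open>e i\<close> turns the Lipschitz error
  \<open>\<bar>a - b\<bar> * \<bar>e i\<bar>\<close> into a multiple of the squared error, so a
  bounded mean square is exactly enough.\<close>

lemma avg_times_rho''_perturb:
  assumes Z: "card Z > 0" and "a \<ge> 0" "avg Z (\<lambda>i. (e i)\<^sup>2) \<le> K"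
  shows "\<bar>avg Z (\<lambda>i. (e i - t) * \<rho>'' (a * (e i - t))) - avg Z (\<lambda>i. e i * \<rho>'' (b * e i))\<bar>
    \<le> Q * \<bar>t\<bar> + L * (a * \<bar>t\<bar> * (1 + K) + \<bar>a - b\<bar> * K)"
proof -
  have "\<bar>avg Z (\<lambda>i. (e i - t) * \<rho>'' (a * (e i - t))) - avg Z (\<lambda>i. e i * \<rho>'' (b * e i))\<bar>
      \<le> avg Z (\<lambda>i. \<bar>(e i - t) * \<rho>'' (a * (e i - t)) - e i * \<rho>'' (b * e i)\<bar>)"
    unfolding avg_diff[symmetric] by (rule abs_avg_le)
  also have "\<dots> \<le> avg Z (\<lambda>i. Q * \<bar>t\<bar> + L * (a * \<bar>t\<bar> * \<bar>e i\<bar> + \<bar>a - b\<bar> * (e i)\<^sup>2))"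
  proof (rule avg_mono)
    fix i
    let ?r = "\<rho>'' (a * (e i - t))"
    have "\<bar>a * (e i - t) - b * e i\<bar> = \<bar>(a - b) * e i - a * t\<bar>" by (simp add: algebra_simps)
    also have "\<dots> \<le> a * \<bar>t\<bar> + \<bar>a - b\<bar> * \<bar>e i\<bar>"
      using abs_triangle_ineq4[of "(a - b) * e i" "a * t"] assms(2) by (simp add: abs_mult)
    finally have "\<bar>?r - \<rho>'' (b * e i)\<bar> \<le> L * (a * \<bar>t\<bar> + \<bar>a - b\<bar> * \<bar>e i\<bar>)"
      using rho''_diff_le[of "a * (e i - t)" "b * e i"] L_nonneg
      by (meson mult_left_mono order_trans)
    then have 1: "\<bar>e i\<bar> * \<bar>?r - \<rho>'' (b * e i)\<bar> \<le> \<bar>e i\<bar> * (L * (a * \<bar>t\<bar> + \<bar>a - b\<bar> * \<bar>e i\<bar>))"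
      by (intro mult_left_mono) auto
    have 2: "\<bar>t\<bar> * \<bar>?r\<bar> \<le> \<bar>t\<bar> * Q" using rho''_bound by (intro mult_left_mono) auto
    have "(e i - t) * ?r - e i * \<rho>'' (b * e i) = e i * (?r - \<rho>'' (b * e i)) - t * ?r"
      by (simp add: algebra_simps)
    also have "\<bar>\<dots>\<bar> \<le> \<bar>e i\<bar> * \<bar>?r - \<rho>'' (b * e i)\<bar> + \<bar>t\<bar> * \<bar>?r\<bar>"
      using abs_triangle_ineq4[of "e i * (?r - \<rho>'' (b * e i))" "t * ?r"] by (simp add: abs_mult)
    also have "\<dots> \<le> Q * \<bar>t\<bar> + \<bar>e i\<bar> * (L * (a * \<bar>t\<bar> + \<bar>a - b\<bar> * \<bar>e i\<bar>))"
      using 1 2 by (simp add: mult.commute)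
    also have "\<bar>e i\<bar> * (L * (a * \<bar>t\<bar> + \<bar>a - b\<bar> * \<bar>e i\<bar>)) = L * (a * \<bar>t\<bar> * \<bar>e i\<bar> + \<bar>a - b\<bar> * \<bar>e i\<bar>\<^sup>2)"
      by (simp add: algebra_simps power2_eq_square del: abs_mult_self_eq power2_abs)
    finally show "\<bar>(e i - t) * ?r - e i * \<rho>'' (b * e i)\<bar> \<le> Q * \<bar>t\<bar> + L * (a * \<bar>t\<bar> * \<bar>e i\<bar> + \<bar>a - b\<bar> * (e i)\<^sup>2)"
      by simp
  qed
  also have "\<dots> = Q * \<bar>t\<bar> + L * (a * \<bar>t\<bar> * avg Z (\<lambda>i. \<bar>e i\<bar>) + \<bar>a - b\<bar> * avg Z (\<lambda>i. (e i)\<^sup>2))"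
    using Z by (simp add: avg_cmult avg_add avg_const)
  also have "\<dots> \<le> Q * \<bar>t\<bar> + L * (a * \<bar>t\<bar> * (1 + K) + \<bar>a - b\<bar> * K)"
    using avg_abs_le_square[OF Z, of e] assms(2,3) L_nonneg
    by (intro mult_left_mono add_left_mono add_mono) auto
  finally show ?thesis .
qed

text \<open>
  Zeros of the score at scales \<open>1/a\<close> and \<open>1/b\<close>: the mean value theorem in the location gives a slope
  of at least \<open>b m / 4\<close>, and in the scale a slope that is small because the average of
  \<open>e \<rho>''(b e)\<close> is.
\<close>

lemma score_zeros_close:
  assumes Z: "card Z > 0" and b: "b > 0" and x: "x \<le> b / 2"
    and a: "\<bar>a - b\<bar> \<le> x" and t: "\<bar>t\<bar> \<le> x" and u: "\<bar>u\<bar> \<le> x"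
    and t0: "avg Z (\<lambda>i. \<rho>' (a * (e i - t))) = 0" and u0: "avg Z (\<lambda>i. \<rho>' (b * (e i - u))) = 0"
    and m: "m > 0" "avg Z (\<lambda>i. \<rho>'' (b * e i)) \<ge> m" and x': "\<bar>avg Z (\<lambda>i. e i * \<rho>'' (b * e i))\<bar> \<le> x"
    and K: "avg Z (\<lambda>i. (e i)\<^sup>2) \<le> K" "K \<ge> 0" and small: "L * (2 * b * x + x * (1 + K)) \<le> m / 2"
  shows "\<bar>t - u\<bar> \<le> \<bar>a - b\<bar> * (4 / (b * m)) * (x + Q * x + L * (2 * b * x * (1 + K) + x * K))"
proof -
  have x0: "x \<ge> 0" using a by linarith
  \<comment> \<open>Keeps every inverse scale met below away from 0 and bounded.\<close>
  have near: "c \<ge> b / 2 \<and> c \<le> 2 * b" if "\<bar>c - b\<bar> \<le> x" for c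
    using that x b unfolding abs_le_iff by linarith
  define S where "S = x + Q * x + L * (2 * b * x * (1 + K) + x * K)"
  let ?\<Psi> = "\<lambda>a t. avg Z (\<lambda>i. \<rho>' (a * (e i - t)))"
  have scale: "\<bar>?\<Psi> a u - ?\<Psi> b u\<bar> \<le> S * \<bar>a - b\<bar>"
  proof -
    have "norm (?\<Psi> a u - ?\<Psi> b u) \<le> S * norm (a - b)"
    proof (rule field_differentiable_bound[where S="cball b x" and f = "\<lambda>a. ?\<Psi> a u"
          and f' = "\<lambda>a. avg Z (\<lambda>i. (e i - u) * \<rho>'' (a * (e i - u)))"])
      fix c assume "c \<in> cball b x"
      then have c: "\<bar>c - b\<bar> \<le> x" by (simp add: dist_real_def)
      have cb: "c \<ge> 0" "c \<le> 2 * b" using near[OF c] b by auto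
      have "\<bar>avg Z (\<lambda>i. (e i - u) * \<rho>'' (c * (e i - u)))\<bar> \<le> x + (Q * \<bar>u\<bar> + L * (c * \<bar>u\<bar> * (1 + K) + \<bar>c - b\<bar> * K))"
        using avg_times_rho''_perturb[OF Z cb(1) K(1), of u b] x' by linarith
      also have "\<dots> \<le> S"
      proof -
        have "Q * \<bar>u\<bar> \<le> Q * x" using u Q_nonneg by (intro mult_left_mono)
        moreover have "c * \<bar>u\<bar> * (1 + K) + \<bar>c - b\<bar> * K \<le> 2 * b * x * (1 + K) + x * K"
          using u c cb K(2) x0 by (intro add_mono mult_mono) auto
        then have "L * (c * \<bar>u\<bar> * (1 + K) + \<bar>c - b\<bar> * K) \<le> L * (2 * b * x * (1 + K) + x * K)"
          using L_nonneg by (intro mult_left_mono)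
        ultimately show ?thesis unfolding S_def by linarith
      qed
      finally show "norm (avg Z (\<lambda>i. (e i - u) * \<rho>'' (c * (e i - u)))) \<le> S" by simp
    qed (use a x0 in \<open>auto simp: dist_real_def abs_minus_commute intro!: has_field_derivative_at_within[OF DERIV_avg_scale]\<close>)
    then show ?thesis by simp
  qed
  have loc: "\<bar>?\<Psi> a t - ?\<Psi> a u\<bar> \<ge> (b * m / 4) * \<bar>t - u\<bar>"
  proof -
    have slope: "\<bar>?\<Psi> a v - ?\<Psi> a w\<bar> \<ge> (b * m / 4) * (w - v)"
      if vw: "v < w" "\<bar>v\<bar> \<le> x" "\<bar>w\<bar> \<le> x" for v w
    proof -
      obtain z where z: "v < z" "z < w"
        "?\<Psi> a w - ?\<Psi> a v = (w - v) * (- a * avg Z (\<lambda>i. \<rho>'' (a * (e i - z))))"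
        using MVT2[OF vw(1), of "?\<Psi> a" "\<lambda>z. - a * avg Z (\<lambda>i. \<rho>'' (a * (e i - z)))"]
          DERIV_avg_shift by blast
      have z': "\<bar>z\<bar> \<le> x" using z(1,2) vw by linarith
      have ab: "a \<ge> b / 2" "a \<le> 2 * b" using near[OF a] by auto
      \<comment> \<open>At least half of the curvature \<open>m\<close> survives the move from
        \<open>b\<close> and 0 to \<open>a\<close> and \<open>z\<close>; with
        \<open>a \<ge> b / 2\<close> the slope is at least \<open>b * m / 4\<close>.\<close>
      have "L * (a * \<bar>z\<bar> + \<bar>a - b\<bar> * (1 + K)) \<le> L * (2 * b * x + x * (1 + K))"
        using L_nonneg z' a ab b K(2) x0 by (intro mult_left_mono add_mono mult_mono) auto
      then have "avg Z (\<lambda>i. \<rho>'' (a * (e i - z))) \<ge> m / 2"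
        using avg_rho''_perturb[OF Z _ K(1), of a z b] ab b m(2) small by linarith
      then have "b / 2 * (m / 2) \<le> a * avg Z (\<lambda>i. \<rho>'' (a * (e i - z)))"
        using ab b m by (intro mult_mono) auto
      then have "(w - v) * (b / 2 * (m / 2)) \<le> (w - v) * (a * avg Z (\<lambda>i. \<rho>'' (a * (e i - z))))"
        using vw by (intro mult_left_mono) auto
      also have "(w - v) * (a * avg Z (\<lambda>i. \<rho>'' (a * (e i - z)))) = ?\<Psi> a v - ?\<Psi> a w"
        using z(3) by simp
      also have "\<dots> \<le> \<bar>?\<Psi> a v - ?\<Psi> a w\<bar>" by (rule abs_ge_self)
      finally show ?thesis by (simp add: mult.commute)
    qed
    consider "t < u" | "t = u" | "u < t" by linarith
    then show ?thesis
    proof cases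
      case 1
      then show ?thesis using slope[of t u] t u by (simp add: abs_of_neg)
    next
      case 3
      then show ?thesis
        using slope[of u t] t u by (simp add: abs_minus_commute[of "?\<Psi> a t"])
    qed simp
  qed
  \<comment> \<open>Both scores vanish at their own zeros, so the change in location from
    \<open>u\<close> to \<open>t\<close> and the change in scale from \<open>b\<close> to
    \<open>a\<close> both equal, in absolute value, the score at \<open>a\<close> and
    \<open>u\<close>.\<close>
  have "(b * m / 4) * \<bar>t - u\<bar> \<le> S * \<bar>a - b\<bar>"
    using loc scale t0 u0 by (simp add: abs_minus_commute)
  then have "\<bar>t - u\<bar> \<le> S * \<bar>a - b\<bar> / (b * m / 4)"
    using b m(1) by (simp add: field_simps)
  also have "\<dots> = \<bar>a - b\<bar> * (4 / (b * m)) * S" by simp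
  finally show ?thesis unfolding S_def .
qed

text \<open>A point beyond \<open>B\<close> loses to the origin even if all outliers are free there
  and cost the maximum at the origin; \<open>budget\<close> says just this. Within \<open>B\<close>
  the outliers sit strictly beyond \<open>x_star\<close>: their loss is constant and their score is
  zero.\<close>

lemma minimizer_with_outliers:
  assumes fin: "finite I" and Z: "Z \<subseteq> I" "card Z > 0" and a: "a > 0" and B: "B \<ge> 0"
    and min: "\<And>u. (\<Sum>i\<in>I. \<rho> (a * (e i - t))) \<le> (\<Sum>i\<in>I. \<rho> (a * (e i - u)))"
    and out: "\<And>j. j \<in> I - Z \<Longrightarrow> a * (\<bar>e j\<bar> - B) > x_star"
    and far: "\<And>u. \<bar>u\<bar> > B \<Longrightarrow> avg Z (\<lambda>i. \<rho> (a * (e i - u))) \<ge> F"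
    and budget: "real (card Z) * avg Z (\<lambda>i. \<rho> (a * e i)) + real (card (I - Z)) * rho_star < real (card Z) * F"
  shows "\<bar>t\<bar> \<le> B" "\<bar>u\<bar> \<le> B \<Longrightarrow> avg Z (\<lambda>i. \<rho> (a * (e i - t))) \<le> avg Z (\<lambda>i. \<rho> (a * (e i - u)))"
    "avg Z (\<lambda>i. \<rho>' (a * (e i - t))) = 0"
proof -
  have split: "(\<Sum>i\<in>I. f i) = real (card Z) * avg Z f + (\<Sum>i\<in>I - Z. f i)" for f
    using sum.subset_diff[OF Z(1) fin, of f] sum_eq_card_avg[OF Z(2), of f] by simp
  show t: "\<bar>t\<bar> \<le> B"
  proof (rule ccontr)
    assume "\<not> \<bar>t\<bar> \<le> B"
    then have "real (card Z) * F \<le> real (card Z) * avg Z (\<lambda>i. \<rho> (a * (e i - t)))"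
      by (intro mult_left_mono far) auto
    also have "\<dots> \<le> (\<Sum>i\<in>I. \<rho> (a * (e i - t)))"
      unfolding split using rho_nonneg by (simp add: sum_nonneg)
    also have "\<dots> \<le> (\<Sum>i\<in>I. \<rho> (a * (e i - 0)))" by (rule min)
    also have "\<dots> \<le> real (card Z) * avg Z (\<lambda>i. \<rho> (a * e i)) + real (card (I - Z)) * rho_star"
      unfolding split using sum_mono[of "I - Z" "\<lambda>i. \<rho> (a * e i)" "\<lambda>_. rho_star"] rho_le_star by simp
    finally show False using budget by simp
  qed
  have outer: "\<bar>a * (e j - u)\<bar> > x_star" if "j \<in> I - Z" "\<bar>u\<bar> \<le> B" for j u
  proof -
    have "a * (\<bar>e j\<bar> - B) \<le> a * \<bar>e j - u\<bar>"
      using that(2) a by (intro mult_left_mono) auto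
    also have "\<dots> = \<bar>a * (e j - u)\<bar>" using a by (simp add: abs_mult)
    finally show ?thesis using out[OF that(1)] by linarith
  qed
  then have eq: "(\<Sum>i\<in>I. \<rho> (a * (e i - u))) = real (card Z) * avg Z (\<lambda>i. \<rho> (a * (e i - u))) + real (card (I - Z)) * rho_star"
    if "\<bar>u\<bar> \<le> B" for u
    unfolding split using that by (simp add: rho_eq_star less_imp_le)
  show "avg Z (\<lambda>i. \<rho> (a * (e i - t))) \<le> avg Z (\<lambda>i. \<rho> (a * (e i - u)))" if "\<bar>u\<bar> \<le> B"
    using min[of u] Z(2) unfolding eq[OF that] eq[OF t] by simp
  have "(\<Sum>i\<in>I. \<rho>' (a * (e i - t))) = 0"
    by (rule sum_rho'_eq_0_if_minimizer[OF min a])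
  moreover have "(\<Sum>i\<in>I. \<rho>' (a * (e i - t))) = real (card Z) * avg Z (\<lambda>i. \<rho>' (a * (e i - t)))"
    unfolding split using outer t by (simp add: rho'_outer)
  ultimately show "avg Z (\<lambda>i. \<rho>' (a * (e i - t))) = 0" using Z(2) by simp
qed

end

section \<open>Measurable minimizers\<close>

text \<open>A bounded loss is not coercive. The level \<open>r\<close> replaces coercivity: points
  with a value below it lie in a compact interval, and so do good enough approximate
  minimizers.\<close>

lemma attains_minimum_if_below_level_at_infinity:
  fixes f :: "real \<Rightarrow> real"
  assumes cont: "continuous_on UNIV f" and level: "\<And>u. b < \<bar>u\<bar> \<Longrightarrow> r \<le> f u" and "f u0 < r"
    and S: "closed S" and approx: "\<And>e. e > 0 \<Longrightarrow> \<exists>u\<in>S. \<forall>v. f u \<le> f v + e"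
  shows "\<exists>u\<in>S. \<forall>v. f u \<le> f v"
proof -
  let ?T = "S \<inter> {-b..b}"
  have inT: "u \<in> ?T" if "u \<in> S" "f u < r" for u
    using that level[of u] by fastforce
  have "compact ?T" using S by (intro closed_Int_compact) auto
  moreover have "?T \<noteq> {}"
  proof -
    have "(r - f u0) / 2 > 0" using assms(3) by simp
    from approx[OF this] obtain u where u: "u \<in> S" "\<forall>v. f u \<le> f v + (r - f u0) / 2" by blast
    have "f u < r" using u(2)[rule_format, of u0] assms(3) by (simp add: field_simps)
    then show ?thesis using inT u(1) by blast
  qed
  moreover have "continuous_on ?T f" using cont continuous_on_subset by blast
  ultimately obtain u where u: "u \<in> ?T" "\<And>w. w \<in> ?T \<Longrightarrow> f u \<le> f w"
    using continuous_attains_inf by metis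
  have "f u \<le> f v" for v
  proof (rule ccontr)
    assume v: "\<not> f u \<le> f v"
    \<comment> \<open>With this tolerance an approximate minimizer lies below the level, hence in
      \<open>?T\<close>, and beats the minimum \<open>u\<close> over \<open>?T\<close>.\<close>
    define e where "e = min (f u - f v) (r - f u0) / 2"
    have e: "e > 0" "e < f u - f v" "e < r - f u0"
      using v assms(3) unfolding e_def by auto
    from approx[OF e(1)] obtain w where w: "w \<in> S" "\<And>v. f w \<le> f v + e" by blast
    have "f w < r" "f w < f u" using w(2)[of u0] w(2)[of v] e by linarith+
    then show False using inT[OF w(1)] u(2) by fastforce
  qed
  then show ?thesis using u(1) by blast
qed

text \<open>Approximating from the left keeps the rational in \<open>{..c}\<close> whenever
  \<open>u\<close> is in it, also for \<open>u = c\<close>.\<close>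

lemma rational_approximation_left:
  fixes f :: "real \<Rightarrow> real"
  assumes "continuous_on UNIV f" "e > 0"
  obtains q where "real_of_rat q < u" "\<bar>f (real_of_rat q) - f u\<bar> < e"
proof -
  have "isCont f u" using assms(1) continuous_on_eq_continuous_at by blast
  then obtain d where d: "d > 0" "\<And>x. \<bar>x - u\<bar> < d \<Longrightarrow> \<bar>f x - f u\<bar> < e"
    unfolding continuous_at_eps_delta dist_real_def using assms(2) by blast
  obtain q where "u - d < real_of_rat q" "real_of_rat q < u"
    using of_rat_dense[of "u - d" u] d(1) by auto
  then show ?thesis using that d(2)[of "real_of_rat q"] by auto
qed

text \<open>
  The smallest minimizer is measurable: it is at most \<open>c\<close> iff the infimum over rationals up to \<open>c\<close>
  equals the infimum over all rationals.
\<close>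

lemma measurable_minimizer:
  fixes R :: "'a \<Rightarrow> real \<Rightarrow> real"
  assumes [measurable]: "\<And>u. (\<lambda>\<omega>. R \<omega> u) \<in> borel_measurable M"
    and cont: "\<And>\<omega>. \<omega> \<in> space M \<Longrightarrow> continuous_on UNIV (R \<omega>)"
    and level: "\<And>\<omega>. \<omega> \<in> space M \<Longrightarrow> \<not> (\<forall>u. R \<omega> u = R \<omega> 0) \<Longrightarrow>
      \<exists>b r. (\<forall>u. b < \<bar>u\<bar> \<longrightarrow> r \<le> R \<omega> u) \<and> (\<exists>u. R \<omega> u < r)"
  obtains m where "m \<in> borel_measurable M" "\<And>\<omega> u. \<omega> \<in> space M \<Longrightarrow> R \<omega> (m \<omega>) \<le> R \<omega> u"
proof -
  \<comment> \<open>A constant objective has no smallest minimizer and is treated apart, with value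
    0. Testing rationals only keeps the condition measurable.\<close>
  define const where "const \<omega> \<longleftrightarrow> (\<forall>q::rat. R \<omega> (of_rat q) = R \<omega> 0)" for \<omega>
  have [measurable]: "Measurable.pred M const"
    unfolding const_def by measurable
  have const: "R \<omega> u = R \<omega> 0" if \<omega>: "\<omega> \<in> space M" "const \<omega>" for \<omega> u
  proof (rule ccontr)
    assume "R \<omega> u \<noteq> R \<omega> 0"
    then have "\<bar>R \<omega> 0 - R \<omega> u\<bar> > 0" by simp
    then obtain q where "\<bar>R \<omega> (real_of_rat q) - R \<omega> u\<bar> < \<bar>R \<omega> 0 - R \<omega> u\<bar>"
      using rational_approximation_left[OF cont[OF \<omega>(1)]] by metis
    then show False using \<omega>(2) unfolding const_def by simp
  qed
  define A where "A \<omega> = {u. \<forall>v. R \<omega> u \<le> R \<omega> v}" for \<omega>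
  define m where "m \<omega> = (if const \<omega> then 0 else Inf (A \<omega>))" for \<omega>
  have nc: "\<exists>b r. (\<forall>u. b < \<bar>u\<bar> \<longrightarrow> r \<le> R \<omega> u) \<and> (\<exists>u. R \<omega> u < r)"
    if "\<omega> \<in> space M" "\<not> const \<omega>" for \<omega>
    using level[OF that(1)] that(2) unfolding const_def by blast
  have A: "Inf (A \<omega>) \<in> A \<omega> \<and> bdd_below (A \<omega>)" if \<omega>: "\<omega> \<in> space M" "\<not> const \<omega>" for \<omega>
  proof -
    obtain b r u0 where b: "\<And>u. b < \<bar>u\<bar> \<Longrightarrow> r \<le> R \<omega> u" "R \<omega> u0 < r"
      using nc[OF \<omega>] by blast
    have u0: "u0 \<in> {-b..b}" using b(1)[of u0] b(2) by fastforce
    moreover have "compact {-b..b}" "continuous_on {-b..b} (R \<omega>)"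
      using cont[OF \<omega>(1)] continuous_on_subset by blast+
    ultimately obtain u where u: "\<And>v. v \<in> {-b..b} \<Longrightarrow> R \<omega> u \<le> R \<omega> v"
      using continuous_attains_inf[of "{-b..b}" "R \<omega>"] by blast
    have "R \<omega> u \<le> R \<omega> v" for v
    proof (cases "v \<in> {-b..b}")
      case False
      then have "r \<le> R \<omega> v" by (intro b(1)) auto
      then show ?thesis using u[OF u0] b(2) by linarith
    qed (rule u)
    then have "A \<omega> \<noteq> {}" unfolding A_def by blast
    moreover have "closed (A \<omega>)"
      unfolding A_def
      by (intro closed_Collect_all closed_Collect_le cont[OF \<omega>(1)] continuous_on_const)
    moreover have "bdd_below (A \<omega>)"
    proof (rule bdd_belowI[of _ "- b"])
      fix v assume "v \<in> A \<omega>"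
      then have "R \<omega> v < r" using b(2) unfolding A_def by (metis (mono_tags) le_less_trans mem_Collect_eq)
      then show "- b \<le> v" using b(1)[of v] by fastforce
    qed
    ultimately show ?thesis using closed_contains_Inf by blast
  qed
  have le_iff: "m \<omega> \<le> c \<longleftrightarrow> (const \<omega> \<and> 0 \<le> c) \<or> (\<not> const \<omega> \<and> (\<forall>k::nat. \<exists>q::rat. of_rat q \<le> c \<and>
      (\<forall>p::rat. R \<omega> (of_rat q) \<le> R \<omega> (of_rat p) + 1 / real (Suc k))))"
    (is "_ \<longleftrightarrow> _ \<or> (_ \<and> ?P \<omega> c)") if \<omega>: "\<omega> \<in> space M" for \<omega> c
  proof (cases "const \<omega>")
    case False
    have "Inf (A \<omega>) \<le> c \<longleftrightarrow> (\<exists>u\<in>{..c}. \<forall>v. R \<omega> u \<le> R \<omega> v)"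
    proof
      assume "Inf (A \<omega>) \<le> c"
      moreover have "\<forall>v. R \<omega> (Inf (A \<omega>)) \<le> R \<omega> v"
        using A[OF \<omega> False] unfolding A_def by blast
      ultimately show "\<exists>u\<in>{..c}. \<forall>v. R \<omega> u \<le> R \<omega> v" by blast
    next
      assume "\<exists>u\<in>{..c}. \<forall>v. R \<omega> u \<le> R \<omega> v"
      then obtain u where "u \<le> c" "u \<in> A \<omega>" unfolding A_def by blast
      then show "Inf (A \<omega>) \<le> c"
        using cInf_lower[of u "A \<omega>"] A[OF \<omega> False] by linarith
    qed
    also have "\<dots> \<longleftrightarrow> ?P \<omega> c"
    proof
      assume "\<exists>u\<in>{..c}. \<forall>v. R \<omega> u \<le> R \<omega> v"
      then obtain u where u: "u \<le> c" "\<And>v. R \<omega> u \<le> R \<omega> v" by blast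
      show "?P \<omega> c"
      proof
        fix k :: nat
        have "1 / real (Suc k) > 0" by simp
        then obtain q where q: "real_of_rat q < u" "\<bar>R \<omega> (real_of_rat q) - R \<omega> u\<bar> < 1 / real (Suc k)"
          using rational_approximation_left[OF cont[OF \<omega>]] by metis
        have "R \<omega> (real_of_rat q) \<le> R \<omega> v + 1 / real (Suc k)" for v
          using q(2) u(2)[of v] by linarith
        then show "\<exists>q. real_of_rat q \<le> c \<and> (\<forall>p. R \<omega> (real_of_rat q) \<le> R \<omega> (real_of_rat p) + 1 / real (Suc k))"
          using q(1) u(1) by (intro exI[of _ q]) auto
      qed
    next
      assume P: "?P \<omega> c"
      obtain b r u0 where b: "\<And>u. b < \<bar>u\<bar> \<Longrightarrow> r \<le> R \<omega> u" "R \<omega> u0 < r"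
        using nc[OF \<omega> False] by blast
      show "\<exists>u\<in>{..c}. \<forall>v. R \<omega> u \<le> R \<omega> v"
      proof (rule attains_minimum_if_below_level_at_infinity[OF cont[OF \<omega>] b])
        fix e :: real assume "e > 0"
        then have "e / 2 > 0" by simp
        then obtain k where k: "1 / real (Suc k) < e / 2" using nat_approx_posE by blast
        obtain q where q: "real_of_rat q \<le> c"
            "\<And>p. R \<omega> (real_of_rat q) \<le> R \<omega> (real_of_rat p) + 1 / real (Suc k)"
          using P by blast
        have "R \<omega> (real_of_rat q) \<le> R \<omega> v + e" for v
        proof -
          obtain p where "\<bar>R \<omega> (real_of_rat p) - R \<omega> v\<bar> < e / 2"
            using rational_approximation_left[OF cont[OF \<omega>] \<open>e / 2 > 0\<close>] by metis
          then show ?thesis using q(2)[of p] k by linarith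
        qed
        then show "\<exists>u\<in>{..c}. \<forall>v. R \<omega> u \<le> R \<omega> v + e" using q(1) by blast
      qed simp_all
    qed
    finally show ?thesis using False by (simp add: m_def)
  qed (simp add: m_def)
  have "m \<in> borel_measurable M"
  proof (rule borel_measurableI_le)
    fix c
    have "{\<omega> \<in> space M. m \<omega> \<le> c} = {\<omega> \<in> space M. (const \<omega> \<and> 0 \<le> c) \<or> (\<not> const \<omega> \<and> (\<forall>k::nat. \<exists>q::rat. of_rat q \<le> c \<and>
      (\<forall>p::rat. R \<omega> (of_rat q) \<le> R \<omega> (of_rat p) + 1 / real (Suc k))))}"
      using le_iff by blast
    also have "\<dots> \<in> sets M" by measurable
    finally show "{\<omega> \<in> space M. m \<omega> \<le> c} \<in> sets M" .
  qed
  moreover have "R \<omega> (m \<omega>) \<le> R \<omega> u" if "\<omega> \<in> space M" for \<omega> u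
    using const[OF that] A[OF that] unfolding m_def A_def
    by (cases "const \<omega>") (metis order_refl, auto)
  ultimately show ?thesis using that by blast
qed

text \<open>If the objective is not constant, then the scale is nonzero and there is an observation.
  Far out every term equals \<open>rho_star\<close>, whereas at an observation one term is 0; this
  is the level condition.\<close>

lemma (in bounded_rho) measurable_objective_minimizer:
  assumes s[measurable]: "s \<in> borel_measurable M"
    and y[measurable]: "\<And>i. i \<in> I \<Longrightarrow> (\<lambda>\<omega>. y \<omega> i) \<in> borel_measurable M" and fin: "finite I"
  obtains m where "m \<in> borel_measurable M"
    "\<And>\<omega>. \<omega> \<in> space M \<Longrightarrow> minimizer (objective \<rho> I (y \<omega>) (s \<omega>)) (m \<omega>)"
proof -
  let ?R = "\<lambda>\<omega>. objective \<rho> I (y \<omega>) (s \<omega>)"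
  have meas: "(\<lambda>\<omega>. ?R \<omega> u) \<in> borel_measurable M" for u
    unfolding objective_def by (intro borel_measurable_sum) measurable
  have cont_rho: "continuous_on UNIV \<rho>"
    using deriv1 by (intro continuous_at_imp_continuous_on) (auto intro: DERIV_isCont)
  have cont: "continuous_on UNIV (?R \<omega>)" for \<omega>
    unfolding objective_def divide_inverse
    by (intro continuous_intros continuous_on_compose2[OF cont_rho]) auto
  have level: "\<exists>b r. (\<forall>u. b < \<bar>u\<bar> \<longrightarrow> r \<le> ?R \<omega> u) \<and> (\<exists>u. ?R \<omega> u < r)"
    if nc: "\<not> (\<forall>u. ?R \<omega> u = ?R \<omega> 0)" for \<omega>
  proof -
    have s0: "s \<omega> \<noteq> 0" using nc by (auto simp: objective_def)
    obtain k where k: "k \<in> I" using nc by (fastforce simp: objective_def)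
    let ?b = "(\<Sum>i\<in>I. \<bar>y \<omega> i\<bar>) + \<bar>s \<omega>\<bar> * x_star"
    have "(\<Sum>i\<in>I. rho_star) \<le> ?R \<omega> u" if u: "?b < \<bar>u\<bar>" for u
      unfolding objective_def
    proof (rule sum_mono)
      fix i assume "i \<in> I"
      then have "\<bar>y \<omega> i\<bar> \<le> (\<Sum>i\<in>I. \<bar>y \<omega> i\<bar>)"
        using member_le_sum[of i I "\<lambda>i. \<bar>y \<omega> i\<bar>"] fin by simp
      then have "\<bar>s \<omega>\<bar> * x_star \<le> \<bar>y \<omega> i - u\<bar>" using u by linarith
      then have "x_star \<le> \<bar>(y \<omega> i - u) / s \<omega>\<bar>"
        using s0 by (simp add: pos_le_divide_eq mult.commute)
      then show "rho_star \<le> \<rho> ((y \<omega> i - u) / s \<omega>)" by (simp add: rho_eq_star)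
    qed
    moreover have "?R \<omega> (y \<omega> k) < (\<Sum>i\<in>I. rho_star)"
      unfolding objective_def
      using k rho_0 rho_star_pos by (intro sum_strict_mono_ex1 fin ballI rho_le_star bexI[of _ k]) auto
    ultimately show ?thesis by blast
  qed
  show thesis
  proof (rule measurable_minimizer[of ?R M, OF meas cont level])
    fix m assume "m \<in> borel_measurable M" "\<And>\<omega> u. \<omega> \<in> space M \<Longrightarrow> ?R \<omega> (m \<omega>) \<le> ?R \<omega> u"
    then show thesis by (intro that) (auto simp: minimizer_iff)
  qed
qed

section \<open>Location estimation from the good observations\<close>

lemma small_multiples:
  fixes P R p q r :: real
  assumes "0 \<le> P" "0 \<le> R" "0 < p" "0 < q" "0 < r"
  obtains x where "x > 0" "x \<le> p" "P * x \<le> q" "R * x \<le> r"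
proof -
  \<comment> \<open>Adding 1 to the denominators covers vanishing coefficients.\<close>
  define x where "x = min p (min (q / (P + 1)) (r / (R + 1)))"
  have x: "x > 0" "x \<le> p" "x \<le> q / (P + 1)" "x \<le> r / (R + 1)"
    using assms by (auto simp: x_def)
  have "(P + 1) * x \<le> q" "(R + 1) * x \<le> r"
    using x assms by (auto simp: field_simps)
  then have "P * x \<le> q" "R * x \<le> r" using x(1) by (auto simp: distrib_right)
  then show ?thesis using that x by blast
qed

text \<open>The model in standardised coordinates: \<open>t_good\<close> is the location error in
  units of \<open>\<sigma>0\<close>, and \<open>b\<close> is the inverse of the limiting relative
  scale.\<close>

locale location_model = iid_rows M \<zeta> \<epsilon> D + bounded_rho \<rho> \<rho>' \<rho>'' x_star rho_star C L
  for M :: "nat \<Rightarrow> 'a measure" and \<zeta> :: "nat \<Rightarrow> 'i set" and \<epsilon> D \<rho> \<rho>' \<rho>'' x_star rho_star C L +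
  fixes b :: real and t_good :: "nat \<Rightarrow> 'a \<Rightarrow> real"
  assumes b_pos: "b > 0"
    and good_min: "\<And>n \<omega> u. \<omega> \<in> space (M n) \<Longrightarrow>
      (\<Sum>i\<in>\<zeta> n. \<rho> (b * (\<epsilon> n i \<omega> - t_good n \<omega>))) \<le> (\<Sum>i\<in>\<zeta> n. \<rho> (b * (\<epsilon> n i \<omega> - u)))"
    and good_consistent: "\<And>d. d > 0 \<Longrightarrow> with_large_prob M (\<lambda>n \<omega>. \<bar>t_good n \<omega>\<bar> \<le> d)"
    and good_rate: "\<And>e. e > 0 \<Longrightarrow> \<exists>K>0. likely M e (\<lambda>n \<omega>. real (card (\<zeta> n)) * (t_good n \<omega>)\<^sup>2 \<le> K)"
    and curvature: "(\<integral>x. \<rho>'' (b * x) \<partial>D) > 0"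
    and cross_curvature: "(\<integral>x. x * \<rho>'' (b * x) \<partial>D) = 0"
begin

sublocale D: real_distribution D by (rule real_distribution_D)

section \<open>The population objective and its unique minimum\<close>

definition g :: "real \<Rightarrow> real" where "g t = (\<integral>x. \<rho> (b * (x - t)) \<partial>D)"

lemma integrable_bounded: 
  fixes f :: "real \<Rightarrow> real"
  assumes "f \<in> borel_measurable borel" "\<And>x. \<bar>f x\<bar> \<le> B"
  shows "integrable D f"
  using assms by (intro D.integrable_const_bound[where B = B]) (auto intro!: AE_I2)

lemma rho_abs_le: "\<bar>\<rho> x\<bar> \<le> rho_star"
  using rho_nonneg[of x] rho_le_star[of x] by simp

lemma integrable_rho: "integrable D (\<lambda>x. \<rho> (b * (x - t)))"
  "integrable D (\<lambda>x. \<rho>' (b * x))" "integrable D (\<lambda>x. \<rho>'' (b * x))"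
  by (rule integrable_bounded, measurable, rule rho_abs_le rho'_bound rho''_bound)+

lemma g_le_star: "g t \<le> rho_star"
proof -
  have "g t \<le> (\<integral>x. rho_star \<partial>D)"
    unfolding g_def by (intro integral_mono integrable_rho rho_le_star) simp
  then show ?thesis using D.prob_space by simp
qed

lemma lln_rho:
  assumes "d > 0"
  shows "with_large_prob M (\<lambda>n \<omega>. \<bar>avg (\<zeta> n) (\<lambda>i. \<rho> (b * (\<epsilon> n i \<omega> - t))) - g t\<bar> \<le> d)"
  unfolding g_def
  by (rule law_of_large_numbers[OF _ rho_abs_le assms]) measurable

lemma g_lipschitz: "\<bar>g t - g u\<bar> \<le> C * b * \<bar>t - u\<bar>"
proof -
  have "g t - g u = (\<integral>x. \<rho> (b * (x - t)) - \<rho> (b * (x - u)) \<partial>D)"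
    unfolding g_def by (simp add: integrable_rho)
  also have "\<bar>\<dots>\<bar> \<le> (\<integral>x. \<bar>\<rho> (b * (x - t)) - \<rho> (b * (x - u))\<bar> \<partial>D)"
    by (rule integral_abs_bound)
  also have "\<dots> \<le> (\<integral>x. C * b * \<bar>t - u\<bar> \<partial>D)"
  proof (rule integral_mono)
    fix x
    have "\<bar>b * (x - t) - b * (x - u)\<bar> = b * \<bar>t - u\<bar>"
      using b_pos by (simp add: right_diff_distrib[symmetric] abs_mult abs_minus_commute)
    then show "\<bar>\<rho> (b * (x - t)) - \<rho> (b * (x - u))\<bar> \<le> C * b * \<bar>t - u\<bar>"
      using rho_diff_le[of "b * (x - t)" "b * (x - u)"] by (simp add: mult.assoc)
  qed (auto intro!: integrable_abs integrable_diff integrable_rho)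
  finally show ?thesis using D.prob_space by simp
qed

text \<open>The good minimizers tend to 0, so in the limit 0 inherits their minimality.\<close>

lemma g_ge_0: "g 0 \<le> g t"
proof (rule field_le_epsilon)
  fix e :: real assume e: "e > 0"
  \<comment> \<open>Two shares of \<open>d\<close> go to the averages at \<open>t\<close> and at 0,
    and \<open>C * b\<close> shares to the move from 0 to \<open>t_good\<close>.\<close>
  define d where "d = e / (2 + C * b)"
  have Cb: "C * b \<ge> 0" using C_nonneg b_pos by simp
  then have d: "d > 0" using e by (simp add: d_def)
  have "with_large_prob M (\<lambda>n \<omega>. \<bar>avg (\<zeta> n) (\<lambda>i. \<rho> (b * (\<epsilon> n i \<omega> - t))) - g t\<bar> \<le> d \<and>
      \<bar>avg (\<zeta> n) (\<lambda>i. \<rho> (b * (\<epsilon> n i \<omega> - 0))) - g 0\<bar> \<le> d \<and> \<bar>t_good n \<omega>\<bar> \<le> d)"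
    using d by (intro with_large_prob_conj prob lln_rho good_consistent)
  from likely_satisfiable[OF this[unfolded with_large_prob_iff_likely, rule_format, of 1]]
  have "\<forall>\<^sub>F n in sequentially. \<exists>\<omega>\<in>space (M n). \<bar>avg (\<zeta> n) (\<lambda>i. \<rho> (b * (\<epsilon> n i \<omega> - t))) - g t\<bar> \<le> d \<and>
      \<bar>avg (\<zeta> n) (\<lambda>i. \<rho> (b * (\<epsilon> n i \<omega> - 0))) - g 0\<bar> \<le> d \<and> \<bar>t_good n \<omega>\<bar> \<le> d"
    by simp
  from eventually_happens[OF eventually_conj[OF this eventually_card_pos]]
  obtain n \<omega> where h: "card (\<zeta> n) > 0" and \<omega>: "\<omega> \<in> space (M n)"
    "\<bar>avg (\<zeta> n) (\<lambda>i. \<rho> (b * (\<epsilon> n i \<omega> - t))) - g t\<bar> \<le> d"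
    "\<bar>avg (\<zeta> n) (\<lambda>i. \<rho> (b * (\<epsilon> n i \<omega> - 0))) - g 0\<bar> \<le> d" "\<bar>t_good n \<omega>\<bar> \<le> d"
    by auto
  have "avg (\<zeta> n) (\<lambda>i. \<rho> (b * (\<epsilon> n i \<omega> - t_good n \<omega>))) \<le> avg (\<zeta> n) (\<lambda>i. \<rho> (b * (\<epsilon> n i \<omega> - t)))"
    unfolding avg_def by (intro divide_right_mono good_min \<omega>(1)) simp
  moreover have "C * b * \<bar>0 - t_good n \<omega>\<bar> \<le> C * b * d"
    using \<omega>(4) Cb by (intro mult_left_mono) auto
  ultimately have "g 0 \<le> g t + 2 * d + C * b * d"
    using rho_shift_perturb[OF h b_pos, of "\<lambda>i. \<epsilon> n i \<omega>" 0 "t_good n \<omega>"] \<omega>(2,3) unfolding abs_le_iff by linarith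
  also have "2 * d + C * b * d = (2 + C * b) * d" by (simp add: distrib_right)
  then have "g t + 2 * d + C * b * d = g t + e" using Cb by (simp add: d_def add.assoc)
  finally show "g 0 \<le> g t + e" .
qed

text \<open>The first-order condition at the minimum 0. The second-order bound on \<rho> gives it
  without differentiating under the integral: \<open>s * m\<close> is at most quadratic in
  \<open>s\<close> for both signs of \<open>s\<close>.\<close>

lemma score_mean_zero: "(\<integral>x. \<rho>' (b * x) \<partial>D) = 0"
proof -
  define m where "m = (\<integral>x. \<rho>' (b * x) \<partial>D)"
  have le: "s * m \<le> Q * s\<^sup>2" for s
  proof -
    have "0 \<le> g (s / b) - g 0" using g_ge_0 by simp
    also have "\<dots> = (\<integral>x. \<rho> (b * (x - s / b)) - \<rho> (b * (x - 0)) \<partial>D)"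
      unfolding g_def by (intro Bochner_Integration.integral_diff[symmetric] integrable_rho)
    also have "\<dots> \<le> (\<integral>x. Q * s\<^sup>2 - s * \<rho>' (b * x) \<partial>D)"
    proof (rule integral_mono)
      fix x
      have "b * (x - s / b) = b * x - s" using b_pos by (simp add: field_simps)
      then show "\<rho> (b * (x - s / b)) - \<rho> (b * (x - 0)) \<le> Q * s\<^sup>2 - s * \<rho>' (b * x)"
        using rho_second_order[of "b * x" s] by (simp add: abs_le_iff)
    next
      show "integrable D (\<lambda>x. \<rho> (b * (x - s / b)) - \<rho> (b * (x - 0)))"
        by (intro Bochner_Integration.integrable_diff integrable_rho)
    qed (simp add: integrable_rho)
    also have "\<dots> = Q * s\<^sup>2 - s * m"
      using D.prob_space by (simp add: m_def integrable_rho)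
    finally show ?thesis by simp
  qed
  \<comment> \<open>The choice \<open>s = m / (Q + 1)\<close> leaves the linear side with the larger
    constant.\<close>
  have "(m / (Q + 1)) * m * (Q + 1)\<^sup>2 \<le> Q * (m / (Q + 1))\<^sup>2 * (Q + 1)\<^sup>2"
    by (rule mult_right_mono[OF le]) simp
  then have "m\<^sup>2 * (Q + 1) \<le> Q * m\<^sup>2"
    using Q_nonneg by (simp add: power_divide power2_eq_square)
  then have "m\<^sup>2 \<le> 0" by (simp add: algebra_simps)
  then show ?thesis by (simp add: m_def)
qed

text \<open>
  If \<open>g t = g 0\<close>, the centred sum of \<open>\<rho>(b (\<epsilon> - t)) - \<rho>(b \<epsilon>)\<close> would be bounded below in probability,
  so the summands vanish almost surely. By monotonicity of \<open>\<rho>\<close>, almost all mass then lies where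
  \<open>\<rho>' = \<rho>'' = 0\<close> or at the midpoint \<open>t / 2\<close>, and an atom at the midpoint is excluded by
  the mean-zero score.
\<close>

lemma g_unique_minimum:
  assumes "t \<noteq> 0"
  shows "g 0 < g t"
proof (rule ccontr)
  assume "\<not> g 0 < g t"
  then have eq: "g t = g 0" using g_ge_0[of t] by simp
  define W where "W = (\<lambda>x. \<rho> (b * (x - t)) - \<rho> (b * x))"
  have W: "W \<in> borel_measurable borel" unfolding W_def by measurable
  have W_bound: "\<bar>W x\<bar> \<le> rho_star + rho_star" for x
    unfolding W_def using rho_abs_le[of "b * (x - t)"] rho_abs_le[of "b * x"] by linarith
  have W_mean: "(\<integral>x. W x \<partial>D) = 0"
    using eq integrable_rho(1)[of t] integrable_rho(1)[of 0] unfolding W_def g_def by simp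
  have W2: "integrable D (\<lambda>x. (W x)\<^sup>2)"
  proof (rule integrable_bounded)
    show "\<bar>(W x)\<^sup>2\<bar> \<le> (rho_star + rho_star)\<^sup>2" for x
      using power_mono[OF W_bound[of x], of 2] unfolding power2_abs abs_power2 by simp
  qed (use W in measurable)
  show False
  proof (cases "(\<integral>x. (W x)\<^sup>2 \<partial>D) > 0")
    case True
    then obtain p where p: "p > 0" "\<And>K. \<not> likely M p (\<lambda>n \<omega>. (\<Sum>i\<in>\<zeta> n. W (\<epsilon> n i \<omega>)) \<ge> - K)"
      using centred_sum_not_bounded_below[OF W W_bound W_mean] by blast
    obtain K where K: "likely M p (\<lambda>n \<omega>. real (card (\<zeta> n)) * (t_good n \<omega>)\<^sup>2 \<le> K)"
      using good_rate[OF p(1)] by blast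
    \<comment> \<open>At \<open>t\<close> the good objective is at least its minimum; at 0 it
      exceeds the minimum by no more than \<open>Q * b\<^sup>2 * K\<close>.\<close>
    have "likely M p (\<lambda>n \<omega>. (\<Sum>i\<in>\<zeta> n. W (\<epsilon> n i \<omega>)) \<ge> - (Q * b\<^sup>2 * K))"
    proof (rule likely_mono[OF K], rule always_eventually, safe)
      fix n \<omega> assume \<omega>: "\<omega> \<in> space (M n)" and le: "real (card (\<zeta> n)) * (t_good n \<omega>)\<^sup>2 \<le> K"
      have "(\<Sum>i\<in>\<zeta> n. \<rho> (b * \<epsilon> n i \<omega>)) - (\<Sum>i\<in>\<zeta> n. \<rho> (b * (\<epsilon> n i \<omega> - t_good n \<omega>)))
          \<le> Q * b\<^sup>2 * (real (card (\<zeta> n)) * (t_good n \<omega>)\<^sup>2)"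
        by (rule sum_rho_origin_le[OF good_min[OF \<omega>] b_pos])
      also have "\<dots> \<le> Q * b\<^sup>2 * K"
        using le Q_nonneg by (intro mult_left_mono) auto
      finally show "- (Q * b\<^sup>2 * K) \<le> (\<Sum>i\<in>\<zeta> n. W (\<epsilon> n i \<omega>))"
        using good_min[OF \<omega>, of t] unfolding W_def sum_subtractf by linarith
    qed
    then show False using p(2) by blast
  next
    case False
    moreover have "(\<integral>x. (W x)\<^sup>2 \<partial>D) \<ge> 0"
      by (rule integral_nonneg_AE) simp
    ultimately have "(\<integral>x. (W x)\<^sup>2 \<partial>D) = 0"
      by (simp add: less_le)
    then have "AE x in D. W x = 0"
      using integral_nonneg_eq_0_iff_AE[OF W2] by simp
    then have ae: "AE x in D. \<rho>' (b * x) = indicator {t / 2} x * \<rho>' (b * t / 2) \<and>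
        \<rho>'' (b * x) = indicator {t / 2} x * \<rho>'' (b * t / 2)"
    proof eventually_elim
      case (elim x)
      show ?case
      proof (cases "x = t / 2")
        case False
        have "\<rho>' (b * x) = 0 \<and> \<rho>'' (b * x) = 0"
        proof (rule rho_coincidence)
          show "\<rho> (b * x - b * t) = \<rho> (b * x)"
            using elim by (simp add: W_def right_diff_distrib)
          show "b * t \<noteq> 0" using assms b_pos by simp
          show "b * x \<noteq> b * t / 2" using False b_pos by simp
        qed
        then show ?thesis using False by simp
      next
        case True
        then show ?thesis by (simp only:) simp
      qed
    qed
    \<comment> \<open>Positive curvature can only come from an atom at the midpoint with positive
      \<open>\<rho>''\<close>. The zero mean score then forces \<open>\<rho>'\<close> to vanish
      there, and away from 0 this makes \<open>\<rho>''\<close> vanish too.\<close>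
    have "(\<integral>x. \<rho>' (b * x) \<partial>D) = (\<integral>x. indicator {t / 2} x * \<rho>' (b * t / 2) \<partial>D)"
      by (rule integral_cong_AE) (use ae in \<open>auto elim: eventually_mono\<close>)
    then have 1: "D.prob {t / 2} * \<rho>' (b * t / 2) = 0"
      using score_mean_zero by simp
    have "(\<integral>x. \<rho>'' (b * x) \<partial>D) = (\<integral>x. indicator {t / 2} x * \<rho>'' (b * t / 2) \<partial>D)"
      by (rule integral_cong_AE) (use ae in \<open>auto elim: eventually_mono\<close>)
    then have 2: "D.prob {t / 2} * \<rho>'' (b * t / 2) > 0"
      using curvature by simp
    then have "\<rho>' (b * t / 2) = 0" using 1 by auto
    then have "\<rho>'' (b * t / 2) = 0"
      using assms b_pos by (intro rho''_0_if_rho'_0) auto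
    then show False using 2 by simp
  qed
qed

text \<open>The averages and \<open>g\<close> share the Lipschitz constant \<open>C * b\<close>. A
  finite net of mesh \<open>r\<close> thus suffices: \<open>d / 2\<close> is spent at the net points
  and at most \<open>d / 4\<close> on each of the two moves.\<close>

lemma uniform_law_of_large_numbers:
  assumes d: "d > 0"
  shows "with_large_prob M (\<lambda>n \<omega>. \<forall>t. \<bar>t\<bar> \<le> B \<longrightarrow> \<bar>avg (\<zeta> n) (\<lambda>i. \<rho> (b * (\<epsilon> n i \<omega> - t))) - g t\<bar> \<le> d)"
proof -
  define r where "r = d / (4 * (C * b + 1))"
  have Cb: "C * b \<ge> 0" using C_nonneg b_pos by simp
  have r: "r > 0" using d Cb by (simp add: r_def)
  have Cbr: "C * b * r \<le> d / 4"
    using d Cb by (simp add: r_def field_simps)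
  obtain F where F: "finite F" "{-B..B} \<subseteq> (\<Union>x\<in>F. ball x r)"
    using compact_Icc[of "-B" B] r unfolding compact_eq_totally_bounded by blast
  have "with_large_prob M (\<lambda>n \<omega>. \<forall>u\<in>F. \<bar>avg (\<zeta> n) (\<lambda>i. \<rho> (b * (\<epsilon> n i \<omega> - u))) - g u\<bar> \<le> d / 2)"
    using d by (intro with_large_prob_Ball_finite prob F(1) lln_rho) simp
  then show ?thesis
  proof (rule with_large_prob_mono)
    show "\<forall>\<^sub>F n in sequentially. \<forall>\<omega>\<in>space (M n).
        (\<forall>u\<in>F. \<bar>avg (\<zeta> n) (\<lambda>i. \<rho> (b * (\<epsilon> n i \<omega> - u))) - g u\<bar> \<le> d / 2) \<longrightarrow>
        (\<forall>t. \<bar>t\<bar> \<le> B \<longrightarrow> \<bar>avg (\<zeta> n) (\<lambda>i. \<rho> (b * (\<epsilon> n i \<omega> - t))) - g t\<bar> \<le> d)"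
      using eventually_card_pos
    proof eventually_elim
      case (elim n)
      show ?case
      proof (intro ballI impI allI)
        fix \<omega> t assume H: "\<forall>u\<in>F. \<bar>avg (\<zeta> n) (\<lambda>i. \<rho> (b * (\<epsilon> n i \<omega> - u))) - g u\<bar> \<le> d / 2"
          and t: "\<bar>t\<bar> \<le> B"
        have "t \<in> {-B..B}" using t by auto
        then obtain u where u: "u \<in> F" "\<bar>t - u\<bar> < r"
          using F(2) by (auto simp: dist_real_def abs_minus_commute)
        have "C * b * \<bar>t - u\<bar> \<le> C * b * r"
          using u(2) Cb by (intro mult_left_mono) auto
        then show "\<bar>avg (\<zeta> n) (\<lambda>i. \<rho> (b * (\<epsilon> n i \<omega> - t))) - g t\<bar> \<le> d"
          using rho_shift_perturb[OF elim b_pos, of "\<lambda>i. \<epsilon> n i \<omega>" t u] g_lipschitz[of t u]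
            H[rule_format, OF u(1)] Cbr unfolding abs_le_iff by linarith
      qed
    qed
  qed
qed

text \<open>By compactness the unique minimum leaves a gap of \<open>2 * c\<close>, of which the
  uniform law of large numbers uses up \<open>c\<close>.\<close>

lemma well_separated:
  assumes "x > 0"
  obtains c where "c > 0" "with_large_prob M (\<lambda>n \<omega>. \<forall>t. x \<le> \<bar>t\<bar> \<and> \<bar>t\<bar> \<le> B \<longrightarrow>
    avg (\<zeta> n) (\<lambda>i. \<rho> (b * (\<epsilon> n i \<omega> - t))) \<ge> g 0 + c)"
proof -
  let ?S = "{-B..-x} \<union> {x..B}"
  have "continuous_on UNIV g"
    using g_lipschitz C_nonneg b_pos
    by (intro lipschitz_on_continuous_on[of "C * b"] lipschitz_onI) (auto simp: dist_real_def)
  then have cont: "continuous_on ?S g" by (rule continuous_on_subset) simp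
  have "\<exists>c>0. \<forall>t\<in>?S. g t \<ge> g 0 + 2 * c"
  proof (cases "?S = {}")
    case False
    have "compact ?S" by (intro compact_Un compact_Icc)
    then obtain s where s: "s \<in> ?S" "\<And>t. t \<in> ?S \<Longrightarrow> g s \<le> g t"
      using continuous_attains_inf[OF _ False cont] by blast
    have "g 0 < g s" using s(1) assms by (intro g_unique_minimum) auto
    then show ?thesis
      using s(2) by (intro exI[of _ "(g s - g 0) / 2"] conjI ballI) (simp_all add: field_simps)
  qed (auto intro!: exI[of _ 1])
  then obtain c where c: "c > 0" "\<And>t. t \<in> ?S \<Longrightarrow> g t \<ge> g 0 + 2 * c" by blast
  have "with_large_prob M (\<lambda>n \<omega>. \<forall>t. x \<le> \<bar>t\<bar> \<and> \<bar>t\<bar> \<le> B \<longrightarrow>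
      avg (\<zeta> n) (\<lambda>i. \<rho> (b * (\<epsilon> n i \<omega> - t))) \<ge> g 0 + c)"
  proof (rule with_large_prob_mono[OF uniform_law_of_large_numbers[OF c(1), of B]],
      rule always_eventually, safe)
    fix n \<omega> t
    assume H: "\<forall>t. \<bar>t\<bar> \<le> B \<longrightarrow> \<bar>avg (\<zeta> n) (\<lambda>i. \<rho> (b * (\<epsilon> n i \<omega> - t))) - g t\<bar> \<le> c"
      and t: "x \<le> \<bar>t\<bar>" "\<bar>t\<bar> \<le> B"
    have "t \<in> ?S" using t by auto
    then show "g 0 + c \<le> avg (\<zeta> n) (\<lambda>i. \<rho> (b * (\<epsilon> n i \<omega> - t)))"
      using c(2) H[rule_format, OF t(2)] unfolding abs_le_iff by fastforce
  qed
  then show ?thesis using that c(1) by blast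
qed

lemma minimizers_close_to_good:
  fixes I :: "nat \<Rightarrow> 'i set" and a :: "nat \<Rightarrow> 'a \<Rightarrow> real"
  assumes I: "\<And>n. finite (I n)" "\<And>n. \<zeta> n \<subseteq> I n" "\<And>n. card (I n) = n"
    and ratio: "(\<lambda>n. real (card (\<zeta> n)) / real n) \<longlonglongrightarrow> \<Lambda>"
    and square: "\<And>e. e > 0 \<Longrightarrow> \<exists>K>0. likely M e (\<lambda>n \<omega>. avg (\<zeta> n) (\<lambda>i. (\<epsilon> n i \<omega>)\<^sup>2) \<le> K)"
    and scale: "\<And>e. e > 0 \<Longrightarrow> \<exists>K>0. likely M e (\<lambda>n \<omega>. sqrt (real n) * \<bar>a n \<omega> - b\<bar> \<le> K)"
    and outliers: "\<And>E. with_large_prob M (\<lambda>n \<omega>. \<forall>j\<in>I n - \<zeta> n. \<bar>\<epsilon> n j \<omega>\<bar> \<ge> E)"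
    and breakdown: "\<Lambda> * (2 * rho_star - g 0) > rho_star"
    and \<eta>: "\<eta> > 0"
  shows "with_large_prob M (\<lambda>n \<omega>. \<forall>t.
    (\<forall>u. (\<Sum>i\<in>I n. \<rho> (a n \<omega> * (\<epsilon> n i \<omega> - t))) \<le> (\<Sum>i\<in>I n. \<rho> (a n \<omega> * (\<epsilon> n i \<omega> - u)))) \<longrightarrow>
    \<bar>t - t_good n \<omega>\<bar> \<le> \<eta> / sqrt (real n))"
  unfolding with_large_prob_iff_likely
proof (intro allI impI)
  fix e :: real assume "e > 0"
  then have e: "e / 3 > 0" by simp
  \<comment> \<open>\<open>K\<close> and \<open>K'\<close> depend on \<open>e\<close>, so all
    further constants are chosen after them, at this fixed level.\<close>
  obtain K where K: "K > 0" "likely M (e / 3) (\<lambda>n \<omega>. avg (\<zeta> n) (\<lambda>i. (\<epsilon> n i \<omega>)\<^sup>2) \<le> K)"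
    using square[OF e] by blast
  obtain K' where K': "K' > 0" "likely M (e / 3) (\<lambda>n \<omega>. sqrt (real n) * \<bar>a n \<omega> - b\<bar> \<le> K')"
    using scale[OF e] by blast
  define \<gamma> where "\<gamma> = \<Lambda> * (2 * rho_star - g 0) - rho_star"
  have \<gamma>: "\<gamma> > 0" using breakdown by (simp add: \<gamma>_def)
  \<comment> \<open>Half of the population curvature, the other half being the allowed deviation of
    its empirical version.\<close>
  define m where "m = (\<integral>x. \<rho>'' (b * x) \<partial>D) / 2"
  have m: "m > 0" using curvature by (simp add: m_def)
  \<comment> \<open>Solves \<open>K / A\<^sup>2 * rho_star = \<gamma> / 8\<close>: good errors
    beyond \<open>A\<close> lower the cost per good observation by at most
    \<open>\<gamma> / 8\<close>.\<close>
  define A where "A = sqrt (8 * K * rho_star / \<gamma>)"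
  have "8 * K * rho_star / \<gamma> > 0" using K(1) rho_star_pos \<gamma> by simp
  then have A: "A > 0" "A\<^sup>2 = 8 * K * rho_star / \<gamma>" unfolding A_def by auto
  \<comment> \<open>Since \<open>a \<ge> b / 2\<close> will hold, \<open>2 * x_star / b\<close>
    dominates \<open>x_star / a\<close>; \<open>E\<close> below uses the same margin.\<close>
  define B where "B = A + 2 * x_star / b"
  have B: "B \<ge> 0" using A(1) x_star_pos b_pos by (simp add: B_def)
  define P where "P = L * (2 * b + (1 + K))"
  define W where "W = 1 + Q + L * (2 * b * (1 + K) + K)"
  have PW: "P \<ge> 0" "W \<ge> 0"
    using L_nonneg Q_nonneg b_pos K(1) by (simp_all add: P_def W_def)
  have "4 / (b * m) * K' * W \<ge> 0" using PW b_pos m K'(1) by simp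
  \<comment> \<open>\<open>P * x\<close> and \<open>W * x\<close> collect the error terms of
    \<open>score_zeros_close\<close>: the first preserves half of the curvature, the second yields
    the radius \<eta>.\<close>
  then obtain x where x: "x > 0" "x \<le> b / 2" "P * x \<le> m / 2" "4 / (b * m) * K' * W * x \<le> \<eta>"
    using small_multiples[of P "4 / (b * m) * K' * W" "b / 2" "m / 2" \<eta>] PW b_pos m \<eta> by auto
  obtain c where c: "c > 0" and sep: "with_large_prob M (\<lambda>n \<omega>. \<forall>t. x \<le> \<bar>t\<bar> \<and> \<bar>t\<bar> \<le> B \<longrightarrow>
      avg (\<zeta> n) (\<lambda>i. \<rho> (b * (\<epsilon> n i \<omega> - t))) \<ge> g 0 + c)"
    using well_separated[OF x(1)] by blast
  have CK: "C * (1 + K + B) \<ge> 0" using C_nonneg K(1) B by simp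
  \<comment> \<open>The tolerance for the inverse scale. It bounds the effect of the wrong scale,
    uniformly over locations up to \<open>B\<close>, by \<open>c / 4\<close> and by
    \<open>\<gamma> / 16\<close>.\<close>
  obtain y where y: "y > 0" "y \<le> x" "C * (1 + K + B) * y \<le> c / 4" "C * (1 + K + B) * y \<le> \<gamma> / 16"
    using small_multiples[OF CK CK x(1), of "c / 4" "\<gamma> / 16"] c \<gamma> by auto
  define z where "z = min (c / 4) (\<gamma> / 16)"
  have z: "z > 0" using c \<gamma> by (simp add: z_def)
  define E where "E = B + 2 * x_star / b + 1"
  let ?G = "\<lambda>n \<omega>. (\<forall>t. x \<le> \<bar>t\<bar> \<and> \<bar>t\<bar> \<le> B \<longrightarrow> avg (\<zeta> n) (\<lambda>i. \<rho> (b * (\<epsilon> n i \<omega> - t))) \<ge> g 0 + c) \<and>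
      \<bar>avg (\<zeta> n) (\<lambda>i. \<rho> (b * (\<epsilon> n i \<omega> - 0))) - g 0\<bar> \<le> z \<and>
      \<bar>avg (\<zeta> n) (\<lambda>i. \<rho>'' (b * \<epsilon> n i \<omega>)) - (\<integral>x. \<rho>'' (b * x) \<partial>D)\<bar> \<le> m \<and>
      \<bar>avg (\<zeta> n) (\<lambda>i. \<epsilon> n i \<omega> * \<rho>'' (b * \<epsilon> n i \<omega>)) - (\<integral>x. x * \<rho>'' (b * x) \<partial>D)\<bar> \<le> x \<and>
      \<bar>t_good n \<omega>\<bar> \<le> x \<and> (\<forall>j\<in>I n - \<zeta> n. \<bar>\<epsilon> n j \<omega>\<bar> \<ge> E)"
  have "with_large_prob M ?G"
  proof (intro with_large_prob_conj prob sep outliers good_consistent lln_rho z x(1))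
    show "with_large_prob M (\<lambda>n \<omega>. \<bar>avg (\<zeta> n) (\<lambda>i. \<rho>'' (b * \<epsilon> n i \<omega>)) - (\<integral>x. \<rho>'' (b * x) \<partial>D)\<bar> \<le> m)"
      by (rule law_of_large_numbers[OF _ rho''_bound m]) measurable
    show "with_large_prob M (\<lambda>n \<omega>. \<bar>avg (\<zeta> n) (\<lambda>i. \<epsilon> n i \<omega> * \<rho>'' (b * \<epsilon> n i \<omega>)) - (\<integral>x. x * \<rho>'' (b * x) \<partial>D)\<bar> \<le> x)"
      by (rule law_of_large_numbers[OF _ times_rho''_bound[OF b_pos] x(1)]) measurable
  qed
  then have G: "likely M (e / 3) ?G" using e unfolding with_large_prob_iff_likely by blast
  have ev_gap: "\<forall>\<^sub>F n in sequentially. real (card (\<zeta> n)) / real n * (2 * rho_star - g 0) - rho_star > \<gamma> / 2"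
  proof -
    have "(\<lambda>n. real (card (\<zeta> n)) / real n * (2 * rho_star - g 0) - rho_star) \<longlonglongrightarrow> \<gamma>"
      unfolding \<gamma>_def by (intro tendsto_intros ratio)
    then show ?thesis by (rule order_tendstoD) (use \<gamma> in simp)
  qed
  have ev_root: "\<forall>\<^sub>F n in sequentially. K' / y < sqrt (real n)"
    using filterlim_compose[OF sqrt_at_top filterlim_real_sequentially]
    unfolding filterlim_at_top_dense by blast
  have "likely M (e / 3 + (e / 3 + e / 3)) (\<lambda>n \<omega>. ?G n \<omega> \<and>
      avg (\<zeta> n) (\<lambda>i. (\<epsilon> n i \<omega>)\<^sup>2) \<le> K \<and> sqrt (real n) * \<bar>a n \<omega> - b\<bar> \<le> K')"
    by (intro likely_conj prob G K(2) K'(2))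
  then have "likely M e (\<lambda>n \<omega>. ?G n \<omega> \<and>
      avg (\<zeta> n) (\<lambda>i. (\<epsilon> n i \<omega>)\<^sup>2) \<le> K \<and> sqrt (real n) * \<bar>a n \<omega> - b\<bar> \<le> K')"
    by simp
  then show "likely M e (\<lambda>n \<omega>. \<forall>t.
    (\<forall>u. (\<Sum>i\<in>I n. \<rho> (a n \<omega> * (\<epsilon> n i \<omega> - t))) \<le> (\<Sum>i\<in>I n. \<rho> (a n \<omega> * (\<epsilon> n i \<omega> - u)))) \<longrightarrow>
    \<bar>t - t_good n \<omega>\<bar> \<le> \<eta> / sqrt (real n))"
  proof (rule likely_mono)
    show "\<forall>\<^sub>F n in sequentially. \<forall>\<omega>\<in>space (M n). ?G n \<omega> \<and>
      avg (\<zeta> n) (\<lambda>i. (\<epsilon> n i \<omega>)\<^sup>2) \<le> K \<and> sqrt (real n) * \<bar>a n \<omega> - b\<bar> \<le> K' \<longrightarrow>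
      (\<forall>t. (\<forall>u. (\<Sum>i\<in>I n. \<rho> (a n \<omega> * (\<epsilon> n i \<omega> - t))) \<le> (\<Sum>i\<in>I n. \<rho> (a n \<omega> * (\<epsilon> n i \<omega> - u)))) \<longrightarrow>
        \<bar>t - t_good n \<omega>\<bar> \<le> \<eta> / sqrt (real n))"
      using eventually_card_pos ev_gap ev_root
    proof eventually_elim
      case (elim n)
      show ?case
      proof (intro ballI impI allI)
        fix \<omega> t
        assume \<omega>: "\<omega> \<in> space (M n)"
          and H: "?G n \<omega> \<and> avg (\<zeta> n) (\<lambda>i. (\<epsilon> n i \<omega>)\<^sup>2) \<le> K \<and> sqrt (real n) * \<bar>a n \<omega> - b\<bar> \<le> K'"
          and min: "\<forall>u. (\<Sum>i\<in>I n. \<rho> (a n \<omega> * (\<epsilon> n i \<omega> - t))) \<le> (\<Sum>i\<in>I n. \<rho> (a n \<omega> * (\<epsilon> n i \<omega> - u)))"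
        let ?Z = "\<zeta> n" and ?e = "\<lambda>i. \<epsilon> n i \<omega>" and ?a = "a n \<omega>" and ?u = "t_good n \<omega>"
        note Z = elim(1)
        have HK: "avg ?Z (\<lambda>i. (?e i)\<^sup>2) \<le> K" and HK': "sqrt (real n) * \<bar>?a - b\<bar> \<le> K'"
          and Hsep: "\<And>t. x \<le> \<bar>t\<bar> \<Longrightarrow> \<bar>t\<bar> \<le> B \<Longrightarrow> avg ?Z (\<lambda>i. \<rho> (b * (?e i - t))) \<ge> g 0 + c"
          and Hu: "\<bar>?u\<bar> \<le> x" and Hout: "\<And>j. j \<in> I n - ?Z \<Longrightarrow> \<bar>?e j\<bar> \<ge> E"
          and Hx: "\<bar>avg ?Z (\<lambda>i. ?e i * \<rho>'' (b * ?e i))\<bar> \<le> x"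
          using H cross_curvature by auto
        have H0: "avg ?Z (\<lambda>i. \<rho> (b * (?e i - 0))) \<le> g 0 + z"
          and Hm: "avg ?Z (\<lambda>i. \<rho>'' (b * ?e i)) \<ge> m"
          using H unfolding m_def abs_le_iff by auto
        have root: "sqrt (real n) > 0" using elim(3) K'(1) y(1) by (meson divide_pos_pos less_trans)
        then have n: "real n > 0" by simp
        have ay: "\<bar>?a - b\<bar> \<le> y"
        proof -
          have "K' \<le> sqrt (real n) * y" using elim(3) y(1) by (simp add: field_simps)
          then have "sqrt (real n) * \<bar>?a - b\<bar> \<le> sqrt (real n) * y" using HK' by linarith
          then show ?thesis using root by simp
        qed
        then have ax: "\<bar>?a - b\<bar> \<le> x" using y(2) by linarith
        then have ab: "?a \<ge> b / 2" using x(2) unfolding abs_le_iff by linarith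
        then have a: "?a > 0" using b_pos by linarith
        have ratio_ab: "x_star / ?a \<le> 2 * x_star / b"
          using ab a b_pos x_star_pos by (simp add: field_simps)
        have perturb: "\<bar>avg ?Z (\<lambda>i. \<rho> (?a * (?e i - s))) - avg ?Z (\<lambda>i. \<rho> (b * (?e i - s)))\<bar> \<le> C * (1 + K + B) * y"
          if "\<bar>s\<bar> \<le> B" for s
        proof -
          have "C * \<bar>?a - b\<bar> * (1 + avg ?Z (\<lambda>i. (?e i)\<^sup>2) + \<bar>s\<bar>) \<le> C * y * (1 + K + B)"
          proof (intro mult_mono)
            have "avg ?Z (\<lambda>i. (?e i)\<^sup>2) \<ge> 0" unfolding avg_def by (simp add: sum_nonneg)
            then show "0 \<le> 1 + avg ?Z (\<lambda>i. (?e i)\<^sup>2) + \<bar>s\<bar>" by simp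
          qed (use C_nonneg ay HK that y(1) in auto)
          then show ?thesis
            using rho_scale_perturb[OF Z, of ?a ?e s b] by (simp add: algebra_simps)
        qed
        have z_le: "z \<le> c / 4" "z \<le> \<gamma> / 16" by (simp_all add: z_def)
        define F where "F = rho_star - \<gamma> / 8"
        have far: "avg ?Z (\<lambda>i. \<rho> (?a * (?e i - s))) \<ge> F" if "\<bar>s\<bar> > B" for s
        proof -
          have "avg ?Z (\<lambda>i. (?e i)\<^sup>2) / A\<^sup>2 \<le> K / A\<^sup>2" using HK by (intro divide_right_mono) auto
          then have "(1 - K / A\<^sup>2) * rho_star \<le> (1 - avg ?Z (\<lambda>i. (?e i)\<^sup>2) / A\<^sup>2) * rho_star"
            using rho_star_pos by (intro mult_right_mono) auto
          moreover have "(1 - K / A\<^sup>2) * rho_star = F"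
            unfolding F_def A(2) using K(1) rho_star_pos \<gamma> by (simp add: field_simps)
          moreover have "(1 - avg ?Z (\<lambda>i. (?e i)\<^sup>2) / A\<^sup>2) * rho_star \<le> avg ?Z (\<lambda>i. \<rho> (?a * (?e i - s)))"
            using that ratio_ab by (intro avg_rho_far Z a A(1)) (simp add: B_def)
          ultimately show ?thesis by linarith
        qed
        have origin: "avg ?Z (\<lambda>i. \<rho> (?a * (?e i - 0))) \<le> g 0 + \<gamma> / 8"
          "avg ?Z (\<lambda>i. \<rho> (?a * (?e i - 0))) \<le> g 0 + c / 2"
          using perturb[of 0] B y(3,4) H0 z_le unfolding abs_le_iff by simp_all
        \<comment> \<open>The slack is more than \<open>\<gamma> / 2\<close> per observation. The
          origin uses \<open>\<gamma> / 8\<close> and the far bound \<open>F\<close> another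
          \<open>\<gamma> / 8\<close> per good observation.\<close>
        have budget: "real (card ?Z) * avg ?Z (\<lambda>i. \<rho> (?a * ?e i)) + real (card (I n - ?Z)) * rho_star < real (card ?Z) * F"
        proof -
          let ?h = "real (card ?Z)"
          have h: "card ?Z \<le> n" using card_mono[OF I(1,2), of n] I(3) by simp
          have "\<gamma> / 2 < ?h / real n * (2 * rho_star - g 0) - rho_star" by (rule elim(2))
          then have "\<gamma> / 2 * real n < (?h / real n * (2 * rho_star - g 0) - rho_star) * real n"
            using n by (rule mult_strict_right_mono)
          also have "\<dots> = ?h * (2 * rho_star - g 0) - rho_star * real n"
            using n by (simp add: field_simps)
          finally have 1: "\<gamma> / 2 * real n < ?h * (2 * rho_star - g 0) - rho_star * real n" .
          have "\<gamma> / 2 * ?h \<le> \<gamma> / 2 * real n" using h \<gamma> by (intro mult_left_mono) auto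
          moreover have "?h * avg ?Z (\<lambda>i. \<rho> (?a * ?e i)) \<le> ?h * (g 0 + \<gamma> / 8)"
            using origin(1) by (intro mult_left_mono) auto
          moreover have "real (card (I n - ?Z)) * rho_star = (real n - ?h) * rho_star"
            using card_Diff_subset[OF finite_subset[OF I(2) I(1)] I(2), of n] I(3) h by simp
          moreover have "\<gamma> * ?h \<ge> 0" using \<gamma> by simp
          ultimately show ?thesis using 1 unfolding F_def by (simp add: algebra_simps)
        qed
        have out: "?a * (\<bar>?e j\<bar> - B) > x_star" if "j \<in> I n - ?Z" for j
        proof -
          have "2 * x_star / b < \<bar>?e j\<bar> - B" using Hout[OF that] by (simp add: E_def)
          then have "x_star / ?a < \<bar>?e j\<bar> - B" using ratio_ab by linarith
          then show ?thesis using a by (simp add: field_simps)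
        qed
        note loc = minimizer_with_outliers[OF I(1,2) Z a B min[rule_format] out far budget]
        have tB: "\<bar>t\<bar> \<le> B" using loc(1) by blast
        \<comment> \<open>Beyond \<open>x\<close> the value at scale \<open>a\<close> is at least
          \<open>g 0 + 3 * c / 4\<close>, but the minimizer must not exceed the value at the origin,
          which is at most \<open>g 0 + c / 2\<close>.\<close>
        have "\<bar>t\<bar> \<le> x"
        proof (rule ccontr)
          assume "\<not> \<bar>t\<bar> \<le> x"
          then have "g 0 + c \<le> avg ?Z (\<lambda>i. \<rho> (b * (?e i - t)))" using tB by (intro Hsep) auto
          moreover have "avg ?Z (\<lambda>i. \<rho> (?a * (?e i - t))) \<le> avg ?Z (\<lambda>i. \<rho> (?a * (?e i - 0)))"
            using loc(2)[of 0] B by simp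
          ultimately show False using perturb[OF tB] y(3) origin(2) c unfolding abs_le_iff by linarith
        qed
        moreover have "avg ?Z (\<lambda>i. \<rho>' (?a * (?e i - t))) = 0" using loc(3) by blast
        moreover have "avg ?Z (\<lambda>i. \<rho>' (b * (?e i - ?u))) = 0"
          unfolding avg_def using sum_rho'_eq_0_if_minimizer[OF good_min[OF \<omega>] b_pos] by simp
        moreover have "L * (2 * b * x + x * (1 + K)) \<le> m / 2"
          using x(3) by (simp add: P_def algebra_simps)
        ultimately have "\<bar>t - ?u\<bar> \<le> \<bar>?a - b\<bar> * (4 / (b * m)) * (x + Q * x + L * (2 * b * x * (1 + K) + x * K))"
          using K(1) by (intro score_zeros_close[OF Z b_pos x(2) ax _ Hu _ _ m Hm Hx HK]) auto
        also have "\<dots> = \<bar>?a - b\<bar> * (4 / (b * m) * (W * x))"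
          by (simp add: W_def algebra_simps)
        also have "\<dots> \<le> K' / sqrt (real n) * (4 / (b * m) * (W * x))"
          using HK' root PW x(1) b_pos m by (intro mult_right_mono) (auto simp: field_simps)
        also have "\<dots> = (4 / (b * m) * K' * W * x) / sqrt (real n)"
          by (simp add: mult_ac)
        also have "\<dots> \<le> \<eta> / sqrt (real n)"
          using x(4) by (intro divide_right_mono) auto
        finally show "\<bar>t - ?u\<bar> \<le> \<eta> / sqrt (real n)" .
      qed
    qed
  qed
qed

end

section \<open>The scale estimator and the outliers\<close>

text \<open>Holds for a vanishing scale too: division by zero makes every argument of \<rho> zero on
  both sides.\<close>

lemma objective_obs:
  assumes "\<sigma>0 > 0"
  shows "objective \<rho> I (obs \<mu>0 \<sigma>0 \<epsilon> n \<omega>) s \<mu> =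
    (\<Sum>i\<in>I. \<rho> (\<sigma>0 / s * (\<epsilon> n i \<omega> - (\<mu> - \<mu>0) / \<sigma>0)))"
  unfolding objective_def obs_def
  using assms by (intro sum.cong refl arg_cong[where f = \<rho>]) (cases "s = 0", simp_all add: field_simps)

lemma minimizer_objective_obs:
  assumes "\<sigma>0 > 0" "minimizer (objective \<rho> I (obs \<mu>0 \<sigma>0 \<epsilon> n \<omega>) s) \<mu>"
  shows "(\<Sum>i\<in>I. \<rho> (\<sigma>0 / s * (\<epsilon> n i \<omega> - (\<mu> - \<mu>0) / \<sigma>0))) \<le> (\<Sum>i\<in>I. \<rho> (\<sigma>0 / s * (\<epsilon> n i \<omega> - u)))"
  using assms(2)[unfolded minimizer_iff, rule_format, of "\<mu>0 + \<sigma>0 * u"] assms(1)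
  unfolding objective_obs[OF assms(1)] by simp

lemma inverse_scale_close:
  fixes r v :: real
  assumes "v > 0" "\<bar>r - v\<bar> \<le> v / 2"
  shows "\<bar>1 / r - 1 / v\<bar> \<le> 2 / v\<^sup>2 * \<bar>r - v\<bar>"
proof -
  have r: "r \<ge> v / 2" using assms(2) unfolding abs_le_iff by linarith
  then have r0: "r > 0" using assms(1) by linarith
  have "1 / r - 1 / v = (v - r) / (r * v)" using r0 assms(1) by (simp add: field_simps)
  then have "\<bar>1 / r - 1 / v\<bar> = \<bar>r - v\<bar> / (r * v)"
    using r0 assms(1) by (simp add: abs_mult abs_minus_commute)
  also have "\<dots> \<le> \<bar>r - v\<bar> / (v / 2 * v)"
    using r assms(1) by (intro divide_left_mono mult_right_mono mult_pos_pos) auto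
  also have "\<dots> = 2 / v\<^sup>2 * \<bar>r - v\<bar>" by (simp add: power2_eq_square)
  finally show ?thesis .
qed

lemma ennreal_inverse_antimono:
  fixes x y :: ennreal
  assumes "x \<le> y"
  shows "inverse y \<le> inverse x"
  using assms by (simp add: less_eq_ennreal.rep_eq inverse_ennreal.rep_eq ereal_inverse_antimono)

text \<open>An outlier error smaller than \<open>F\<close> would push the reciprocal above the fixed
  level \<open>1 / F\<^sup>2\<close>; if the error is 0, the reciprocal is infinite.\<close>

lemma outlier_errors_large:
  assumes prob: "\<And>n. prob_space (M n)"
    and errors: "\<And>n i. i \<in> {1..n} \<Longrightarrow> \<epsilon> n i \<in> borel_measurable (M n)"
    and null: "null_in_prob M (inv_min_sq_outlier \<zeta> \<epsilon>)"
  shows "with_large_prob M (\<lambda>n \<omega>. \<forall>j\<in>{1..n} - \<zeta> n. \<bar>\<epsilon> n j \<omega>\<bar> \<ge> E)"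
proof -
  define F where "F = \<bar>E\<bar> + 1"
  have F: "F > 0" "F \<ge> E" by (auto simp: F_def)
  note [measurable] = errors
  have [measurable]: "inv_min_sq_outlier \<zeta> \<epsilon> n \<in> borel_measurable (M n)" for n
    unfolding inv_min_sq_outlier_def by measurable
  have "with_large_prob M (\<lambda>n \<omega>. \<not> inv_min_sq_outlier \<zeta> \<epsilon> n \<omega> > ennreal (1 / F\<^sup>2))"
    using null F(1) unfolding null_in_prob_def
    by (intro with_large_prob_if_tendsto_0 prob) auto
  then show ?thesis
  proof (rule with_large_prob_mono, intro always_eventually allI ballI impI)
    fix n \<omega> j
    assume le: "\<not> inv_min_sq_outlier \<zeta> \<epsilon> n \<omega> > ennreal (1 / F\<^sup>2)" and j: "j \<in> {1..n} - \<zeta> n"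
    let ?m = "INF j\<in>{1..n} - \<zeta> n. ennreal ((\<epsilon> n j \<omega>)\<^sup>2)"
    have m: "?m \<le> ennreal ((\<epsilon> n j \<omega>)\<^sup>2)" by (rule INF_lower) (fact j)
    show "\<bar>\<epsilon> n j \<omega>\<bar> \<ge> E"
    proof (rule ccontr)
      assume "\<not> \<bar>\<epsilon> n j \<omega>\<bar> \<ge> E"
      then have "\<bar>\<epsilon> n j \<omega>\<bar> < F" using F(2) by simp
      then have lt: "(\<epsilon> n j \<omega>)\<^sup>2 < F\<^sup>2" 
        using power_strict_mono[of "\<bar>\<epsilon> n j \<omega>\<bar>" F 2] by simp
      have "inv_min_sq_outlier \<zeta> \<epsilon> n \<omega> > ennreal (1 / F\<^sup>2)"
      proof (cases "\<epsilon> n j \<omega> = 0")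
        case True
        then show ?thesis using inv_min_sq_outlier_zero_error[of j n \<zeta> \<epsilon> \<omega>] j by simp
      next
        case False
        then have "ennreal (1 / F\<^sup>2) < ennreal (1 / (\<epsilon> n j \<omega>)\<^sup>2)"
          using lt F(1) by (intro ennreal_lessI divide_strict_left_mono) auto
        also have "\<dots> = 1 / ennreal ((\<epsilon> n j \<omega>)\<^sup>2)"
          using False divide_ennreal[of 1 "(\<epsilon> n j \<omega>)\<^sup>2"] by simp
        also have "\<dots> \<le> 1 / ?m"
          unfolding divide_ennreal_def using m by (intro mult_left_mono ennreal_inverse_antimono) auto
        finally show ?thesis unfolding inv_min_sq_outlier_def .
      qed
      then show False using le by simp
    qed
  qed
qed

theorem theorem3p3:
  fixes M :: "nat \<Rightarrow> 'a measure"
    and \<epsilon> :: "nat \<Rightarrow> nat \<Rightarrow> 'a \<Rightarrow> real"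
    and \<zeta> :: "nat \<Rightarrow> nat set"
    and \<mu>0 \<sigma>0 \<Lambda> varsig V x_star rho_star :: real
    and \<rho> \<rho>' \<rho>'' rho_tilde :: "real \<Rightarrow> real"
    and N :: "real set"
    and T :: "nat \<Rightarrow> (nat \<Rightarrow> real) \<Rightarrow> real"
    and sigma_hat mu_hat_good :: "nat \<Rightarrow> 'a \<Rightarrow> real"
    and D :: "real measure"
  assumes rho: "rho_condition \<rho> x_star rho_star 0"
    and prob: "\<And>n. prob_space (M n)"
    and errors: "\<And>n i. i \<in> {1..n} \<Longrightarrow> \<epsilon> n i \<in> borel_measurable (M n)"
    and sigma0: "\<sigma>0 > 0"
    and good: "\<And>n. \<zeta> n \<subseteq> {1..n}"
    and h_infinity: "filterlim (\<lambda>n. card (\<zeta> n)) at_top sequentially"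
    and h_ratio: "(\<lambda>n. real (card (\<zeta> n)) / real n) \<longlonglongrightarrow> \<Lambda>"
    and Lambda: "1 / 2 < \<Lambda>" "\<Lambda> \<le> 1"
    and estimator: "\<And>n. T n \<in> borel_measurable (PiM {1..n} (\<lambda>_. borel))"
    and sigma_hat: "\<And>n \<omega>. \<omega> \<in> space (M n) \<Longrightarrow>
      sigma_hat n \<omega> = T n (restrict (obs \<mu>0 \<sigma>0 \<epsilon> n \<omega>) {1..n})"
    and c1: "varsig > 0" "conv_in_prob M sigma_hat (varsig * \<sigma>0)"
    and c2: "bounded_in_prob M (\<lambda>n \<omega>. (\<Sum>i\<in>\<zeta> n. (\<epsilon> n i \<omega>)\<^sup>2) / real (card (\<zeta> n)))"
    and c3: "open N" "varsig \<in> N" "N \<subseteq> {0<..}" "continuous_on N rho_tilde"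
      "unif_conv_in_prob M N
         (\<lambda>n \<omega> \<alpha>. (\<Sum>i\<in>\<zeta> n. \<rho> (\<epsilon> n i \<omega> / \<alpha>)) / real (card (\<zeta> n))) rho_tilde"
    and c4: "null_in_prob M (inv_min_sq_outlier \<zeta> \<epsilon>)"
    and c5: "\<exists>C>0. C-lipschitz_on UNIV \<rho>"
    and c6: "\<And>\<delta>. \<delta> > 0 \<Longrightarrow> with_large_prob M (\<lambda>n \<omega>.
      \<forall>m. minimizer (objective \<rho> (\<zeta> n) (obs \<mu>0 \<sigma>0 \<epsilon> n \<omega>) (\<sigma>0 * varsig)) m \<longrightarrow>
        m \<in> {\<mu>0 - \<delta><..<\<mu>0 + \<delta>})"
    and c7: "bounded_in_prob M (\<lambda>n \<omega>. sqrt (real n) * (sigma_hat n \<omega> / \<sigma>0 - varsig))"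
    and c8: "\<And>x. (\<rho> has_real_derivative \<rho>' x) (at x)"
      "\<And>x. (\<rho>' has_real_derivative \<rho>'' x) (at x)"
      "\<exists>L. L-lipschitz_on UNIV \<rho>''"
    and c9_iid: "\<And>n. prob_space.indep_vars (M n) (\<lambda>_. borel) (\<epsilon> n) (\<zeta> n)"
      "\<And>n i. i \<in> \<zeta> n \<Longrightarrow> distr (M n) borel (\<epsilon> n i) = D"
    and c9_moments:
      "\<And>n i. i \<in> \<zeta> n \<Longrightarrow> integrable (M n) (\<lambda>\<omega>. \<rho>'' (\<epsilon> n i \<omega> / varsig))"
      "\<And>n i. i \<in> \<zeta> n \<Longrightarrow> prob_space.expectation (M n) (\<lambda>\<omega>. \<rho>'' (\<epsilon> n i \<omega> / varsig)) > 0"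
      "\<And>n i. i \<in> \<zeta> n \<Longrightarrow> integrable (M n) (\<lambda>\<omega>. \<epsilon> n i \<omega> * \<rho>'' (\<epsilon> n i \<omega> / varsig))"
      "\<And>n i. i \<in> \<zeta> n \<Longrightarrow>
        prob_space.expectation (M n) (\<lambda>\<omega>. \<epsilon> n i \<omega> * \<rho>'' (\<epsilon> n i \<omega> / varsig)) = 0"
      "\<And>n i. i \<in> \<zeta> n \<Longrightarrow> integrable (M n) (\<lambda>\<omega>. (\<epsilon> n i \<omega> * \<rho>'' (\<epsilon> n i \<omega> / varsig))\<^sup>2)"
    and c10_minimizer:
      "\<And>n. mu_hat_good n \<in> borel_measurable (M n)"
      "\<And>n \<omega>. \<omega> \<in> space (M n) \<Longrightarrow>
        minimizer (objective \<rho> (\<zeta> n) (obs \<mu>0 \<sigma>0 \<epsilon> n \<omega>) (\<sigma>0 * varsig)) (mu_hat_good n \<omega>)"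
    and c10_normal: "V > 0"
      "asymp_normal M (\<lambda>n \<omega>. sqrt (real (card (\<zeta> n))) * (mu_hat_good n \<omega> - \<mu>0)) 0 (\<sigma>0\<^sup>2 * V)"
    and c10_others: "\<And>\<eta>. \<eta> > 0 \<Longrightarrow> with_large_prob M (\<lambda>n \<omega>.
      \<forall>m. minimizer (objective \<rho> (\<zeta> n) (obs \<mu>0 \<sigma>0 \<epsilon> n \<omega>) (\<sigma>0 * varsig)) m \<longrightarrow>
        \<bar>m - mu_hat_good n \<omega>\<bar> \<le> \<eta> / sqrt (real n))"
    and c11: "\<Lambda> > 1 / (2 - rho_tilde varsig / rho_star)"
  shows "(\<forall>\<eta>>0. with_large_prob M (\<lambda>n \<omega>.
      \<forall>m. minimizer (objective \<rho> {1..n} (obs \<mu>0 \<sigma>0 \<epsilon> n \<omega>) (sigma_hat n \<omega>)) m \<longrightarrow>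
        \<bar>m - mu_hat_good n \<omega>\<bar> \<le> \<eta> / sqrt (real n))) \<and>
    (\<exists>mu_hat :: nat \<Rightarrow> 'a \<Rightarrow> real.
      (\<forall>n. mu_hat n \<in> borel_measurable (M n)) \<and>
      (\<forall>n. \<forall>\<omega>\<in>space (M n).
        minimizer (objective \<rho> {1..n} (obs \<mu>0 \<sigma>0 \<epsilon> n \<omega>) (sigma_hat n \<omega>)) (mu_hat n \<omega>)) \<and>
      asymp_normal M (\<lambda>n \<omega>. sqrt (real (card (\<zeta> n))) * (mu_hat n \<omega> - \<mu>0)) 0 (\<sigma>0\<^sup>2 * V))"
proof -
  obtain C where C: "C-lipschitz_on UNIV \<rho>" using c5 by blast
  obtain L where L: "L-lipschitz_on UNIV \<rho>''" using c8(3) by blast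
  define b where "b = 1 / varsig"
  have b: "b > 0" using c1(1) by (simp add: b_def)
  define t_good where "t_good = (\<lambda>n \<omega>. (mu_hat_good n \<omega> - \<mu>0) / \<sigma>0)"
  let ?h = "\<lambda>n. real (card (\<zeta> n))"
  have h_le: "card (\<zeta> n) \<le> n" for n using card_mono[OF _ good[of n]] by simp
  have errors_good[measurable]: "\<epsilon> n i \<in> borel_measurable (M n)" if "i \<in> \<zeta> n" for n i
    using that good by (intro errors) blast
  interpret iid_rows M \<zeta> \<epsilon> D
    by (rule iid_rows.intro[OF prob h_infinity c9_iid])
  interpret bounded_rho \<rho> \<rho>' \<rho>'' x_star rho_star C L
    by (rule bounded_rho.intro[OF rho c8(1,2) C L])
  \<comment> \<open>The moment conditions are stated on the spaces \<open>M n\<close>; one good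
    error carries them over to \<open>D\<close>.\<close>
  obtain n1 i1 where i1: "i1 \<in> \<zeta> n1"
    using eventually_happens[OF eventually_card_pos] by (auto simp: card_gt_0_iff)
  have scaled: "\<sigma>0 / (\<sigma>0 * varsig) = b" using sigma0 by (simp add: b_def)
  have norm_meas: "(\<lambda>\<omega>. sqrt (?h n) * (mu_hat_good n \<omega> - \<mu>0)) \<in> borel_measurable (M n)" for n
    using c10_minimizer(1) by measurable
  have var_pos: "\<sigma>0\<^sup>2 * V > 0" using sigma0 c10_normal(1) by simp
  interpret location_model M \<zeta> \<epsilon> D \<rho> \<rho>' \<rho>'' x_star rho_star C L b t_good
  proof unfold_locales
    show "b > 0" by (rule b)
    show "(\<Sum>i\<in>\<zeta> n. \<rho> (b * (\<epsilon> n i \<omega> - t_good n \<omega>))) \<le> (\<Sum>i\<in>\<zeta> n. \<rho> (b * (\<epsilon> n i \<omega> - u)))"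
      if "\<omega> \<in> space (M n)" for n \<omega> u
      using minimizer_objective_obs[OF sigma0 c10_minimizer(2)[OF that], of u]
      unfolding scaled t_good_def .
    show "with_large_prob M (\<lambda>n \<omega>. \<bar>t_good n \<omega>\<bar> \<le> d)" if d: "d > 0" for d
    proof (rule with_large_prob_mono[OF c6[of "\<sigma>0 * d"]])
      show "\<sigma>0 * d > 0" using sigma0 d by simp
      show "\<forall>\<^sub>F n in sequentially. \<forall>\<omega>\<in>space (M n).
        (\<forall>m. minimizer (objective \<rho> (\<zeta> n) (obs \<mu>0 \<sigma>0 \<epsilon> n \<omega>) (\<sigma>0 * varsig)) m \<longrightarrow>
          m \<in> {\<mu>0 - \<sigma>0 * d<..<\<mu>0 + \<sigma>0 * d}) \<longrightarrow> \<bar>t_good n \<omega>\<bar> \<le> d"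
      proof (intro always_eventually allI ballI impI)
        fix n \<omega>
        assume "\<omega> \<in> space (M n)" and "\<forall>m. minimizer (objective \<rho> (\<zeta> n) (obs \<mu>0 \<sigma>0 \<epsilon> n \<omega>) (\<sigma>0 * varsig)) m \<longrightarrow>
          m \<in> {\<mu>0 - \<sigma>0 * d<..<\<mu>0 + \<sigma>0 * d}"
        then have "mu_hat_good n \<omega> \<in> {\<mu>0 - \<sigma>0 * d<..<\<mu>0 + \<sigma>0 * d}"
          using c10_minimizer(2) by blast
        then have "\<bar>mu_hat_good n \<omega> - \<mu>0\<bar> \<le> d * \<sigma>0"
          unfolding abs_le_iff by (auto simp: mult.commute)
        then show "\<bar>t_good n \<omega>\<bar> \<le> d"
          using sigma0 by (simp add: t_good_def pos_divide_le_eq)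
      qed
    qed
    show "\<exists>K>0. likely M e (\<lambda>n \<omega>. ?h n * (t_good n \<omega>)\<^sup>2 \<le> K)" if e: "e > 0" for e
    proof -
      obtain K where K: "K > 0" "likely M e (\<lambda>n \<omega>. \<bar>sqrt (?h n) * (mu_hat_good n \<omega> - \<mu>0)\<bar> \<le> K)"
        by (rule asymp_normal_likely_bounded[OF prob norm_meas var_pos c10_normal(2) e])
      have "likely M e (\<lambda>n \<omega>. ?h n * (t_good n \<omega>)\<^sup>2 \<le> K\<^sup>2 / \<sigma>0\<^sup>2)"
      proof (rule likely_mono[OF K(2)], intro always_eventually allI ballI impI)
        fix n \<omega> assume "\<bar>sqrt (?h n) * (mu_hat_good n \<omega> - \<mu>0)\<bar> \<le> K"
        then have "(sqrt (?h n) * (mu_hat_good n \<omega> - \<mu>0))\<^sup>2 \<le> K\<^sup>2"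
          using K(1) by (simp add: abs_le_square_iff[symmetric])
        then show "?h n * (t_good n \<omega>)\<^sup>2 \<le> K\<^sup>2 / \<sigma>0\<^sup>2"
          by (simp add: t_good_def power_mult_distrib power_divide divide_right_mono)
      qed
      then show ?thesis using K(1) sigma0 by (intro exI[of _ "K\<^sup>2 / \<sigma>0\<^sup>2"]) simp
    qed
    have "(\<lambda>x. \<rho>'' (b * x)) \<in> borel_measurable borel" "(\<lambda>x. x * \<rho>'' (b * x)) \<in> borel_measurable borel"
      by measurable
    from this[THEN expectation_error[OF i1]]
    show "(\<integral>x. \<rho>'' (b * x) \<partial>D) > 0" "(\<integral>x. x * \<rho>'' (b * x) \<partial>D) = 0"
      using c9_moments(2,4)[OF i1] by (simp_all add: b_def)
  qed
  have sigma_meas: "sigma_hat n \<in> borel_measurable (M n)" for n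
  proof -
    have "(\<lambda>\<omega>. T n (\<lambda>i\<in>{1..n}. obs \<mu>0 \<sigma>0 \<epsilon> n \<omega> i)) \<in> borel_measurable (M n)"
      unfolding obs_def
      by (rule measurable_compose[OF measurable_restrict estimator]) (use errors in measurable)
    then show ?thesis using sigma_hat by (subst measurable_cong) auto
  qed
  \<comment> \<open>Both numbers are limits in probability of the same average, once by the law of
    large numbers and once by condition (3) at \<alpha> = \<open>varsig\<close>.\<close>
  have g0: "g 0 = rho_tilde varsig"
  proof (rule ccontr)
    assume neq: "g 0 \<noteq> rho_tilde varsig"
    define d where "d = \<bar>g 0 - rho_tilde varsig\<bar> / 3"
    have d: "d > 0" using neq by (simp add: d_def)
    have "with_large_prob M (\<lambda>n \<omega>. \<bar>avg (\<zeta> n) (\<lambda>i. \<rho> (b * (\<epsilon> n i \<omega> - 0))) - g 0\<bar> \<le> d \<and>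
        (\<forall>\<alpha>\<in>N. \<bar>(\<Sum>i\<in>\<zeta> n. \<rho> (\<epsilon> n i \<omega> / \<alpha>)) / ?h n - rho_tilde \<alpha>\<bar> \<le> d))"
      using c3(5) d unfolding unif_conv_in_prob_def by (intro with_large_prob_conj prob lln_rho) auto
    from likely_satisfiable[OF this[unfolded with_large_prob_iff_likely, rule_format, of 1]]
    obtain n \<omega> where n: "\<bar>avg (\<zeta> n) (\<lambda>i. \<rho> (b * (\<epsilon> n i \<omega> - 0))) - g 0\<bar> \<le> d"
      "\<bar>(\<Sum>i\<in>\<zeta> n. \<rho> (\<epsilon> n i \<omega> / varsig)) / ?h n - rho_tilde varsig\<bar> \<le> d"
      using c3(2) by (fastforce dest: eventually_happens)
    then have "\<bar>g 0 - rho_tilde varsig\<bar> \<le> 2 * d"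
      unfolding avg_def b_def abs_le_iff by simp
    then show False using neq by (simp add: d_def)
  qed
  have breakdown: "\<Lambda> * (2 * rho_star - g 0) > rho_star"
  proof -
    \<comment> \<open>Makes the denominator in condition (11) positive, so that it can be
      cleared.\<close>
    have "rho_tilde varsig / rho_star \<le> 1"
      using g_le_star[of 0] rho_star_pos by (simp add: g0)
    then have "1 < \<Lambda> * (2 - rho_tilde varsig / rho_star)"
      using c11 by (simp add: pos_divide_less_eq)
    then have "rho_star * 1 < rho_star * (\<Lambda> * (2 - rho_tilde varsig / rho_star))"
      using rho_star_pos by (rule mult_strict_left_mono)
    also have "\<dots> = \<Lambda> * (2 * rho_star - g 0)"
      using rho_star_pos by (simp add: g0 field_simps)
    finally show ?thesis by simp
  qed
  have square: "\<exists>K>0. likely M e (\<lambda>n \<omega>. avg (\<zeta> n) (\<lambda>i. (\<epsilon> n i \<omega>)\<^sup>2) \<le> K)" if e: "e > 0" for e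
  proof -
    have "(\<lambda>\<omega>. (\<Sum>i\<in>\<zeta> n. (\<epsilon> n i \<omega>)\<^sup>2) / ?h n) \<in> borel_measurable (M n)" for n
      by (intro borel_measurable_divide borel_measurable_sum) auto
    then obtain K where K: "K > 0" "likely M e (\<lambda>n \<omega>. \<bar>(\<Sum>i\<in>\<zeta> n. (\<epsilon> n i \<omega>)\<^sup>2) / ?h n\<bar> \<le> K)"
      using bounded_in_prob_likely[OF prob _ c2 e] by blast
    from K(2) have "likely M e (\<lambda>n \<omega>. avg (\<zeta> n) (\<lambda>i. (\<epsilon> n i \<omega>)\<^sup>2) \<le> K)"
      by (rule likely_mono) (simp add: avg_def abs_of_nonneg sum_nonneg)
    then show ?thesis using K(1) by blast
  qed
  have scale: "\<exists>K>0. likely M e (\<lambda>n \<omega>. sqrt (real n) * \<bar>\<sigma>0 / sigma_hat n \<omega> - b\<bar> \<le> K)" if e: "e > 0" for e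
  proof -
    have "(\<lambda>\<omega>. sqrt (real n) * (sigma_hat n \<omega> / \<sigma>0 - varsig)) \<in> borel_measurable (M n)" for n
      using sigma_meas by measurable
    then obtain K where K: "K > 0"
      "likely M e (\<lambda>n \<omega>. \<bar>sqrt (real n) * (sigma_hat n \<omega> / \<sigma>0 - varsig)\<bar> \<le> K)"
      using bounded_in_prob_likely[OF prob _ c7 e] by blast
    \<comment> \<open>From here on the relative scale deviates by at most \<open>varsig / 2\<close>,
      so it is bounded away from 0 and inversion is Lipschitz with constant
      \<open>2 / varsig\<^sup>2\<close>.\<close>
    have ev: "\<forall>\<^sub>F n in sequentially. 2 * K / varsig < sqrt (real n)"
      using filterlim_compose[OF sqrt_at_top filterlim_real_sequentially]
      unfolding filterlim_at_top_dense by blast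
    from K(2) have "likely M e (\<lambda>n \<omega>. sqrt (real n) * \<bar>\<sigma>0 / sigma_hat n \<omega> - b\<bar> \<le> 2 / varsig\<^sup>2 * K)"
    proof (rule likely_mono)
      show "\<forall>\<^sub>F n in sequentially. \<forall>\<omega>\<in>space (M n). \<bar>sqrt (real n) * (sigma_hat n \<omega> / \<sigma>0 - varsig)\<bar> \<le> K \<longrightarrow>
          sqrt (real n) * \<bar>\<sigma>0 / sigma_hat n \<omega> - b\<bar> \<le> 2 / varsig\<^sup>2 * K"
        using ev
      proof (eventually_elim, intro ballI impI)
        fix n \<omega>
        assume n: "2 * K / varsig < sqrt (real n)"
          and bd: "\<bar>sqrt (real n) * (sigma_hat n \<omega> / \<sigma>0 - varsig)\<bar> \<le> K"
        let ?r = "sigma_hat n \<omega> / \<sigma>0"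
        have root: "sqrt (real n) > 0" using n K(1) c1(1) by (meson divide_pos_pos less_trans mult_pos_pos zero_less_numeral)
        have bd': "sqrt (real n) * \<bar>?r - varsig\<bar> \<le> K"
          using bd root by (simp add: abs_mult)
        have "K \<le> sqrt (real n) * (varsig / 2)"
          using n c1(1) by (simp add: field_simps)
        then have "sqrt (real n) * \<bar>?r - varsig\<bar> \<le> sqrt (real n) * (varsig / 2)"
          using bd' by (rule order_trans[rotated])
        then have "\<bar>?r - varsig\<bar> \<le> varsig / 2" using root by (rule mult_left_le_imp_le)
        then have "\<bar>1 / ?r - 1 / varsig\<bar> \<le> 2 / varsig\<^sup>2 * \<bar>?r - varsig\<bar>"
          by (rule inverse_scale_close[OF c1(1)])
        then have "sqrt (real n) * \<bar>1 / ?r - 1 / varsig\<bar> \<le> sqrt (real n) * (2 / varsig\<^sup>2 * \<bar>?r - varsig\<bar>)"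
          using root by (intro mult_left_mono) auto
        also have "\<dots> = 2 / varsig\<^sup>2 * (sqrt (real n) * \<bar>?r - varsig\<bar>)"
          by (rule mult.left_commute)
        also have "\<dots> \<le> 2 / varsig\<^sup>2 * K"
          using bd' by (rule mult_left_mono) simp
        finally show "sqrt (real n) * \<bar>\<sigma>0 / sigma_hat n \<omega> - b\<bar> \<le> 2 / varsig\<^sup>2 * K"
          by (simp add: b_def)
      qed
    qed
    then show ?thesis using K(1) c1(1) by (intro exI[of _ "2 / varsig\<^sup>2 * K"]) simp
  qed
  have close: "with_large_prob M (\<lambda>n \<omega>.
      \<forall>m. minimizer (objective \<rho> {1..n} (obs \<mu>0 \<sigma>0 \<epsilon> n \<omega>) (sigma_hat n \<omega>)) m \<longrightarrow>
        \<bar>m - mu_hat_good n \<omega>\<bar> \<le> \<eta> / sqrt (real n))" if \<eta>: "\<eta> > 0" for \<eta>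
  proof -
    have "with_large_prob M (\<lambda>n \<omega>. \<forall>t.
      (\<forall>u. (\<Sum>i\<in>{1..n}. \<rho> (\<sigma>0 / sigma_hat n \<omega> * (\<epsilon> n i \<omega> - t)))
         \<le> (\<Sum>i\<in>{1..n}. \<rho> (\<sigma>0 / sigma_hat n \<omega> * (\<epsilon> n i \<omega> - u)))) \<longrightarrow>
      \<bar>t - t_good n \<omega>\<bar> \<le> (\<eta> / \<sigma>0) / sqrt (real n))"
      using good \<eta> sigma0
      by (intro minimizers_close_to_good[OF _ _ _ h_ratio square scale outlier_errors_large[OF prob errors c4] breakdown])
        auto
    then show ?thesis
    proof (rule with_large_prob_mono, intro always_eventually allI ballI impI)
      fix n \<omega> m
      assume H: "\<forall>t. (\<forall>u. (\<Sum>i\<in>{1..n}. \<rho> (\<sigma>0 / sigma_hat n \<omega> * (\<epsilon> n i \<omega> - t)))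
         \<le> (\<Sum>i\<in>{1..n}. \<rho> (\<sigma>0 / sigma_hat n \<omega> * (\<epsilon> n i \<omega> - u)))) \<longrightarrow>
        \<bar>t - t_good n \<omega>\<bar> \<le> (\<eta> / \<sigma>0) / sqrt (real n)"
        and m: "minimizer (objective \<rho> {1..n} (obs \<mu>0 \<sigma>0 \<epsilon> n \<omega>) (sigma_hat n \<omega>)) m"
      have "\<bar>(m - \<mu>0) / \<sigma>0 - t_good n \<omega>\<bar> \<le> (\<eta> / \<sigma>0) / sqrt (real n)"
        using H minimizer_objective_obs[OF sigma0 m] by blast
      then have "\<sigma>0 * \<bar>(m - \<mu>0) / \<sigma>0 - t_good n \<omega>\<bar> \<le> \<sigma>0 * ((\<eta> / \<sigma>0) / sqrt (real n))"
        using sigma0 by (intro mult_left_mono) auto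
      moreover have "m - mu_hat_good n \<omega> = \<sigma>0 * ((m - \<mu>0) / \<sigma>0 - t_good n \<omega>)"
        using sigma0 by (simp add: t_good_def field_simps)
      ultimately show "\<bar>m - mu_hat_good n \<omega>\<bar> \<le> \<eta> / sqrt (real n)"
        using sigma0 by (simp add: abs_mult)
    qed
  qed
  have "\<exists>m. m \<in> borel_measurable (M n) \<and>
      (\<forall>\<omega>\<in>space (M n). minimizer (objective \<rho> {1..n} (obs \<mu>0 \<sigma>0 \<epsilon> n \<omega>) (sigma_hat n \<omega>)) (m \<omega>))" for n
  proof -
    have obs_meas: "(\<lambda>\<omega>. obs \<mu>0 \<sigma>0 \<epsilon> n \<omega> i) \<in> borel_measurable (M n)" if "i \<in> {1..n}" for i
      unfolding obs_def using errors[OF that] by measurable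
    show ?thesis
      by (rule measurable_objective_minimizer[where I = "{1..n}" and y = "obs \<mu>0 \<sigma>0 \<epsilon> n",
            OF sigma_meas obs_meas finite_atLeastAtMost]) blast+
  qed
  then obtain mu_hat where mu_hat: "\<And>n. mu_hat n \<in> borel_measurable (M n)"
    "\<And>n \<omega>. \<omega> \<in> space (M n) \<Longrightarrow>
      minimizer (objective \<rho> {1..n} (obs \<mu>0 \<sigma>0 \<epsilon> n \<omega>) (sigma_hat n \<omega>)) (mu_hat n \<omega>)"
    by metis
  have "asymp_normal M (\<lambda>n \<omega>. sqrt (?h n) * (mu_hat n \<omega> - \<mu>0)) 0 (\<sigma>0\<^sup>2 * V)"
  proof (rule asymp_normal_perturb[OF prob norm_meas _ var_pos c10_normal(2)])
    show "(\<lambda>\<omega>. sqrt (?h n) * (mu_hat n \<omega> - \<mu>0)) \<in> borel_measurable (M n)" for n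
      using mu_hat(1) by measurable
    show "with_large_prob M (\<lambda>n \<omega>. \<bar>sqrt (?h n) * (mu_hat_good n \<omega> - \<mu>0) - sqrt (?h n) * (mu_hat n \<omega> - \<mu>0)\<bar> \<le> d)"
      if d: "d > 0" for d
    proof (rule with_large_prob_mono[OF close[OF d]], intro always_eventually allI ballI impI)
      fix n \<omega>
      assume \<omega>: "\<omega> \<in> space (M n)" and H: "\<forall>m. minimizer (objective \<rho> {1..n} (obs \<mu>0 \<sigma>0 \<epsilon> n \<omega>) (sigma_hat n \<omega>)) m \<longrightarrow>
        \<bar>m - mu_hat_good n \<omega>\<bar> \<le> d / sqrt (real n)"
      \<comment> \<open>Since \<open>h\<close> is at most \<open>n\<close>, closeness of order
        \<open>1 / sqrt n\<close> survives scaling by the square root of \<open>h\<close>.\<close>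
      have "sqrt (?h n) * \<bar>mu_hat n \<omega> - mu_hat_good n \<omega>\<bar> \<le> sqrt (real n) * (d / sqrt (real n))"
        using H mu_hat(2)[OF \<omega>] h_le[of n] by (intro mult_mono) auto
      \<comment> \<open>An inequality only, because for \<open>n = 0\<close> the left-hand side is
        0.\<close>
      also have "\<dots> \<le> d" using d by simp
      finally show "\<bar>sqrt (?h n) * (mu_hat_good n \<omega> - \<mu>0) - sqrt (?h n) * (mu_hat n \<omega> - \<mu>0)\<bar> \<le> d"
        by (simp add: right_diff_distrib[symmetric] abs_mult abs_minus_commute)
    qed
  qed
  then show ?thesis using close mu_hat by blast
qed

end
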